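(* Let $(W,S)$ be a Coxeter system without large odd endpoints. An element $w\in\mathrm{CFC}(W)$ is logarithmic if and only if it is torsion-free.
   Context: $(W,S)$ is a Coxeter system of finite rank: $W=\langle S\mid (st)^{m(s,t)}=1\rangle$, where $m(s,t)=m(t,s)\in\{1,2,\dots,\infty\}$, $m(s,t)=1$ iff $s=t$, and $m(s,t)=\infty$ means no relation. The Coxeter graph $\Gamma$ has vertex set $S$ and an edge $\{s,t\}$ labeled $m(s,t)$ whenever $m(s,t)\ge 3$. An expression for $w$ is a word in the free monoid $S^*$ representing $w$; it is reduced if it has minimal length $\ell(w)$. The support $\mathrm{supp}(w)$ is the set of generators occurring in any reduced expression of $w$. An endpoint is a vertex $s$ of $\Gamma$ of degree $1$; its weight is $m(s,t)$ for the unique $t$ adjacent to it. A large odd endpoint is an endpoint $s$ whose weight is odd (in particular finite) and at least $5$. $w$ is logarithmic if $\ell(w^k)=k\cdot\ell(w)$ for all $k\ge1$. $w$ is torsion-free if every connected component of the subgraph of $\Gamma$ induced by $\mathrm{supp}(w)$ describes an infinite Coxeter group. Two words are commutation equivalent if they differ by a sequence of moves $st\leftrightarrow ts$ with $m(s,t)=2$. An element is fully commutative (FC) if all its reduced expressions are commutation equivalent. A cyclic shift of a word is any word obtained by repeatedly moving the first letter to the end. $w$ is cyclically fully commutative, $w\in\mathrm{CFC}(W)$, if every cyclic shift of every reduced expression for $w$ is a reduced expression for an FC element. *)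

theory Defs
  imports "HOL-Algebra.Group" "HOL-Library.Extended_Nat"
begin

section \<open>Coxeter systems\<close>

definition coxeter_matrix :: "'a set \<Rightarrow> ('a \<Rightarrow> 'a \<Rightarrow> enat) \<Rightarrow> bool" where
  "coxeter_matrix S m \<longleftrightarrow>
     (\<forall>s\<in>S. \<forall>t\<in>S. m s t \<ge> 1 \<and> m s t = m t s \<and> (m s t = 1 \<longleftrightarrow> s = t))"

text \<open>
  The congruence on the free monoid of words over \<open>S\<close> generated by \<open>(st)^m(s,t) = 1\<close>. The relators
  for \<open>s = t\<close> give \<open>ss = 1\<close>, so every generator is its own inverse and the quotient monoid is the
  group with presentation \<open>\<langle>S | (st)^m(s,t) = 1\<rangle>\<close>; formal inverses of letters are not needed.
\<close>

inductive_set coxeter_cong :: "'a set \<Rightarrow> ('a \<Rightarrow> 'a \<Rightarrow> enat) \<Rightarrow> ('a list \<times> 'a list) set"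
  for S :: "'a set" and m :: "'a \<Rightarrow> 'a \<Rightarrow> enat" where
  refl: "u \<in> lists S \<Longrightarrow> (u, u) \<in> coxeter_cong S m"
| sym: "(u, v) \<in> coxeter_cong S m \<Longrightarrow> (v, u) \<in> coxeter_cong S m"
| trans: "(u, v) \<in> coxeter_cong S m \<Longrightarrow> (v, x) \<in> coxeter_cong S m \<Longrightarrow> (u, x) \<in> coxeter_cong S m"
| relator: "u \<in> lists S \<Longrightarrow> v \<in> lists S \<Longrightarrow> s \<in> S \<Longrightarrow> t \<in> S \<Longrightarrow> m s t = enat k \<Longrightarrow>
    (u @ concat (replicate k [s, t]) @ v, u @ v) \<in> coxeter_cong S m"

definition coxeter_group :: "'a set \<Rightarrow> ('a \<Rightarrow> 'a \<Rightarrow> enat) \<Rightarrow> 'a list set monoid" where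
  "coxeter_group S m =
     \<lparr>carrier = lists S // coxeter_cong S m,
      mult = (\<lambda>A B. \<Union>u\<in>A. \<Union>v\<in>B. coxeter_cong S m `` {u @ v}),
      one = coxeter_cong S m `` {[]}\<rparr>"

locale coxeter_system = group W for W (structure) +
  fixes S :: "'a set" and m :: "'a \<Rightarrow> 'a \<Rightarrow> enat"
  assumes finite_rank: "finite S"
    and generators_closed: "S \<subseteq> carrier W"
    and matrix: "coxeter_matrix S m"
    and presentation:
      "\<exists>\<phi>\<in>iso (coxeter_group S m) W. \<forall>s\<in>S. \<phi> (coxeter_cong S m `` {[s]}) = s"

lemma coxeter_cong_in_lists:
  "(u, v) \<in> coxeter_cong S m \<Longrightarrow> u \<in> lists S \<and> v \<in> lists S"
proof (induction rule: coxeter_cong.induct)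
  case (relator u v s t k)
  have "set (concat (replicate k [s, t])) \<subseteq> {s, t}" by (induction k) auto
  then show ?case using relator by (auto simp: in_lists_conv_set)
qed auto

lemma equiv_coxeter_cong: "equiv (lists S) (coxeter_cong S m)"
  by (rule equivI)
    (auto simp: refl_on_def sym_def trans_def dest: coxeter_cong_in_lists
      intro: coxeter_cong.refl coxeter_cong.sym coxeter_cong.trans)

lemma coxeter_cong_append_left:
  "(u, v) \<in> coxeter_cong S m \<Longrightarrow> x \<in> lists S \<Longrightarrow> (x @ u, x @ v) \<in> coxeter_cong S m"
proof (induction rule: coxeter_cong.induct)
  case (relator u v s t k)
  then show ?case using coxeter_cong.relator[of "x @ u" S v s t m k] by simp
next
  case (refl u)
  then show ?case by (intro coxeter_cong.refl) (auto simp: in_lists_conv_set)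
qed (auto intro: coxeter_cong.sym coxeter_cong.trans)

lemma coxeter_cong_append_right:
  "(u, v) \<in> coxeter_cong S m \<Longrightarrow> x \<in> lists S \<Longrightarrow> (u @ x, v @ x) \<in> coxeter_cong S m"
proof (induction rule: coxeter_cong.induct)
  case (relator u v s t k)
  then show ?case using coxeter_cong.relator[of u S "v @ x" s t m k] by simp
next
  case (refl u)
  then show ?case by (intro coxeter_cong.refl) (auto simp: in_lists_conv_set)
qed (auto intro: coxeter_cong.sym coxeter_cong.trans)

lemma coxeter_group_mult_class:
  assumes "u \<in> lists S" "v \<in> lists S"
  shows "(coxeter_cong S m `` {u}) \<otimes>\<^bsub>coxeter_group S m\<^esub> (coxeter_cong S m `` {v})
         = coxeter_cong S m `` {u @ v}"
proof -
  have "congruent2 (coxeter_cong S m) (coxeter_cong S m) (\<lambda>u v. coxeter_cong S m `` {u @ v})"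
    by (rule congruent2I[OF equiv_coxeter_cong equiv_coxeter_cong])
      (auto intro!: equiv_class_eq[OF equiv_coxeter_cong]
        coxeter_cong_append_left coxeter_cong_append_right)
  then show ?thesis
    using UN_equiv_class2[OF equiv_coxeter_cong equiv_coxeter_cong] assms
    by (fastforce simp: coxeter_group_def)
qed

lemma group_coxeter_group:
  assumes "coxeter_matrix S m"
  shows "group (coxeter_group S m)"
proof -
  have carrier: "carrier (coxeter_group S m) = lists S // coxeter_cong S m"
    and one: "\<one>\<^bsub>coxeter_group S m\<^esub> = coxeter_cong S m `` {[]}"
    by (simp_all add: coxeter_group_def)
  note mult = coxeter_group_mult_class
  have rev: "(rev u @ u, []) \<in> coxeter_cong S m" if "u \<in> lists S" for u
    using that
  proof (induction u)
    case Nil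
    then show ?case by (simp add: coxeter_cong.refl)
  next
    case (Cons a u)
    then have "a \<in> S" "u \<in> lists S" by auto
    moreover have "m a a = enat 1"
      using assms \<open>a \<in> S\<close> by (auto simp: coxeter_matrix_def one_enat_def)
    ultimately have "(rev u @ [a, a] @ u, rev u @ u) \<in> coxeter_cong S m"
      using coxeter_cong.relator[of "rev u" S u a a m 1] by (simp add: in_lists_conv_set)
    then show ?case
      using Cons.IH \<open>u \<in> lists S\<close> by (auto intro: coxeter_cong.trans)
  qed
  show ?thesis
  proof (rule groupI)
    fix x y
    assume "x \<in> carrier (coxeter_group S m)" "y \<in> carrier (coxeter_group S m)"
    then show "x \<otimes>\<^bsub>coxeter_group S m\<^esub> y \<in> carrier (coxeter_group S m)"
      unfolding carrier by (elim quotientE) (simp add: mult quotientI)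
  next
    show "\<one>\<^bsub>coxeter_group S m\<^esub> \<in> carrier (coxeter_group S m)"
      unfolding carrier one by (simp add: quotientI)
  next
    fix x y z
    assume "x \<in> carrier (coxeter_group S m)" "y \<in> carrier (coxeter_group S m)"
      "z \<in> carrier (coxeter_group S m)"
    then show "x \<otimes>\<^bsub>coxeter_group S m\<^esub> y \<otimes>\<^bsub>coxeter_group S m\<^esub> z =
      x \<otimes>\<^bsub>coxeter_group S m\<^esub> (y \<otimes>\<^bsub>coxeter_group S m\<^esub> z)"
      unfolding carrier by (elim quotientE) (simp add: mult)
  next
    fix x
    assume "x \<in> carrier (coxeter_group S m)"
    then obtain u where u: "u \<in> lists S" "x = coxeter_cong S m `` {u}"
      unfolding carrier by (elim quotientE)
    then show "\<one>\<^bsub>coxeter_group S m\<^esub> \<otimes>\<^bsub>coxeter_group S m\<^esub> x = x"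
      unfolding one by (simp add: mult)
    have ru: "rev u \<in> lists S" using u(1) by (simp add: in_lists_conv_set)
    have "coxeter_cong S m `` {rev u @ u} = coxeter_cong S m `` {[]}"
      using rev[OF u(1)] by (rule equiv_class_eq[OF equiv_coxeter_cong])
    then have "coxeter_cong S m `` {rev u} \<otimes>\<^bsub>coxeter_group S m\<^esub> x = \<one>\<^bsub>coxeter_group S m\<^esub>"
      unfolding one using u ru by (simp add: mult)
    moreover have "coxeter_cong S m `` {rev u} \<in> carrier (coxeter_group S m)"
      unfolding carrier using ru by (rule quotientI)
    ultimately show "\<exists>y\<in>carrier (coxeter_group S m).
      y \<otimes>\<^bsub>coxeter_group S m\<^esub> x = \<one>\<^bsub>coxeter_group S m\<^esub>" by blast
  qed
qed


section \<open>Expressions, length and support\<close>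

definition word_value :: "('a, 'b) monoid_scheme \<Rightarrow> 'a list \<Rightarrow> 'a" where
  "word_value W u = foldr (\<otimes>\<^bsub>W\<^esub>) u \<one>\<^bsub>W\<^esub>"

definition expressions :: "('a, 'b) monoid_scheme \<Rightarrow> 'a set \<Rightarrow> 'a \<Rightarrow> 'a list set" where
  "expressions W S w = {u \<in> lists S. word_value W u = w}"

definition len :: "('a, 'b) monoid_scheme \<Rightarrow> 'a set \<Rightarrow> 'a \<Rightarrow> nat" where
  "len W S w = (LEAST n. \<exists>u\<in>expressions W S w. length u = n)"

definition reduced_expressions :: "('a, 'b) monoid_scheme \<Rightarrow> 'a set \<Rightarrow> 'a \<Rightarrow> 'a list set" where
  "reduced_expressions W S w = {u \<in> expressions W S w. length u = len W S w}"

text \<open>All reduced expressions of an element use the same generators, so the union below is the set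
  of letters of any single one of them.\<close>

definition supp :: "('a, 'b) monoid_scheme \<Rightarrow> 'a set \<Rightarrow> 'a \<Rightarrow> 'a set" where
  "supp W S w = (\<Union>u\<in>reduced_expressions W S w. set u)"


section \<open>The Coxeter graph\<close>

text \<open>The edges of the subgraph of the Coxeter graph induced by \<open>J\<close>, as a symmetric relation. There
  are no loops because \<open>m s s = 1\<close>.\<close>

definition coxeter_edges :: "('a \<Rightarrow> 'a \<Rightarrow> enat) \<Rightarrow> 'a set \<Rightarrow> ('a \<times> 'a) set" where
  "coxeter_edges m J = {(s, t). s \<in> J \<and> t \<in> J \<and> m s t \<ge> 3}"

definition graph_components :: "('a \<Rightarrow> 'a \<Rightarrow> enat) \<Rightarrow> 'a set \<Rightarrow> 'a set set" where
  "graph_components m J = J // (coxeter_edges m J)\<^sup>*"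

definition endpoint :: "'a set \<Rightarrow> ('a \<Rightarrow> 'a \<Rightarrow> enat) \<Rightarrow> 'a \<Rightarrow> bool" where
  "endpoint S m s \<longleftrightarrow> s \<in> S \<and> card (coxeter_edges m S `` {s}) = 1"

definition endpoint_weight :: "'a set \<Rightarrow> ('a \<Rightarrow> 'a \<Rightarrow> enat) \<Rightarrow> 'a \<Rightarrow> enat" where
  "endpoint_weight S m s = m s (THE t. (s, t) \<in> coxeter_edges m S)"

definition large_odd_endpoint :: "'a set \<Rightarrow> ('a \<Rightarrow> 'a \<Rightarrow> enat) \<Rightarrow> 'a \<Rightarrow> bool" where
  "large_odd_endpoint S m s \<longleftrightarrow>
     endpoint S m s \<and> (\<exists>k. endpoint_weight S m s = enat k \<and> odd k \<and> k \<ge> 5)"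


section \<open>Logarithmic and torsion-free elements\<close>

definition logarithmic :: "('a, 'b) monoid_scheme \<Rightarrow> 'a set \<Rightarrow> 'a \<Rightarrow> bool" where
  "logarithmic W S w \<longleftrightarrow> (\<forall>k::nat. k \<ge> 1 \<longrightarrow> len W S (w [^]\<^bsub>W\<^esub> k) = k * len W S w)"

definition torsion_free ::
  "('a, 'b) monoid_scheme \<Rightarrow> 'a set \<Rightarrow> ('a \<Rightarrow> 'a \<Rightarrow> enat) \<Rightarrow> 'a \<Rightarrow> bool" where
  "torsion_free W S m w \<longleftrightarrow>
     (\<forall>C\<in>graph_components m (supp W S w). infinite (carrier (coxeter_group C m)))"


section \<open>Cyclically fully commutative elements\<close>

definition commutation_moves :: "'a set \<Rightarrow> ('a \<Rightarrow> 'a \<Rightarrow> enat) \<Rightarrow> ('a list \<times> 'a list) set" where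
  "commutation_moves S m =
     {(u @ [s, t] @ v, u @ [t, s] @ v) | u v s t.
        u \<in> lists S \<and> v \<in> lists S \<and> s \<in> S \<and> t \<in> S \<and> m s t = 2}"

definition commutation_equivalent ::
  "'a set \<Rightarrow> ('a \<Rightarrow> 'a \<Rightarrow> enat) \<Rightarrow> 'a list \<Rightarrow> 'a list \<Rightarrow> bool" where
  "commutation_equivalent S m u v \<longleftrightarrow> (u, v) \<in> (commutation_moves S m)\<^sup>*"

definition FC :: "('a, 'b) monoid_scheme \<Rightarrow> 'a set \<Rightarrow> ('a \<Rightarrow> 'a \<Rightarrow> enat) \<Rightarrow> 'a set" where
  "FC W S m = {w \<in> carrier W. \<forall>u\<in>reduced_expressions W S w. \<forall>v\<in>reduced_expressions W S w.
                 commutation_equivalent S m u v}"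

text \<open>\<open>rotate n u\<close> moves the first letter of \<open>u\<close> to the end \<open>n\<close> times.\<close>

definition CFC :: "('a, 'b) monoid_scheme \<Rightarrow> 'a set \<Rightarrow> ('a \<Rightarrow> 'a \<Rightarrow> enat) \<Rightarrow> 'a set" where
  "CFC W S m = {w \<in> carrier W. \<forall>u\<in>reduced_expressions W S w. \<forall>n.
                  \<exists>x\<in>FC W S m. rotate n u \<in> reduced_expressions W S x}"

end

theory Submission
  imports Defs Complex_Main
begin

text \<open>The main tool is Mozes' numbers game, the action of the group on the dual of the geometric
  representation: a word is reduced as soon as, from some starting vector, every value fired along
  it is positive. For a cyclically fully commutative \<open>w\<close> with full support on a component, the
  powers of a reduced word form a periodic sequence of letters. If \<open>i1 < i\<close> are consecutive
  occurrences of a letter, the fired values satisfy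
  \<open>x i1 + x i = \<Sum>k. a (f i) (f k) * x k\<close>, summed over the neighbours fired in between.

  Cyclic full commutativity says that an alternating chain \<open>s t s t \<dots>\<close> of length \<open>m s t\<close> can
  occur in the sequence only by wrapping around a full period. These are the bands: \<open>m s t = 2p+1\<close>,
  the occurrences of \<open>s\<close> and \<open>t\<close> in a period form \<open>(st)\<^sup>p\<close> cyclically, and \<open>t\<close> is the only
  neighbour of \<open>s\<close>. Without bands positivity propagates, since fired values keep growing along every
  chain. Bands with \<open>p = 1\<close>, and larger bands where \<open>t\<close> has only one further neighbour in the gap
  outside the band, are stripped off and put back by a relative version of this growth argument.
  If every letter occurs once per period or lies in a large band, positive values with
  \<open>x (i + n) = \<rho> * x i\<close>, \<open>\<rho> \<ge> 1\<close>, come from a Perron--Frobenius argument; here the infiniteness of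
  the component enters, as its form is not positive definite. In the converse direction, a finite
  component gives a factor of \<open>w\<close> of finite order.\<close>

section \<open>The numbers game\<close>

text \<open>The obstacle is the minus sign at the earlier occurrence in the recurrence. Along a
  chain of two letters without other neighbours the recurrence is that of the Chebyshev polynomials
  of the second kind. A growing start stays positive while the chain is shorter than the label and
  may turn negative beyond it, so chains of full length have to be controlled. Such a chain spans a
  period; the translate of its first position lies on it, at an even index \<open>2p\<close>, and
  one position more would leave both letters without further neighbours, a finite dihedral
  component. Hence the length, and with it the label, is the odd number \<open>2p + 1\<close>. At a
  gap with several neighbours, one contribution has to outweigh the subtracted value and another has
  to survive. In the exceptional gap of a band, the band's own position cannot outweigh it, so a
  single further neighbour is too few; this is the configuration that is stripped off. The
  Perron--Frobenius case uses that a positive play may start from any vector. Its parameter starts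
  at \<open>\<tau> = 1\<close>, where a nonnegative vector on which the form is not positive gives a
  subsolution, and \<open>\<rho>\<close> is \<open>\<tau> ^ n\<close>.\<close>

fun sinseq :: "real \<Rightarrow> nat \<Rightarrow> real" where
  "sinseq b 0 = 0"
| "sinseq b (Suc 0) = 1"
| "sinseq b (Suc (Suc n)) = b * sinseq b (Suc n) - sinseq b n"

text \<open>\<open>sinseq (2 * x) n\<close> is the Chebyshev polynomial of the second kind of degree
  \<open>n - 1\<close> at \<open>x\<close>, and its recurrence is the addition theorem for
  \<open>sin\<close>.\<close>

lemma sinseq_sin: "sinseq (2 * cos t) n * sin t = sin (real n * t)"
proof (induction "2 * cos t" n rule: sinseq.induct)
  case (3 n)
  have "sin (real (Suc (Suc n)) * t) + sin (real n * t) = 2 * sin (real (Suc n) * t) * cos t"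
    using sin_add[of "real (Suc n) * t" t] sin_diff[of "real (Suc n) * t" t]
    by (simp add: algebra_simps)
  then show ?case using 3 by (simp add: algebra_simps)
qed auto

lemma sinseq_two: "sinseq 2 n = real n"
  by (induction "2::real" n rule: sinseq.induct) auto

text \<open>The value at infinity is the limit of the finite ones. The label 1 gives
  \<open>-2\<close>, so diagonal entries need no separate case.\<close>

definition angle_coeff :: "enat \<Rightarrow> real" where
  "angle_coeff M = (case M of enat k \<Rightarrow> 2 * cos (pi / real k) | \<infinity> \<Rightarrow> 2)"

lemma sinseq_pos:
  assumes "M \<ge> 2" "n > 0" "enat n < M"
  shows "sinseq (angle_coeff M) n > 0"
proof (cases M)
  case (enat k)
  then have k: "k \<ge> 2" "n < k"
    using assms by (auto simp: numeral_eq_enat)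
  have s: "sin (pi / real k) > 0"
    using k by (intro sin_gt_zero) (auto simp: field_simps)
  have "sin (real n * (pi / real k)) > 0"
    using k assms(2) by (intro sin_gt_zero) (auto simp: field_simps)
  then show ?thesis
    using sinseq_sin[of "pi / real k" n] s enat
    by (metis angle_coeff_def enat.simps(4) zero_less_mult_pos2)
next
  case infinity
  then show ?thesis using assms by (simp add: angle_coeff_def sinseq_two)
qed

text \<open>Sines at and next to the half turn and the full turn. The first two govern chains of
  full length, the last three the trivial action of the relator.\<close>

lemma sinseq_order:
  assumes "k \<ge> 2"
  shows "sinseq (angle_coeff (enat k)) k = 0"
    and "sinseq (angle_coeff (enat k)) (k - 1) = 1"
    and "sinseq (angle_coeff (enat k)) (2 * k) = 0"
    and "sinseq (angle_coeff (enat k)) (2 * k + 1) = 1"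
    and "sinseq (angle_coeff (enat k)) (2 * k - 1) = -1"
proof -
  let ?t = "pi / real k"
  have s: "sin ?t > 0"
    using assms by (intro sin_gt_zero) (auto simp: field_simps)
  have e: "sinseq (angle_coeff (enat k)) n = sin (real n * ?t) / sin ?t" for n
    using sinseq_sin[of ?t n] s by (simp add: angle_coeff_def field_simps)
  have k0: "real k > 0" using assms by simp
  show "sinseq (angle_coeff (enat k)) k = 0" using k0 by (simp add: e)
  have "real (k - 1) * ?t = pi - ?t" using k0 assms by (simp add: field_simps of_nat_diff)
  then show "sinseq (angle_coeff (enat k)) (k - 1) = 1" using s by (simp add: e)
  have "real (2 * k) * ?t = 2 * pi" using k0 by (simp add: field_simps)
  then show "sinseq (angle_coeff (enat k)) (2 * k) = 0" by (simp only: e) simp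
  have "real (2 * k + 1) * ?t = ?t + 2 * pi" using k0 by (simp add: field_simps)
  then show "sinseq (angle_coeff (enat k)) (2 * k + 1) = 1" using s by (simp only: e) simp
  have "real (2 * k - 1) * ?t = 2 * pi - ?t" using k0 assms by (simp add: field_simps of_nat_diff)
  then show "sinseq (angle_coeff (enat k)) (2 * k - 1) = -1"
    using s by (simp only: e sin_diff) simp
qed

lemma sinseq_nonneg:
  assumes "M \<ge> 2" "enat n \<le> M"
  shows "sinseq (angle_coeff M) n \<ge> 0"
proof (cases "n = 0 \<or> enat n = M")
  case True
  then show ?thesis using sinseq_order(1)[of n] assms(1)
    by (cases "n = 0") (auto simp: numeral_eq_enat)
next
  case False
  then have "n > 0" "enat n < M" using assms(2) by auto
  then show ?thesis using sinseq_pos[OF assms(1), of n] by linarith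
qed

lemma angle_coeff_1: "angle_coeff 1 = -2"
  by (simp add: angle_coeff_def one_enat_def)

lemma angle_coeff_2: "angle_coeff 2 = 0"
  by (simp add: angle_coeff_def numeral_eq_enat)

lemma angle_coeff_ge_1: "angle_coeff M \<ge> 1" if "M \<ge> 3"
proof (cases M)
  case (enat k)
  then have k: "k \<ge> 3" using that by (auto simp: numeral_eq_enat)
  have "cos (pi / 3) \<le> cos (pi / real k)"
    using k by (intro cos_monotone_0_pi_le) (auto simp: field_simps)
  then show ?thesis using enat by (simp add: angle_coeff_def cos_60)
qed (simp add: angle_coeff_def)

lemma angle_coeff_lt_2: "angle_coeff (enat k) < 2" if "k \<ge> 2"
proof -
  have "cos (pi / real k) < cos 0"
    using that by (intro cos_monotone_0_pi) (auto simp: field_simps)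
  then show ?thesis by (simp add: angle_coeff_def)
qed

lemma enat_ge1_cases:
  fixes M :: enat assumes "M \<ge> 1" shows "M = 1 \<or> M = 2 \<or> M \<ge> 3"
proof (cases M)
  case (enat k)
  then show ?thesis using assms by (cases "k = 1 \<or> k = 2") (auto simp: numeral_eq_enat one_enat_def)
qed simp


section \<open>Alternating words\<close>

fun alt :: "'a \<Rightarrow> 'a \<Rightarrow> nat \<Rightarrow> 'a list" where
  "alt s t 0 = []"
| "alt s t (Suc n) = s # alt t s n"

lemma length_alt [simp]: "length (alt s t n) = n"
  by (induction n arbitrary: s t) auto

lemma set_alt: "set (alt s t n) \<subseteq> {s, t}"
  by (induction n arbitrary: s t) auto

lemma alt_snoc: "alt s t (Suc n) = alt s t n @ [if even n then s else t]"
  by (induction n arbitrary: s t) auto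

lemma rev_alt: "rev (alt s t n) = (if even n then alt t s n else alt s t n)"
proof (induction n arbitrary: s t)
  case (Suc n)
  have "rev (alt s t (Suc n)) = (if even n then s else t) # rev (alt s t n)"
    by (subst alt_snoc) simp
  then show ?case using Suc by auto
qed simp

lemma alt_add: "alt s t (i + j) = alt s t i @ (if even i then alt s t j else alt t s j)"
  by (induction i arbitrary: s t) auto

lemma concat_replicate_alt: "concat (replicate k [s, t]) = alt s t (2 * k)"
  by (induction k) auto

section \<open>Words modulo the relations, and reduced words\<close>

locale coxeter_data =
  fixes S :: "'a set" and m :: "'a \<Rightarrow> 'a \<Rightarrow> enat"
  assumes finite_S: "finite S" and cmatrix: "coxeter_matrix S m"
begin

abbreviation eqv :: "'a list \<Rightarrow> 'a list \<Rightarrow> bool" where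
  "eqv u v \<equiv> (u, v) \<in> coxeter_cong S m"

definition red :: "'a list \<Rightarrow> bool" where
  "red u \<longleftrightarrow> u \<in> lists S \<and> (\<forall>v. eqv u v \<longrightarrow> length u \<le> length v)"

text \<open>This is \<open>-2B(\<alpha>\<^sub>s, \<alpha>\<^sub>t)\<close> for the form \<open>B\<close> of the geometric representation, so the diagonal
  entries are \<open>-2\<close>.\<close>

definition a :: "'a \<Rightarrow> 'a \<Rightarrow> real" where
  "a s t = angle_coeff (m s t)"

definition adj :: "'a \<Rightarrow> 'a \<Rightarrow> bool" where
  "adj s t \<longleftrightarrow> m s t \<ge> 3"

lemma m_sym: "s \<in> S \<Longrightarrow> t \<in> S \<Longrightarrow> m s t = m t s"
  and m_self: "s \<in> S \<Longrightarrow> m s s = 1"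
  and m_ge_2: "s \<in> S \<Longrightarrow> t \<in> S \<Longrightarrow> s \<noteq> t \<Longrightarrow> m s t \<ge> 2"
  and m_not_adj: "s \<in> S \<Longrightarrow> t \<in> S \<Longrightarrow> s \<noteq> t \<Longrightarrow> \<not> adj s t \<Longrightarrow> m s t = 2"
proof -
  show "s \<in> S \<Longrightarrow> t \<in> S \<Longrightarrow> m s t = m t s" and "s \<in> S \<Longrightarrow> m s s = 1"
    using cmatrix by (auto simp: coxeter_matrix_def)
  have "m s t = 2 \<or> m s t \<ge> 3" if "s \<in> S" "t \<in> S" "s \<noteq> t"
    using enat_ge1_cases[of "m s t"] cmatrix that by (auto simp: coxeter_matrix_def)
  moreover have "(2::enat) \<le> M" if "3 \<le> M" for M
    by (rule order_trans[OF _ that]) (simp add: numeral_eq_enat)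
  ultimately show "s \<in> S \<Longrightarrow> t \<in> S \<Longrightarrow> s \<noteq> t \<Longrightarrow> m s t \<ge> 2"
    and "s \<in> S \<Longrightarrow> t \<in> S \<Longrightarrow> s \<noteq> t \<Longrightarrow> \<not> adj s t \<Longrightarrow> m s t = 2"
    by (auto simp: adj_def)
qed

lemma adj_sym: "s \<in> S \<Longrightarrow> t \<in> S \<Longrightarrow> adj s t \<longleftrightarrow> adj t s"
  using m_sym by (simp add: adj_def)

lemma adj_irrefl: "s \<in> S \<Longrightarrow> \<not> adj s s"
  by (simp add: adj_def m_self one_enat_def numeral_eq_enat)

lemma a_sym: "s \<in> S \<Longrightarrow> t \<in> S \<Longrightarrow> a s t = a t s"
  using m_sym by (simp add: a_def)

lemma a_self: "s \<in> S \<Longrightarrow> a s s = -2"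
  by (simp add: a_def m_self angle_coeff_1)

lemma a_adj: "adj s t \<Longrightarrow> a s t \<ge> 1"
  by (simp add: a_def adj_def angle_coeff_ge_1)

lemma a_not_adj: "s \<in> S \<Longrightarrow> t \<in> S \<Longrightarrow> s \<noteq> t \<Longrightarrow> \<not> adj s t \<Longrightarrow> a s t = 0"
  by (simp add: a_def m_not_adj angle_coeff_2)

lemma a_nonneg: "s \<in> S \<Longrightarrow> t \<in> S \<Longrightarrow> s \<noteq> t \<Longrightarrow> a s t \<ge> 0"
  using a_adj[of s t] a_not_adj[of s t] by (cases "adj s t") auto

lemma eqv_lists: "eqv u v \<Longrightarrow> u \<in> lists S \<and> v \<in> lists S"
  by (rule coxeter_cong_in_lists)

lemma eqv_append: "eqv u u' \<Longrightarrow> eqv v v' \<Longrightarrow> eqv (u @ v) (u' @ v')"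
  by (meson coxeter_cong.trans coxeter_cong_append_left coxeter_cong_append_right eqv_lists)

lemma eqv_cancel2:
  assumes "u \<in> lists S" "v \<in> lists S" "s \<in> S"
  shows "eqv (u @ [s, s] @ v) (u @ v)"
  using coxeter_cong.relator[of u S v s s m 1] assms by (simp add: m_self one_enat_def)

lemma eqv_rev:
  assumes "u \<in> lists S"
  shows "eqv (u @ rev u) []"
  using assms
proof (induction u)
  case Nil
  then show ?case by (simp add: coxeter_cong.refl)
next
  case (Cons s u)
  then have "eqv ([s] @ (u @ rev u) @ [s]) ([s] @ [] @ [s])"
    by (intro eqv_append) (auto intro: coxeter_cong.refl)
  moreover have "eqv ([s] @ [] @ [s]) []"
    using eqv_cancel2[of "[]" "[]" s] Cons by simp
  ultimately show ?case by (auto intro: coxeter_cong.trans)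
qed

lemma eqv_cancel_right:
  assumes "eqv (u @ x) (v @ x)"
  shows "eqv u v"
proof -
  have l: "u \<in> lists S" "v \<in> lists S" "x \<in> lists S" "rev x \<in> lists S"
    using eqv_lists[OF assms] by (auto simp: in_lists_conv_set)
  have e: "eqv (y @ x @ rev x) y" if "y \<in> lists S" for y
    using eqv_append[OF coxeter_cong.refl[OF that] eqv_rev[OF l(3)]] by simp
  have "eqv ((u @ x) @ rev x) ((v @ x) @ rev x)"
    by (rule eqv_append[OF assms coxeter_cong.refl[OF l(4)]])
  then show ?thesis
    using e[OF l(1)] e[OF l(2)] by (simp, meson coxeter_cong.sym coxeter_cong.trans)
qed

lemma eqv_braid:
  assumes "s \<in> S" "t \<in> S" "m s t = enat k"
  shows "eqv (alt s t k) (alt t s k)"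
proof -
  have l: "alt s t k \<in> lists S" "alt t s k \<in> lists S" "rev (alt t s k) \<in> lists S"
    using assms set_alt[of s t k] set_alt[of t s k] by (auto simp: in_lists_conv_set)
  have "rev (alt t s k) = (if even k then alt s t k else alt t s k)"
    by (rule rev_alt)
  then have "alt s t k @ rev (alt t s k) = concat (replicate k [s, t])"
    using alt_add[of s t k k] by (simp add: concat_replicate_alt mult_2)
  then have "eqv (alt s t k @ rev (alt t s k)) []"
    using coxeter_cong.relator[of "[]" S "[]" s t m k] assms by simp
  then have "eqv (alt s t k @ rev (alt t s k)) (alt t s k @ rev (alt t s k))"
    using eqv_rev[OF l(2)] by (meson coxeter_cong.sym coxeter_cong.trans)
  then show ?thesis by (rule eqv_cancel_right)
qed

lemma eqv_commute: "s \<in> S \<Longrightarrow> t \<in> S \<Longrightarrow> m s t = 2 \<Longrightarrow> eqv [s, t] [t, s]"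
  using eqv_braid[of s t 2] by (simp add: numeral_2_eq_2 numeral_eq_enat)

text \<open>Every relator has even length, so the sign character is well defined.\<close>

lemma eqv_parity: "eqv u v \<Longrightarrow> even (length u + length v)"
proof (induction rule: coxeter_cong.induct)
  case (relator u v s t k)
  have "length (concat (replicate k [s, t])) = 2 * k" by (induction k) auto
  then show ?case by simp
qed auto

lemma red_lists: "red u \<Longrightarrow> u \<in> lists S"
  by (simp add: red_def)

lemma red_eqv: "red u \<Longrightarrow> eqv u v \<Longrightarrow> length v \<le> length u \<Longrightarrow> red v"
  unfolding red_def using eqv_lists by (meson coxeter_cong.trans order.trans)

lemma red_append: "red (u @ v) \<Longrightarrow> red u" "red (u @ v) \<Longrightarrow> red v"
proof -
  assume r: "red (u @ v)"
  then have l: "u \<in> lists S" "v \<in> lists S" by (auto simp: red_def)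
  have "length u \<le> length u'" if "eqv u u'" for u'
    using r eqv_append[OF that coxeter_cong.refl[OF l(2)]] by (fastforce simp: red_def)
  then show "red u" using l by (simp add: red_def)
  have "length v \<le> length v'" if "eqv v v'" for v'
    using r eqv_append[OF coxeter_cong.refl[OF l(1)] that] by (fastforce simp: red_def)
  then show "red v" using l by (simp add: red_def)
qed

lemma not_red_square: "\<not> red (u @ [s, s] @ v)"
proof
  assume r: "red (u @ [s, s] @ v)"
  then have "eqv (u @ [s, s] @ v) (u @ v)" by (intro eqv_cancel2) (auto simp: red_def)
  then show False using r by (fastforce simp: red_def)
qed

text \<open>By parity a shorter word for \<open>u @ [s]\<close> is shorter by at least two, so
  appending \<open>s\<close> to it gives a reduced word for \<open>u\<close>.\<close>

lemma not_red_snoc: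
  assumes "red u" "s \<in> S" "\<not> red (u @ [s])"
  obtains v where "eqv u (v @ [s])" "length u = Suc (length v)" "red (v @ [s])"
proof -
  have l: "u @ [s] \<in> lists S" using assms by (auto simp: red_def)
  then obtain v where v: "eqv (u @ [s]) v" "length v < length (u @ [s])"
    using assms(3) by (auto simp: red_def not_le)
  have "even (length (u @ [s]) + length v)" by (rule eqv_parity[OF v(1)])
  then have lv: "Suc (length v) \<le> length u" using v(2) by (cases "length v = length u") auto
  have "eqv (u @ [s] @ [s]) (v @ [s])"
    using eqv_append[OF v(1) coxeter_cong.refl[of "[s]"]] assms(2) by auto
  moreover have "eqv (u @ [s] @ [s]) u"
    using eqv_cancel2[of u "[]" s] assms by (simp add: red_def)
  ultimately have e: "eqv u (v @ [s])" by (meson coxeter_cong.sym coxeter_cong.trans)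
  then have "length u = Suc (length v)" using lv assms(1) by (fastforce simp: red_def)
  then show ?thesis using that e red_eqv[OF assms(1) e] by simp
qed


section \<open>The moves of the game and the signs of its values\<close>

definition fire :: "'a \<Rightarrow> ('a \<Rightarrow> real) \<Rightarrow> 'a \<Rightarrow> real" where
  "fire s V = (\<lambda>t. V t + a t s * V s)"

definition play :: "'a list \<Rightarrow> ('a \<Rightarrow> real) \<Rightarrow> 'a \<Rightarrow> real" where
  "play u = fold fire u"

lemma play_Nil [simp]: "play [] V = V"
  and play_Cons [simp]: "play (s # u) V = play u (fire s V)"
  and play_append: "play (u @ v) V = play v (play u V)"
  by (simp_all add: play_def)

lemma play_snoc: "play (u @ [s]) V t = play u V t + a t s * play u V s"
  by (simp add: play_append fire_def)

lemma play_linear: "play u (\<lambda>t. c * V t + d * V' t) = (\<lambda>t. c * play u V t + d * play u V' t)"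
proof (induction u arbitrary: V V')
  case (Cons s u)
  have "fire s (\<lambda>t. c * V t + d * V' t) = (\<lambda>t. c * fire s V t + d * fire s V' t)"
    by (auto simp: fire_def algebra_simps)
  then show ?case using Cons[of "fire s V" "fire s V'"] by simp
qed simp

lemma play_add: "play u (\<lambda>t. V t + V' t) s = play u V s + play u V' s"
  using play_linear[of u 1 V 1 V'] by simp

lemma play_cong:
  assumes "set u \<subseteq> A" "\<And>t. t \<in> A \<Longrightarrow> V t = V' t" "s \<in> A"
  shows "play u V s = play u V' s"
  using assms
proof (induction u arbitrary: V V')
  case (Cons x u)
  show ?case unfolding play_Cons
    by (rule Cons.IH) (use Cons.prems in \<open>auto simp: fire_def\<close>)
qed simp

text \<open>The letter fired last holds the negative of the value it was fired with, and the next
  one to be fired follows the Chebyshev recurrence. The parity tests tell which of the two letters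
  is which.\<close>

lemma play_alt:
  assumes "s \<in> S" "t \<in> S" "s \<noteq> t"
  shows "play (alt s t n) V (if even n then s else t) =
      sinseq (a s t) (Suc n) * V s + sinseq (a s t) n * V t"
    and "n > 0 \<Longrightarrow> play (alt s t n) V (if even n then t else s) =
      - (sinseq (a s t) n * V s + sinseq (a s t) (n - 1) * V t)"
proof -
  have fire: "fire s V s = - V s" "fire s V t = V t + a s t * V s" if "s \<in> S" "t \<in> S" for s t V
    using that by (simp_all add: fire_def a_self a_sym[of t s])
  show 1: "play (alt s t n) V (if even n then s else t) =
      sinseq (a s t) (Suc n) * V s + sinseq (a s t) n * V t"
    using assms
  proof (induction n arbitrary: s t V)
    case (Suc n)
    have "play (alt s t (Suc n)) V (if even (Suc n) then s else t) =
       sinseq (a t s) (Suc n) * fire s V t + sinseq (a t s) n * fire s V s"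
      using Suc.IH[of t s "fire s V"] Suc.prems by auto
    then show ?case using Suc.prems by (simp add: fire a_sym[of t s] algebra_simps)
  qed simp
  show "n > 0 \<Longrightarrow> play (alt s t n) V (if even n then t else s) =
      - (sinseq (a s t) n * V s + sinseq (a s t) (n - 1) * V t)"
    using assms
  proof (induction n arbitrary: s t V)
    case (Suc n)
    show ?case
    proof (cases "n = 0")
      case True
      then show ?thesis using Suc.prems by (simp add: fire)
    next
      case False
      have "play (alt s t (Suc n)) V (if even (Suc n) then t else s) =
         - (sinseq (a t s) n * fire s V t + sinseq (a t s) (n - 1) * fire s V s)"
        using Suc.IH[of t s "fire s V"] Suc.prems False by auto
      moreover obtain n' where "n = Suc n'" using False by (cases n) auto
      ultimately show ?thesis using Suc.prems by (simp add: fire a_sym[of t s] algebra_simps)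
    qed
  qed simp
qed

text \<open>\<open>X\<close> and \<open>Y\<close> accumulate the values fired at \<open>s\<close>
  and at \<open>t\<close>, the same for every \<open>y\<close>.\<close>

lemma play_two_letters:
  assumes "set u \<subseteq> {s, t}"
  obtains X Y where "\<And>y. play u V y = V y + a y s * X + a y t * Y"
proof -
  have "\<exists>X Y. \<forall>y. play u V y = V y + a y s * X + a y t * Y"
    using assms
  proof (induction u arbitrary: V)
    case Nil
    then show ?case by (intro exI[of _ 0]) simp
  next
    case (Cons x u)
    then obtain X Y where XY: "play u (fire x V) y = fire x V y + a y s * X + a y t * Y" for y
      by fastforce
    show ?case
    proof (cases "x = s")
      case True
      then have "\<forall>y. play (x # u) V y = V y + a y s * (X + V x) + a y t * Y"
        using XY by (simp add: fire_def algebra_simps)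
      then show ?thesis by blast
    next
      case False
      then have "\<forall>y. play (x # u) V y = V y + a y s * X + a y t * (Y + V x)"
        using XY Cons.prems by (auto simp: fire_def algebra_simps)
      then show ?thesis by blast
    qed
  qed
  then show ?thesis using that by blast
qed

lemma play_relator:
  assumes "s \<in> S" "t \<in> S" "m s t = enat k"
  shows "play (concat (replicate k [s, t])) V = V"
proof (cases "s = t")
  case True
  then have "k = 1" using assms by (simp add: m_self one_enat_def)
  then show ?thesis using True assms by (auto simp: fire_def a_self)
next
  case False
  have k: "k \<ge> 2" using m_ge_2[OF assms(1,2) False] assms(3) by (simp add: numeral_eq_enat)
  define A where "A = a s t"
  have A: "A < 2" "A \<ge> 0"
    using angle_coeff_lt_2[OF k] a_nonneg[OF assms(1,2) False] assms by (simp_all add: A_def a_def)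
  note ord = sinseq_order[OF k, folded assms(3), folded a_def]
  let ?u = "alt s t (2 * k)"
  have s: "play ?u V s = V s" and t: "play ?u V t = V t"
    using play_alt[OF assms(1,2) False, where n = "2 * k" and V = V] ord k by simp_all
  obtain X Y where XY: "\<And>y. play ?u V y = V y + a y s * X + a y t * Y"
    using play_two_letters[OF set_alt] by metis
  have X2: "2 * X = A * Y" and Y2: "2 * Y = A * X"
    using XY[of s] XY[of t] s t assms a_self a_sym[of t s] by (auto simp: A_def)
  \<comment> \<open>Values unchanged at \<open>s\<close> and \<open>t\<close> give two linear
    equations for \<open>X\<close> and \<open>Y\<close> with determinant
    \<open>(2 - A) * (2 + A)\<close>, which is nonzero because the label is finite. So
    \<open>X = Y = 0\<close> and no other letter changes either.\<close>
  have "2 * (2 * X) = A * (A * X)" using X2 Y2 by (metis mult.left_commute)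
  then have "(2 - A) * (2 + A) * X = 0" by (simp add: algebra_simps)
  then have "X = 0" using A by simp
  moreover have "Y = 0" using Y2 \<open>X = 0\<close> by simp
  ultimately show ?thesis using XY by (auto simp: concat_replicate_alt)
qed

lemma play_eqv: "eqv u v \<Longrightarrow> play u = play v"
proof (induction rule: coxeter_cong.induct)
  case (relator u v s t k)
  then show ?case by (auto simp: play_append play_relator)
qed auto

lemma play_rev: "u \<in> lists S \<Longrightarrow> play (rev u) (play u V) = V"
  using play_eqv[OF eqv_rev[of u]] by (simp add: play_append[symmetric])

text \<open>The dual form of Tits' theorem that \<open>u \<alpha>\<^sub>s\<close> is a positive root whenever
  \<open>us\<close> is longer than \<open>u\<close>.\<close>

lemma play_nonneg:
  assumes "red (u @ [s])" "\<And>t. t \<in> S \<Longrightarrow> V t \<ge> 0"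
  shows "play u V s \<ge> 0"
  using assms
proof (induction "length u" arbitrary: u s rule: less_induct)
  case less
  have s: "s \<in> S" using less.prems(1) by (simp add: red_def)
  have ru: "red u" using red_append(1)[OF less.prems(1)] .
  show ?case
  proof (cases u rule: rev_cases)
    case Nil
    then show ?thesis using less.prems s by simp
  next
    case (snoc u0 t)
    have t: "t \<in> S" using ru snoc by (simp add: red_def)
    have st: "s \<noteq> t"
      using less.prems(1) snoc not_red_square[of u0 t "[]"] by auto
    \<comment> \<open>Words for \<open>u\<close> that end in an alternating word of length
      \<open>k\<close> with last letter \<open>t\<close>. For maximal \<open>k\<close> this splits
      off a dihedral factor in \<open>s\<close> and \<open>t\<close> from a word \<open>v\<close>
      that neither letter shortens.\<close>
    define P where "P k \<longleftrightarrow> (\<exists>v. eqv u (v @ rev (alt t s k)) \<and> length v + k = length u)" for k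
    have P1: "P 1" unfolding P_def
      by (rule exI[of _ u0]) (use snoc ru red_lists in \<open>auto intro: coxeter_cong.refl\<close>)
    have bound: "\<And>k. P k \<Longrightarrow> k \<le> length u" by (auto simp: P_def)
    define k where "k = Greatest P"
    have Pk: "P k" unfolding k_def using GreatestI_nat[of P 1, OF P1] bound by blast
    have kmax: "j \<le> k" if "P j" for j unfolding k_def
      by (rule Greatest_le_nat[of P j "length u"]) (use that bound in auto)
    have k1: "k \<ge> 1" using kmax[OF P1] .
    obtain v where v: "eqv u (v @ rev (alt t s k))" "length v + k = length u"
      using Pk by (auto simp: P_def)
    have rvd: "red (v @ rev (alt t s k))" using red_eqv[OF ru v(1)] v(2) by simp
    have rv: "red v" and vl: "v \<in> lists S" using red_append(1)[OF rvd] red_lists by auto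
    define e1 e2 where "e1 = (if even k then s else t)" and "e2 = (if even k then t else s)"
    have e: "e1 \<in> S" "e2 \<in> S" "e1 \<noteq> e2" "{e1, e2} = {s, t}"
      using s t st by (auto simp: e1_def e2_def)
    have d: "rev (alt t s k) = alt e1 e2 k" by (auto simp: rev_alt e1_def e2_def)
    \<comment> \<open>Otherwise a braid move makes the suffix of length \<open>m s t\<close> end in
      \<open>s\<close>, and appending \<open>s\<close> produces a square.\<close>
    have km: "enat k < m s t"
    proof (rule ccontr)
      assume "\<not> enat k < m s t"
      then obtain M where M: "m s t = enat M" "M \<le> k" by (cases "m s t") auto
      define j where "j = k - M"
      have "alt t s k = alt t s M @ (if even M then alt t s j else alt s t j)"
        using alt_add[of t s M j] M by (simp add: j_def)
      then have split: "rev (alt t s k) = rev (if even M then alt t s j else alt s t j) @ rev (alt t s M)"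
        by simp
      obtain v' where v': "v @ rev (alt t s k) = v' @ rev (alt t s M)"
        using split by (metis append.assoc)
      have v'l: "v' \<in> lists S"
        using rvd v' by (auto simp: red_def)
      have "eqv (rev (alt t s M)) (rev (alt s t M))"
        using eqv_braid[OF s t M(1)] by (auto simp: rev_alt intro: coxeter_cong.sym)
      moreover obtain M' where "M = Suc M'"
        using m_ge_2[OF s t st] M by (cases M) (auto simp: numeral_eq_enat)
      ultimately have "eqv (rev (alt t s M)) (rev (alt t s M') @ [s])" by simp
      then have "eqv (v' @ rev (alt t s M)) (v' @ rev (alt t s M') @ [s])"
        using eqv_append[OF coxeter_cong.refl[OF v'l]] by blast
      then have e: "eqv u (v' @ rev (alt t s M') @ [s])" using v(1) v' by (auto intro: coxeter_cong.trans)
      have "eqv (u @ [s]) ((v' @ rev (alt t s M') @ [s]) @ [s])"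
        using eqv_append[OF e coxeter_cong.refl[of "[s]"]] s by auto
      then have "red ((v' @ rev (alt t s M') @ [s]) @ [s])"
        using red_eqv[OF less.prems(1)] v(2) v' \<open>M = Suc M'\<close>
        by (metis add_Suc_right length_append length_append_singleton length_rev length_alt order_refl append.assoc)
      then show False using not_red_square[of "v' @ rev (alt t s M')" s "[]"] by simp
    qed
    \<comment> \<open>\<open>v @ [e1]\<close> is a prefix of a reduced word. If \<open>v\<close>
      could be written with last letter \<open>e2\<close>, the alternating suffix could be
      lengthened, against the maximality of \<open>k\<close>.\<close>
    have r: "red (v @ [e1])" "red (v @ [e2])"
    proof -
      obtain k' where k': "k = Suc k'" using k1 by (cases k) auto
      show "red (v @ [e1])"
        using red_append(1)[of "v @ [e1]" "alt e2 e1 k'"] rvd d k' by simp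
      show "red (v @ [e2])"
      proof (rule ccontr)
        assume "\<not> red (v @ [e2])"
        then obtain v' where v': "eqv v (v' @ [e2])" "length v = Suc (length v')"
          using not_red_snoc[OF rv e(2)] by metis
        have "alt e1 e2 k \<in> lists S" using set_alt[of e1 e2 k] e by (auto simp: in_lists_conv_set)
        then have "eqv (v @ alt e1 e2 k) ((v' @ [e2]) @ alt e1 e2 k)"
          by (intro eqv_append v' coxeter_cong.refl)
        moreover have "[e2] @ alt e1 e2 k = rev (alt t s (Suc k))"
          by (subst rev_alt) (simp add: e1_def e2_def)
        ultimately have "eqv u (v' @ rev (alt t s (Suc k)))"
          using v(1) d by (metis append.assoc coxeter_cong.trans)
        then have "P (Suc k)" unfolding P_def using v' v(2) by auto
        then show False using kmax by fastforce
      qed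
    qed
    have lv: "length v < length u" using v(2) k1 by simp
    have nn: "play v V e1 \<ge> 0" "play v V e2 \<ge> 0"
      using less.hyps[OF lv r(1)] less.hyps[OF lv r(2)] less.prems(2) by auto
    have "s = (if even k then e1 else e2)" by (simp add: e1_def e2_def)
    then have "play (alt e1 e2 k) (play v V) s =
        sinseq (a e1 e2) (Suc k) * play v V e1 + sinseq (a e1 e2) k * play v V e2"
      using play_alt(1)[OF e(1,2,3), of k "play v V"] by simp
    moreover have "a e1 e2 = angle_coeff (m s t)"
      using m_sym[OF s t] by (auto simp: a_def e1_def e2_def)
    moreover have "enat (Suc k) \<le> m s t" using km by (simp add: Suc_ile_eq)
    ultimately have "play (alt e1 e2 k) (play v V) s \<ge> 0"
      using nn sinseq_nonneg[OF m_ge_2[OF s t st]] km by simp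
    then show ?thesis
      using play_eqv[OF v(1)] d by (simp add: play_append)
  qed
qed

text \<open>\<open>V'\<close> is the vector that \<open>u\<close> takes to the unit vector at
  \<open>s\<close>. A small multiple of it can be subtracted from a strictly positive
  \<open>V\<close> without leaving the nonnegative cone, and this multiple is the positive margin at
  \<open>s\<close>.\<close>

lemma play_pos:
  assumes "red (u @ [s])" "\<And>t. t \<in> S \<Longrightarrow> V t > 0"
  shows "play u V s > 0"
proof -
  have l: "u \<in> lists S" "s \<in> S" using assms(1) by (auto simp: red_def)
  define D where "D = (\<lambda>t. if t = s then 1 else (0::real))"
  define V' where "V' = play (rev u) D"
  have V': "play u V' = D"
    using play_rev[of "rev u" D] l by (simp add: V'_def in_lists_conv_set)
  have "\<exists>\<epsilon>>0. \<forall>t\<in>S. \<epsilon> * V' t \<le> V t"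
    using finite_S assms(2)
  proof (induction S rule: finite_induct)
    case empty
    then show ?case by (intro exI[of _ 1]) simp
  next
    case (insert x F)
    then obtain \<epsilon> where e: "\<epsilon> > 0" "\<forall>t\<in>F. \<epsilon> * V' t \<le> V t" by auto
    define d where "d = min \<epsilon> (V x / (\<bar>V' x\<bar> + 1))"
    have Vx: "V x > 0" using insert.prems by simp
    then have d0: "d > 0" using e by (simp add: d_def)
    have "d * V' x \<le> d * (\<bar>V' x\<bar> + 1)" using d0 by (intro mult_left_mono) auto
    also have "\<dots> \<le> V x / (\<bar>V' x\<bar> + 1) * (\<bar>V' x\<bar> + 1)"
      by (intro mult_right_mono) (auto simp: d_def)
    also have "\<dots> = V x" by simp
    finally have "d * V' x \<le> V x" .
    moreover have "d * V' t \<le> V t" if "t \<in> F" for t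
    proof (cases "V' t \<ge> 0")
      case True
      then have "d * V' t \<le> \<epsilon> * V' t" by (intro mult_right_mono) (auto simp: d_def)
      then show ?thesis using e that by force
    next
      case False
      then have "d * V' t \<le> 0" using d0 by (simp add: mult_nonneg_nonpos)
      also have "0 \<le> V t" using insert.prems that by (auto intro: less_imp_le)
      finally show ?thesis .
    qed
    ultimately show ?case using d0 by auto
  qed
  then obtain \<epsilon> where e: "\<epsilon> > 0" "\<forall>t\<in>S. \<epsilon> * V' t \<le> V t" by auto
  have "play u (\<lambda>t. 1 * V t + (- \<epsilon>) * V' t) s \<ge> 0"
    using e by (intro play_nonneg assms(1)) auto
  then have "play u V s \<ge> \<epsilon> * play u V' s" unfolding play_linear by simp
  then show ?thesis using e V' by (simp add: D_def)
qed

text \<open>Here \<open>u\<close> has a reduced word ending in \<open>s\<close>, and firing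
  \<open>s\<close> last negates the value there.\<close>

lemma play_nonpos:
  assumes "red u" "s \<in> S" "\<not> red (u @ [s])" "\<And>t. t \<in> S \<Longrightarrow> V t \<ge> 0"
  shows "play u V s \<le> 0"
proof -
  obtain v where v: "eqv u (v @ [s])" "red (v @ [s])"
    using not_red_snoc[OF assms(1-3)] by metis
  have "play u V s = - play v V s"
    using play_eqv[OF v(1)] assms(2) by (simp add: play_snoc a_self)
  then show ?thesis using play_nonneg[OF v(2) assms(4)] by simp
qed

lemma play_neg:
  assumes "red u" "s \<in> S" "\<not> red (u @ [s])" "\<And>t. t \<in> S \<Longrightarrow> V t > 0"
  shows "play u V s < 0"
proof -
  obtain v where v: "eqv u (v @ [s])" "red (v @ [s])"
    using not_red_snoc[OF assms(1-3)] by metis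
  have "play u V s = - play v V s"
    using play_eqv[OF v(1)] assms(2) by (simp add: play_snoc a_self)
  then show ?thesis using play_pos[OF v(2) assms(4)] by simp
qed

definition unit_at :: "'a \<Rightarrow> 'a \<Rightarrow> real" where
  "unit_at t = (\<lambda>z. if z = t then 1 else 0)"

lemma play_expand:
  assumes "set u \<subseteq> S" "s \<in> S"
  shows "play u V s = (\<Sum>t\<in>S. V t * play u (unit_at t) s)"
proof -
  have "play u (\<lambda>z. \<Sum>t\<in>F. V t * unit_at t z) s = (\<Sum>t\<in>F. V t * play u (unit_at t) s)"
    if "finite F" for F
    using that
  proof (induction F rule: finite_induct)
    case empty
    show ?case using play_linear[of u 0 V 0 V] by simp
  next
    case (insert x F)
    have "play u (\<lambda>z. \<Sum>t\<in>insert x F. V t * unit_at t z) =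
        play u (\<lambda>z. V x * unit_at x z + 1 * (\<Sum>t\<in>F. V t * unit_at t z))"
      using insert by (simp add: fun_eq_iff)
    then show ?case using insert by (simp only: play_linear) simp
  qed
  from this[OF finite_S] show ?thesis
    using play_cong[of u S V "\<lambda>z. \<Sum>t\<in>S. V t * unit_at t z" s] assms finite_S
    by (auto simp: unit_at_def if_distrib cong: if_cong)
qed

text \<open>If the word is not reduced, two of the fired values are negative multiples of each other,
  for any initial position \<open>V\<close>.\<close>

lemma legal_play_red:
  assumes "w \<in> lists S" "\<And>k. k < length w \<Longrightarrow> play (take k w) V (w ! k) > 0"
  shows "red w"
proof (rule ccontr)
  assume "\<not> red w"
  define k where "k = (LEAST k. \<not> red (take (Suc k) w))"
  have w0: "w \<noteq> []" using \<open>\<not> red w\<close> by (auto simp: red_def)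
  have ex: "\<not> red (take (Suc (length w - 1)) w)" using \<open>\<not> red w\<close> w0 by simp
  have k: "\<not> red (take (Suc k) w)" unfolding k_def
    by (rule LeastI[of "\<lambda>k. \<not> red (take (Suc k) w)", OF ex])
  have kl: "k < length w"
    using Least_le[of "\<lambda>k. \<not> red (take (Suc k) w)", OF ex] w0
    unfolding k_def[symmetric] by (cases w) auto
  have ru: "red (take k w)"
  proof (cases k)
    case 0
    then show ?thesis by (simp add: red_def)
  next
    case (Suc k')
    then show ?thesis using not_less_Least[of k' "\<lambda>k. \<not> red (take (Suc k) w)"]
      unfolding k_def[symmetric] by auto
  qed
  define u s where "u = take k w" and "s = w ! k"
  have us: "take (Suc k) w = u @ [s]" using kl by (simp add: u_def s_def take_Suc_conv_app_nth)
  have s: "s \<in> S" using assms(1) kl by (auto simp: s_def in_lists_conv_set)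
  have lu: "length u = k" using kl by (simp add: u_def)
  have uS: "set u \<subseteq> S" using assms(1) by (auto simp: u_def in_lists_conv_set dest: in_set_takeD)
  \<comment> \<open>\<open>P i\<close> says that the tail \<open>drop i u\<close> takes the simple
    root of \<open>s\<close> to a positive root. This fails for all of \<open>u\<close> and holds
    for the empty tail, so the sign changes across some letter \<open>si\<close>.\<close>
  define P where "P i \<longleftrightarrow> (\<forall>V'. (\<forall>t\<in>S. V' t \<ge> 0) \<longrightarrow> play (drop i u) V' s \<ge> 0)" for i
  have "\<not> P 0"
  proof -
    have "play u (\<lambda>_. 1) s < 0"
      by (rule play_neg) (use ru s k us u_def in auto)
    then show ?thesis by (auto simp: P_def intro!: exI[of _ "\<lambda>_. 1"])
  qed
  moreover have "P k" using s lu by (simp add: P_def)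
  ultimately obtain i where i: "i < k" "\<not> P i" "P (Suc i)"
    using ex_least_nat_less[of P k] by (metis Suc_leI gr_zeroI le_less lessI)
  define g si where "g = drop (Suc i) u" and "si = u ! i"
  have di: "drop i u = si # g" using i lu by (simp add: g_def si_def Cons_nth_drop_Suc)
  have siS: "si \<in> S" using uS i lu by (auto simp: si_def)
  have gS: "set g \<subseteq> S" using uS by (auto simp: g_def dest: in_set_dropD)
  have "red (drop i u)" using red_append(2)[of "take i u" "drop i u"] ru
    by (simp only: append_take_drop_id u_def[symmetric])
  moreover have "\<not> red (drop i u @ [s])" using i(2) play_nonneg[of "drop i u" s] by (auto simp: P_def)
  ultimately have np: "play (drop i u) V' s \<le> 0" if "\<forall>t\<in>S. V' t \<ge> 0" for V'
    using play_nonpos[of "drop i u" s V'] s that by auto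
  \<comment> \<open>The reflection in \<open>si\<close> alters only the coefficient of
    \<open>si\<close>. As it turns a positive root into a negative one, all other coefficients
    vanish, and the root is \<open>c\<close> times the simple root of \<open>si\<close>.\<close>
  have zero: "play g (unit_at t) s = 0" if "t \<in> S" "t \<noteq> si" for t
  proof -
    have "fire si (unit_at t) = unit_at t" using that by (auto simp: fire_def unit_at_def)
    then have "play g (unit_at t) s \<le> 0" using np[of "unit_at t"] di by (simp add: unit_at_def)
    moreover have "play g (unit_at t) s \<ge> 0"
      using i(3) by (auto simp: P_def g_def unit_at_def)
    ultimately show ?thesis by simp
  qed
  define c where "c = play g (unit_at si) s"
  have c0: "c \<ge> 0" using i(3) by (auto simp: P_def g_def c_def unit_at_def)
  have g: "play g V' s = c * V' si" for V'
  proof -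
    have "play g V' s = (\<Sum>t\<in>S. V' t * play g (unit_at t) s)" by (rule play_expand[OF gS s])
    also have "\<dots> = (\<Sum>t\<in>S. if t = si then V' si * c else 0)"
      by (intro sum.cong) (auto simp: zero c_def)
    finally show ?thesis using siS finite_S by simp
  qed
  have "play u V s = play (drop i u) (play (take i u) V) s"
    by (metis append_take_drop_id play_append)
  also have "\<dots> = c * fire si (play (take i u) V) si" by (simp add: di g)
  also have "\<dots> = - c * play (take i w) V (w ! i)"
    using siS i by (simp add: fire_def a_self u_def si_def)
  also have "\<dots> \<le> 0" using assms(2)[of i] i kl c0 by simp
  finally show False using assms(2)[OF kl] by (simp add: u_def s_def)
qed

end

section \<open>Relative growth\<close>

locale letter_sequence = coxeter_data +
  fixes f :: "nat \<Rightarrow> 'a"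
  assumes f_in: "f k \<in> S"
begin

text \<open>All notions are relative to a set \<open>L\<close> of letters, the others being skipped, so that letters
  can be deleted without reindexing the sequence.\<close>

definition prefix_on :: "'a set \<Rightarrow> nat \<Rightarrow> 'a list" where
  "prefix_on L k = filter (\<lambda>x. x \<in> L) (map f [0..<k])"

definition straight_on :: "'a set \<Rightarrow> bool" where
  "straight_on L \<longleftrightarrow> (\<forall>k. red (prefix_on L k))"

definition consec :: "nat \<Rightarrow> nat \<Rightarrow> bool" where
  "consec i i' \<longleftrightarrow> i < i' \<and> f i = f i' \<and> (\<forall>k. i < k \<longrightarrow> k < i' \<longrightarrow> f k \<noteq> f i')"

text \<open>The covering relation of the heap restricted to the two letters involved.\<close>

definition linked :: "nat \<Rightarrow> nat \<Rightarrow> bool" where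
  "linked j i \<longleftrightarrow> j < i \<and> adj (f j) (f i) \<and> (\<forall>k. j < k \<longrightarrow> k < i \<longrightarrow> f k \<noteq> f j \<and> f k \<noteq> f i)"

definition gap :: "'a set \<Rightarrow> nat \<Rightarrow> nat \<Rightarrow> nat set" where
  "gap L i1 i = {k. i1 < k \<and> k < i \<and> f k \<in> L \<and> adj (f k) (f i)}"

text \<open>The longest alternating chain ending in \<open>j\<close>, \<open>i\<close> that can be
  traced back through gaps with nothing else in them; \<open>r\<close> counts its positions. The
  negative premise of \<open>start\<close> forbids stopping early, so \<open>r\<close> is determined
  by \<open>j\<close> and \<open>i\<close>. It is vacuous at the first occurrence of a
  letter.\<close>

inductive chain_to :: "'a set \<Rightarrow> nat \<Rightarrow> nat \<Rightarrow> nat \<Rightarrow> bool" for L where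
  start: "linked j i \<Longrightarrow> (\<And>i1. consec i1 i \<Longrightarrow> gap L i1 i \<noteq> {j}) \<Longrightarrow> chain_to L 2 j i"
| step: "chain_to L r i1 j \<Longrightarrow> consec i1 i \<Longrightarrow> gap L i1 i = {j} \<Longrightarrow> chain_to L (Suc r) j i"

lemma finite_gap [simp]: "finite (gap L i1 i)"
  by (rule finite_subset[of _ "{..<i}"]) (auto simp: gap_def)

lemma consec_unique: "consec i i' \<Longrightarrow> consec j i' \<Longrightarrow> i = j"
  unfolding consec_def by (metis linorder_neqE_nat)

lemma consec_ex:
  assumes "j < i" "f j = f i"
  obtains i1 where "consec i1 i" "j \<le> i1"
proof -
  define i1 where "i1 = Max {k. k < i \<and> f k = f i}"
  have fin: "finite {k. k < i \<and> f k = f i}" by simp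
  have "i1 \<in> {k. k < i \<and> f k = f i}"
    unfolding i1_def using fin assms by (intro Max_in) auto
  moreover have "k \<le> i1" if "k < i" "f k = f i" for k
    unfolding i1_def using fin that by (intro Max_ge) auto
  ultimately have "consec i1 i" "j \<le> i1"
    using assms by (auto simp: consec_def not_less[symmetric])
  then show ?thesis using that by blast
qed

lemma gap_neq: "k \<in> gap L i1 i \<Longrightarrow> f k \<noteq> f i"
  using adj_irrefl f_in by (auto simp: gap_def)

lemma linked_neq: "linked j i \<Longrightarrow> f j \<noteq> f i"
  using adj_irrefl f_in by (auto simp: linked_def)

lemma linked_in_gap: "linked j i \<Longrightarrow> consec i1 i \<Longrightarrow> f j \<in> L \<Longrightarrow> j \<in> gap L i1 i"
proof -
  assume l: "linked j i" "consec i1 i" "f j \<in> L"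
  have "i1 \<noteq> j" using l(1,2) linked_neq[of j i] by (auto simp: consec_def)
  moreover have "\<not> j < i1" using l(1,2) by (auto simp: consec_def linked_def)
  ultimately show ?thesis using l by (auto simp: linked_def gap_def)
qed

lemma linked_if_gap_single:
  assumes "consec i1 i" "gap L i1 i = {j}"
  shows "linked j i" and "linked i1 j"
proof -
  have "j \<in> gap L i1 i" by (simp add: assms(2))
  then have j: "i1 < j" "j < i" "f j \<in> L" "adj (f j) (f i)" by (auto simp: gap_def)
  have u: "k = j" if "i1 < k" "k < i" "f k = f j" for k
  proof -
    have "k \<in> gap L i1 i" using that j by (simp add: gap_def)
    then show ?thesis by (simp add: assms(2))
  qed
  have c: "f i1 = f i" "f k \<noteq> f i" if "i1 < k" "k < i" for k
    using assms(1) that by (auto simp: consec_def)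
  show "linked j i" unfolding linked_def
  proof (intro conjI allI impI)
    fix k assume k: "j < k" "k < i"
    show "f k \<noteq> f j" using u[of k] k j by auto
    show "f k \<noteq> f i" using c[of k] k j by auto
  qed (use j in auto)
  show "linked i1 j" unfolding linked_def
  proof (intro conjI allI impI)
    fix k assume k: "i1 < k" "k < j"
    show "f k \<noteq> f j" using u[of k] k j by auto
    show "f k \<noteq> f i1" using c[of k] k j by auto
  next
    show "adj (f i1) (f j)" using j c(1)[OF j(1,2)] adj_sym[OF f_in f_in, of j i] by simp
  qed (use j in auto)
qed

lemma chain_to_ge_2: "chain_to L r j i \<Longrightarrow> r \<ge> 2"
  by (induction rule: chain_to.induct) auto

lemma chain_to_ex: "linked j i \<Longrightarrow> \<exists>r. chain_to L r j i"
proof (induction i arbitrary: j rule: less_induct)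
  case (less i)
  show ?case
  proof (cases "\<exists>i1. consec i1 i \<and> gap L i1 i = {j}")
    case True
    then obtain i1 where i1: "consec i1 i" "gap L i1 i = {j}" by blast
    then obtain r where "chain_to L r i1 j"
      using less.IH[of j i1] linked_if_gap_single[OF i1] less.prems by (auto simp: linked_def)
    then show ?thesis using chain_to.step[OF _ i1] by blast
  next
    case False
    have "chain_to L 2 j i" by (rule chain_to.start[OF less.prems]) (use False in blast)
    then show ?thesis ..
  qed
qed

text \<open>A contribution can be compared with the value at \<open>i1\<close> only if its position
  is linked to \<open>i1\<close>; the first occurrence of a letter in the gap always is.\<close>

lemma first_in_gap:
  assumes "consec i1 i" "q \<in> gap L i1 i"
  obtains y where "y \<in> gap L i1 i" "f y = f q" "y \<le> q" "linked i1 y"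
proof -
  define P where "P k \<longleftrightarrow> i1 < k \<and> f k = f q" for k
  have "P q" using assms(2) by (simp add: P_def gap_def)
  define y where "y = (LEAST k. P k)"
  have y: "P y" "y \<le> q" unfolding y_def using \<open>P q\<close> by (auto intro: LeastI Least_le)
  have first: "f k \<noteq> f q" if "i1 < k" "k < y" for k
    using not_less_Least[of k P] that unfolding y_def[symmetric] by (auto simp: P_def)
  have g: "y \<in> gap L i1 i" using y assms(2) by (auto simp: P_def gap_def)
  have "linked i1 y"
    unfolding linked_def using g y first assms(1) f_in
    by (auto simp: P_def gap_def consec_def adj_sym)
  then show ?thesis using that g y by (auto simp: P_def)
qed

lemma last_in_gap:
  assumes "consec i1 i" "gap L i1 i \<noteq> {}"
  shows "linked (Max (gap L i1 i)) i" "Max (gap L i1 i) \<in> gap L i1 i"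
proof -
  let ?j = "Max (gap L i1 i)"
  show j: "?j \<in> gap L i1 i" using assms(2) by (intro Max_in) auto
  have "\<not> (?j < k \<and> k < i \<and> f k = f ?j)" for k
  proof
    assume k: "?j < k \<and> k < i \<and> f k = f ?j"
    then have "k \<in> gap L i1 i" using j by (auto simp: gap_def)
    then have "k \<le> ?j" by (intro Max_ge) auto
    then show False using k by simp
  qed
  moreover have "f k \<noteq> f i" if "?j < k" "k < i" for k
    using that j assms(1) by (auto simp: consec_def gap_def)
  ultimately show "linked ?j i" using j unfolding linked_def gap_def by blast
qed


section \<open>The game along a sequence of letters\<close>

definition state :: "'a set \<Rightarrow> nat \<Rightarrow> 'a \<Rightarrow> real" where
  "state L k = play (prefix_on L k) (\<lambda>_. 1)"

definition fired :: "'a set \<Rightarrow> nat \<Rightarrow> real" where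
  "fired L k = state L k (f k)"

lemma prefix_on_Suc: "prefix_on L (Suc k) = prefix_on L k @ (if f k \<in> L then [f k] else [])"
  by (simp add: prefix_on_def)

lemma set_prefix_on: "set (prefix_on L k) \<subseteq> S \<inter> L"
  using f_in by (auto simp: prefix_on_def)

lemma state_Suc: "state L (Suc k) y = state L k y + (if f k \<in> L then a y (f k) * fired L k else 0)"
  by (simp add: state_def fired_def prefix_on_Suc play_snoc)

lemma state_sum:
  assumes "j \<le> i"
  shows "state L i y = state L j y + (\<Sum>k\<in>{k. j \<le> k \<and> k < i \<and> f k \<in> L}. a y (f k) * fired L k)"
  using assms
proof (induction i rule: dec_induct)
  case base
  have "{k. j \<le> k \<and> k < j \<and> f k \<in> L} = {}" by auto
  then show ?case by (simp only: sum.empty add_0_right)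
next
  case (step i)
  have "{k. j \<le> k \<and> k < Suc i \<and> f k \<in> L} =
      (if f i \<in> L then insert i {k. j \<le> k \<and> k < i \<and> f k \<in> L} else {k. j \<le> k \<and> k < i \<and> f k \<in> L})"
    using step(1) by (auto simp: less_Suc_eq)
  then show ?case using step by (simp add: state_Suc)
qed

lemma sum_restrict_adj:
  assumes "\<And>k. k \<in> A \<Longrightarrow> f k \<noteq> y" "y \<in> S" "finite A"
  shows "(\<Sum>k\<in>A. a y (f k) * X k) = (\<Sum>k\<in>{k\<in>A. adj (f k) y}. a y (f k) * X k)"
proof (rule sum.mono_neutral_right)
  show "\<forall>k\<in>A - {k \<in> A. adj (f k) y}. a y (f k) * X k = 0"
    using assms a_not_adj adj_sym f_in by fastforce
qed (use assms in auto)

lemma fired_consec: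
  assumes "consec i1 i" "f i \<in> L"
  shows "fired L i = (\<Sum>k\<in>gap L i1 i. a (f i) (f k) * fired L k) - fired L i1"
proof -
  let ?y = "f i"
  have i1: "i1 < i" "f i1 = ?y" using assms by (auto simp: consec_def)
  have "state L i ?y = state L i1 ?y + (\<Sum>k\<in>{k. i1 \<le> k \<and> k < i \<and> f k \<in> L}. a ?y (f k) * fired L k)"
    using state_sum i1 by simp
  also have "{k. i1 \<le> k \<and> k < i \<and> f k \<in> L} = insert i1 {k. i1 < k \<and> k < i \<and> f k \<in> L}"
    using i1 assms by auto
  also have "state L i1 ?y + (\<Sum>k\<in>\<dots>. a ?y (f k) * fired L k) =
      - fired L i1 + (\<Sum>k\<in>{k. i1 < k \<and> k < i \<and> f k \<in> L}. a ?y (f k) * fired L k)"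
    using i1 a_self[OF f_in, of i] by (simp add: fired_def)
  also have "(\<Sum>k\<in>{k. i1 < k \<and> k < i \<and> f k \<in> L}. a ?y (f k) * fired L k)
      = (\<Sum>k\<in>gap L i1 i. a ?y (f k) * fired L k)"
    by (subst sum_restrict_adj) (use assms f_in in \<open>auto simp: consec_def gap_def intro!: sum.cong\<close>)
  finally show ?thesis by (simp add: fired_def)
qed

lemma fired_first:
  assumes "\<And>j. j < i \<Longrightarrow> f j \<noteq> f i"
  shows "fired L i = 1 + (\<Sum>k\<in>{k. k < i \<and> f k \<in> L \<and> adj (f k) (f i)}. a (f i) (f k) * fired L k)"
proof -
  have "fired L i = 1 + (\<Sum>k\<in>{k. 0 \<le> k \<and> k < i \<and> f k \<in> L}. a (f i) (f k) * fired L k)"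
    unfolding fired_def using state_sum[of 0 i L "f i"] by (simp add: state_def prefix_on_def fired_def)
  also have "(\<Sum>k\<in>{k. 0 \<le> k \<and> k < i \<and> f k \<in> L}. a (f i) (f k) * fired L k) =
     (\<Sum>k\<in>{k. k < i \<and> f k \<in> L \<and> adj (f k) (f i)}. a (f i) (f k) * fired L k)"
    by (subst sum_restrict_adj) (use assms f_in in \<open>auto intro!: sum.cong\<close>)
  finally show ?thesis .
qed

lemma straight_on_if_legal:
  assumes "\<And>i. f i \<in> L \<Longrightarrow> play (prefix_on L i) V (f i) > 0"
  shows "straight_on L"
  unfolding straight_on_def
proof
  fix k
  show "red (prefix_on L k)"
  proof (rule legal_play_red[of _ V])
    show "prefix_on L k \<in> lists S" using set_prefix_on by (auto simp: in_lists_conv_set)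
    fix n assume "n < length (prefix_on L k)"
    then have "\<exists>i. f i \<in> L \<and> take n (prefix_on L k) = prefix_on L i \<and> prefix_on L k ! n = f i"
    proof (induction k)
      case (Suc k)
      show ?case
      proof (cases "n < length (prefix_on L k)")
        case True
        then show ?thesis using Suc by (auto simp: prefix_on_Suc nth_append)
      next
        case False
        then have "f k \<in> L" "n = length (prefix_on L k)"
          using Suc.prems by (auto simp: prefix_on_Suc split: if_splits)
        then show ?thesis by (intro exI[of _ k]) (simp add: prefix_on_Suc)
      qed
    qed (simp add: prefix_on_def)
    then show "play (take n (prefix_on L k)) V (prefix_on L k ! n) > 0"
      using assms by auto
  qed
qed

lemma straight_onI:
  assumes "\<And>i. f i \<in> L \<Longrightarrow> fired L i > 0"
  shows "straight_on L"
  by (rule straight_on_if_legal[of _ "\<lambda>_. 1"]) (use assms in \<open>simp add: fired_def state_def\<close>)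

lemma straight_on_fired_pos:
  assumes "straight_on L" "f i \<in> L"
  shows "fired L i > 0"
proof -
  have "red (prefix_on L (Suc i))" using assms(1) by (simp add: straight_on_def)
  then show ?thesis using assms(2) by (auto simp: prefix_on_Suc fired_def state_def intro: play_pos)
qed

definition response :: "'a set \<Rightarrow> nat \<Rightarrow> nat \<Rightarrow> 'a \<Rightarrow> real" where
  "response J l i = play (filter (\<lambda>x. x \<in> J) (map f [Suc l..<i])) (\<lambda>t. a t (f l))"

text \<open>Firing a letter outside \<open>J\<close> adds a nonnegative vector to the values on \<open>J\<close>; as the
  \<open>J\<close>-part of the sequence is reduced, the response of the values on \<open>J\<close> is nonnegative.\<close>

lemma state_decompose:
  assumes "y \<in> J" "J \<subseteq> L"
  shows "state L i y = state J i y + (\<Sum>l\<in>{l. l < i \<and> f l \<in> L - J}. fired L l * response J l i y)"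
  using assms(1)
proof (induction i arbitrary: y)
  case 0
  then show ?case by (simp add: state_def prefix_on_def)
next
  case (Suc i)
  let ?A = "{l. l < i \<and> f l \<in> L - J}"
  have resp: "response J l (Suc i) y =
      response J l i y + (if f i \<in> J then a y (f i) * response J l i (f i) else 0)" if "l < i" for l y
    using that by (simp add: response_def play_snoc)
  have fin: "finite ?A" by simp
  show ?case
  proof (cases "f i \<in> J")
    case True
    then have A: "{l. l < Suc i \<and> f l \<in> L - J} = ?A" by (auto simp: less_Suc_eq)
    have IHi: "fired L i = fired J i + (\<Sum>l\<in>?A. fired L l * response J l i (f i))"
      using Suc.IH[OF True] by (simp add: fired_def)
    have "state L (Suc i) y = state L i y + a y (f i) * fired L i"
      using True assms(2) by (auto simp: state_Suc)
    also have "\<dots> = state J (Suc i) y + (\<Sum>l\<in>?A. fired L l * response J l i y)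
        + a y (f i) * (\<Sum>l\<in>?A. fired L l * response J l i (f i))"
      using True by (simp add: Suc.IH[OF Suc.prems] state_Suc IHi algebra_simps)
    also have "\<dots> = state J (Suc i) y + (\<Sum>l\<in>?A. fired L l * response J l (Suc i) y)"
      using True resp by (simp add: sum_distrib_left sum.distrib[symmetric] algebra_simps)
    finally show ?thesis by (simp only: A)
  next
    case False
    have IH: "state L i y = state J (Suc i) y + (\<Sum>l\<in>?A. fired L l * response J l (Suc i) y)"
      using Suc.IH[OF Suc.prems] False resp by (simp add: state_Suc)
    show ?thesis
    proof (cases "f i \<in> L")
      case True
      have "{l. l < Suc i \<and> f l \<in> L - J} = insert i ?A" using True False by (auto simp: less_Suc_eq)
      moreover have "response J i (Suc i) y = a y (f i)" by (simp add: response_def)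
      ultimately show ?thesis using IH True by (simp add: state_Suc)
    next
      case False
      then have "{l. l < Suc i \<and> f l \<in> L - J} = ?A" by (auto simp: less_Suc_eq)
      then show ?thesis using IH False by (simp add: state_Suc)
    qed
  qed
qed

text \<open>Fired values are nonnegative, so a letter that is not fired itself only receives
  nonnegative additions.\<close>

lemma play_ge:
  assumes "red g" "y \<in> S" "y \<notin> set g" "\<And>t. t \<in> S \<Longrightarrow> V t \<ge> 0"
  shows "play g V y \<ge> V y"
  using assms
proof (induction g rule: rev_induct)
  case (snoc z g)
  have "play g V z \<ge> 0" using play_nonneg[OF snoc.prems(1,4)] by simp
  moreover have "a y z \<ge> 0" using snoc.prems red_lists[OF snoc.prems(1)] by (intro a_nonneg) auto
  ultimately have "a y z * play g V z \<ge> 0" by simp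
  then show ?case
    using snoc.IH[OF red_append(1)[OF snoc.prems(1)]] snoc.prems by (simp add: play_snoc)
qed simp

lemma response_ge:
  assumes "straight_on J" "f i \<in> J" "f l \<notin> J" "l < i"
  shows "response J l i (f i) \<ge> 0"
    and "(\<And>k. l < k \<Longrightarrow> k < i \<Longrightarrow> f k \<noteq> f i) \<Longrightarrow> response J l i (f i) \<ge> a (f i) (f l)"
proof -
  let ?g = "filter (\<lambda>x. x \<in> J) (map f [Suc l..<i])"
  \<comment> \<open>The vector is cut off outside \<open>J\<close>, because its entry at
    \<open>f l\<close> itself is \<open>-2\<close>; the game restricted to \<open>J\<close> does not
    see the difference.\<close>
  let ?V = "\<lambda>t. if t \<in> J \<inter> S then a t (f l) else 0"
  have "[0..<Suc i] = [0..<Suc l] @ [Suc l..<Suc i]"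
    using assms(4) upt_add_eq_append[of 0 "Suc l" "i - l"] by simp
  then have "prefix_on J (Suc i) = prefix_on J (Suc l) @ (?g @ [f i])"
    using assms(2,4) unfolding prefix_on_def by (simp del: upt_Suc) (simp add: Suc_le_eq)
  then have r: "red (?g @ [f i])"
    using assms(1) red_append(2) unfolding straight_on_def by metis
  have V: "?V t \<ge> 0" for t using a_nonneg[of t "f l"] f_in[of l] assms(3) by auto
  have e: "response J l i (f i) = play ?g ?V (f i)"
    unfolding response_def by (rule play_cong[of _ "J \<inter> S"]) (use assms f_in in auto)
  show "response J l i (f i) \<ge> 0" unfolding e by (rule play_nonneg[OF r V])
  assume ne: "\<And>k. l < k \<Longrightarrow> k < i \<Longrightarrow> f k \<noteq> f i"
  have "f i \<notin> set ?g"
  proof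
    assume "f i \<in> set ?g"
    then obtain k where "k \<in> {Suc l..<i}" "f i = f k" by auto
    then show False using ne[of k] by simp
  qed
  then have "play ?g ?V (f i) \<ge> ?V (f i)"
    by (rule play_ge[OF red_append(1)[OF r] f_in _ V])
  then show "response J l i (f i) \<ge> a (f i) (f l)" using e assms(2) f_in by simp
qed

text \<open>In \<open>state_decompose\<close> the summand of \<open>j\<close> is at least its direct
  contribution, since the letter of \<open>i\<close> does not occur between \<open>j\<close> and
  \<open>i\<close>. Strictness comes from the positive value of the game on \<open>J\<close>
  alone.\<close>

lemma fired_dominates:
  assumes "J \<subseteq> L" "straight_on J" "f i \<in> J" "\<And>l. l < i \<Longrightarrow> f l \<in> L - J \<Longrightarrow> fired L l > 0"
  shows "fired L i > 0"
    and "linked j i \<Longrightarrow> f j \<in> L - J \<Longrightarrow> fired L i > a (f i) (f j) * fired L j"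
proof -
  let ?A = "{l. l < i \<and> f l \<in> L - J}"
  have fin: "finite ?A" by simp
  have dec: "fired L i = fired J i + (\<Sum>l\<in>?A. fired L l * response J l i (f i))"
    unfolding fired_def by (subst state_decompose[OF assms(3,1)]) (simp add: fired_def)
  have pos: "fired J i > 0" by (rule straight_on_fired_pos[OF assms(2,3)])
  have nn: "fired L l * response J l i (f i) \<ge> 0" if "l \<in> ?A" for l
    using response_ge(1)[OF assms(2,3), of l] assms(4)[of l] that by simp
  show "fired L i > 0" unfolding dec using pos sum_nonneg[OF nn] by (rule add_pos_nonneg)
  assume l: "linked j i" and j: "f j \<in> L - J"
  have jA: "j \<in> ?A" using l j by (simp add: linked_def)
  have "fired L j * a (f i) (f j) \<le> fired L j * response J j i (f i)"
    using response_ge(2)[OF assms(2,3), of j] l j assms(4)[of j]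
    by (intro mult_left_mono) (auto simp: linked_def)
  also have "\<dots> \<le> (\<Sum>l\<in>?A. fired L l * response J l i (f i))"
    using nn by (intro member_le_sum[OF jA]) auto
  finally show "fired L i > a (f i) (f j) * fired L j" using dec pos by (simp add: mult.commute)
qed

lemma a_linked: "linked j i \<Longrightarrow> a (f i) (f j) \<ge> 1"
  using a_adj adj_sym[OF f_in f_in] by (auto simp: linked_def)

lemma a_gap: "k \<in> gap L i1 i \<Longrightarrow> a (f i) (f k) \<ge> 1"
  using a_adj adj_sym[OF f_in f_in] by (auto simp: gap_def)

text \<open>Positivity spreads from \<open>J\<close> to \<open>L\<close> position by position. Where
  the gap is a single position outside \<open>J\<close>, \<open>not_full\<close> keeps the Chebyshev
  coefficients from changing sign. Elsewhere \<open>second\<close> provides a neighbour other than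
  \<open>j\<close> whose contribution exceeds the subtracted value at \<open>i1\<close>, so that all
  of the contribution of \<open>j\<close> survives and a new chain can start.\<close>

theorem straight_on_extend:
  assumes JL: "J \<subseteq> L" and J: "straight_on J"
    and gap_nonempty: "\<And>i1 i. consec i1 i \<Longrightarrow> f i \<in> L - J \<Longrightarrow> gap L i1 i \<noteq> {}"
    and not_full: "\<And>i1 i j r. consec i1 i \<Longrightarrow> f i \<in> L - J \<Longrightarrow> gap L i1 i = {j} \<Longrightarrow> f j \<notin> J \<Longrightarrow>
      chain_to L r i1 j \<Longrightarrow> enat r < m (f i) (f j)"
    and second: "\<And>i1 i j. consec i1 i \<Longrightarrow> f i \<in> L - J \<Longrightarrow> gap L i1 i \<noteq> {j} \<Longrightarrow> f j \<in> L - J \<Longrightarrow>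
      linked j i \<Longrightarrow> \<exists>y\<in>gap L i1 i. y \<noteq> j \<and> linked i1 y \<and>
        (f y \<in> J \<or> (\<forall>r. chain_to L r i1 y \<longrightarrow> enat r < m (f y) (f i)))"
  shows "straight_on L"
proof -
  \<comment> \<open>The values along a chain are \<open>x_1, ..., x_r\<close>, prolonged backwards
    by a virtual \<open>x_0\<close>; \<open>sinseq\<close> expresses the last two through
    \<open>x_0\<close> and \<open>x_1\<close>. Negativity of \<open>x_0\<close> says that the second
    value of the chain exceeds its first value times the coefficient.\<close>
  define chain_values where "chain_values r j i \<longleftrightarrow>
      (\<exists>x0 x1. x0 < 0 \<and> x1 > 0 \<and> enat r \<le> m (f i) (f j) \<and>
        fired L j = sinseq (a (f i) (f j)) (r - 1) * x1 - sinseq (a (f i) (f j)) (r - 2) * x0 \<and>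
        fired L i = sinseq (a (f i) (f j)) r * x1 - sinseq (a (f i) (f j)) (r - 1) * x0)" for r j i
  define good where "good i \<longleftrightarrow> (f i \<in> L \<longrightarrow> fired L i > 0) \<and>
     (\<forall>j. linked j i \<longrightarrow> f j \<in> L - J \<longrightarrow>
        (f i \<in> J \<longrightarrow> fired L i > a (f i) (f j) * fired L j) \<and>
        (f i \<in> L - J \<longrightarrow> (\<forall>r. chain_to L r j i \<longrightarrow> chain_values r j i)))" for i
  have start_values: "chain_values 2 j i"
    if "linked j i" "fired L j > 0" "fired L i > a (f i) (f j) * fired L j" for i j
  proof -
    have "m (f i) (f j) \<ge> 2"
      using m_ge_2[OF f_in f_in] linked_neq[OF that(1)] by metis
    then show ?thesis unfolding chain_values_def
      by (intro exI[of _ "a (f i) (f j) * fired L j - fired L i"] exI[of _ "fired L j"])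
        (use that in \<open>auto simp: numeral_2_eq_2 numeral_eq_enat\<close>)
  qed
  \<comment> \<open>The difference is the next term \<open>x_(r+1)\<close> of the chain. For
    \<open>r < m\<close> the coefficient of \<open>x1\<close> is nonnegative and that of
    \<open>x0 < 0\<close> is strictly negative.\<close>
  have advance: "fired L j < a (f i) (f j) * fired L i"
    and extend_values: "fired L k = a (f i) (f j) * fired L i - fired L j \<Longrightarrow> f k = f j \<Longrightarrow>
      chain_values (Suc r) i k"
    if v: "chain_values r j i" and r: "enat r < m (f i) (f j)" "r \<ge> 2" and lk: "linked j i" for r j i k
  proof -
    define b where "b = a (f i) (f j)"
    obtain r' where r': "r = r' + 2" using r(2) by (metis le_add_diff_inverse2)
    obtain x0 x1 where x: "x0 < 0" "x1 > 0"
      "fired L j = sinseq b (r - 1) * x1 - sinseq b (r - 2) * x0"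
      "fired L i = sinseq b r * x1 - sinseq b (r - 1) * x0"
      using v unfolding chain_values_def b_def by blast
    have m2: "m (f i) (f j) \<ge> 2" using m_ge_2[OF f_in f_in] linked_neq[OF lk] by metis
    have b: "b = angle_coeff (m (f i) (f j))" by (simp add: b_def a_def)
    have "sinseq b r > 0" unfolding b using m2 r by (intro sinseq_pos) auto
    moreover have "sinseq b (Suc r) \<ge> 0"
      unfolding b using m2 r by (intro sinseq_nonneg) (auto simp: Suc_ile_eq)
    ultimately have pos: "sinseq b (Suc r) * x1 - sinseq b r * x0 > 0"
      using mult_pos_neg[of "sinseq b r" x0] mult_nonneg_nonneg[of "sinseq b (Suc r)" x1] x by linarith
    have e: "b * fired L i - fired L j = sinseq b (Suc r) * x1 - sinseq b r * x0"
      unfolding x(3,4) r' by (simp add: algebra_simps)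
    show "fired L j < a (f i) (f j) * fired L i" using pos e by (simp add: b_def)
    assume k: "fired L k = a (f i) (f j) * fired L i - fired L j" "f k = f j"
    have sym: "m (f k) (f i) = m (f i) (f j)" "a (f k) (f i) = b"
      using k(2) m_sym a_sym f_in by (auto simp: b_def)
    show "chain_values (Suc r) i k"
      unfolding chain_values_def sym
      by (intro exI[of _ x0] exI[of _ x1]) (use x e k r r' in \<open>auto simp: b_def Suc_ile_eq\<close>)
  qed
  have good: "good i" for i
  proof (induction i rule: less_induct)
    case (less i)
    have pos: "fired L k > 0" if "k < i" "f k \<in> L" for k
      using less.IH[OF that(1)] that(2) by (simp add: good_def)
    consider "f i \<notin> L" | "f i \<in> J" | "f i \<in> L - J" by blast
    then show ?case
    proof cases
      case 1
      then show ?thesis using JL by (auto simp: good_def)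
    next
      case 2
      then show ?thesis using fired_dominates[OF JL J 2] pos JL by (auto simp: good_def)
    next
      case 3
      have key: "good i" if "fired L i > 0"
        and "\<And>j r. linked j i \<Longrightarrow> f j \<in> L - J \<Longrightarrow> chain_to L r j i \<Longrightarrow> chain_values r j i"
        using that 3 by (auto simp: good_def)
      have m_sym': "m (f j) (f i) = m (f i) (f j)" "a (f j) (f i) = a (f i) (f j)" for i j
        using m_sym a_sym f_in by auto
      show ?thesis
      proof (cases "\<exists>i1. consec i1 i")
        case False
        then have first: "f j \<noteq> f i" if "j < i" for j using that consec_ex by metis
        let ?A = "{k. k < i \<and> f k \<in> L \<and> adj (f k) (f i)}"
        have eq: "fired L i = 1 + (\<Sum>k\<in>?A. a (f i) (f k) * fired L k)"
          by (rule fired_first[OF first])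
        have nn: "a (f i) (f k) * fired L k \<ge> 0" if "k \<in> ?A" for k
          using that pos[of k] a_adj[of "f i" "f k"] adj_sym[OF f_in f_in, of k i] by auto
        show ?thesis
        proof (rule key)
          show "fired L i > 0" unfolding eq using zero_less_one sum_nonneg[OF nn] by (rule add_pos_nonneg)
          fix j r assume j: "linked j i" "f j \<in> L - J" "chain_to L r j i"
          have r: "r = 2" using j(3) False by (cases rule: chain_to.cases) auto
          have "j \<in> ?A" using j by (auto simp: linked_def)
          then have "a (f i) (f j) * fired L j \<le> (\<Sum>k\<in>?A. a (f i) (f k) * fired L k)"
            using nn by (intro member_le_sum) auto
          then show "chain_values r j i" unfolding r
            using eq j pos[of j] by (intro start_values) (auto simp: linked_def)
        qed
      next
        case True
        then obtain i1 where i1: "consec i1 i" by blast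
        have i1': "i1 < i" "f i1 = f i" using i1 by (auto simp: consec_def)
        let ?G = "gap L i1 i"
        have eq: "fired L i = (\<Sum>k\<in>?G. a (f i) (f k) * fired L k) - fired L i1"
          using fired_consec[OF i1] 3 by simp
        have nn: "a (f i) (f k) * fired L k \<ge> 0" if "k \<in> ?G" for k
          using a_gap[OF that] pos[of k] that by (auto simp: gap_def)
        have pos1: "fired L i1 > 0" using pos[of i1] i1' 3 by auto
        have dom_J: "a (f i) (f y) * fired L y > fired L i1"
          if "y \<in> ?G" "linked i1 y" "f y \<in> J" for y
        proof -
          have "good y" using that less.IH by (simp add: gap_def)
          then have d: "fired L y > a (f y) (f i1) * fired L i1"
            using that 3 i1' by (auto simp: good_def)
          have "fired L i1 \<le> a (f y) (f i1) * fired L i1"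
            using a_linked[OF that(2)] pos1 by simp
          also have "\<dots> < fired L y" by (rule d)
          also have "fired L y \<le> a (f i) (f y) * fired L y"
            using a_gap[OF that(1)] pos[of y] that(1) by (auto simp: gap_def)
          finally show ?thesis .
        qed
        \<comment> \<open>For \<open>y\<close> outside \<open>J\<close> the difference is the term
          that would follow \<open>i1\<close>, \<open>y\<close> in their chain. It is positive
          whether or not the gap contains other neighbours.\<close>
        have dom: "a (f i) (f y) * fired L y > fired L i1"
          if y: "y \<in> ?G" "linked i1 y" "f y \<in> J \<or> (\<forall>r. chain_to L r i1 y \<longrightarrow> enat r < m (f y) (f i))" for y
        proof (cases "f y \<in> J")
          case True
          then show ?thesis using dom_J y by blast
        next
          case False
          obtain r where r: "chain_to L r i1 y" using chain_to_ex[OF y(2)] by blast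
          have rm: "enat r < m (f y) (f i)" using r y False by blast
          have "good y" using y less.IH by (simp add: gap_def)
          moreover have "f y \<in> L - J" using y(1) False by (auto simp: gap_def)
          ultimately have "chain_values r i1 y"
            using y(2) r 3 i1' by (auto simp: good_def)
          then show ?thesis
            using advance[of r i1 y] rm chain_to_ge_2[OF r] y(2) i1'(2) m_sym'(2)[of y i] by metis
        qed
        have ne: "?G \<noteq> {}" using gap_nonempty[OF i1 3] .
        have two: "fired L i > a (f i) (f j) * fired L j"
          if j: "linked j i" "f j \<in> L - J" "?G \<noteq> {j}" for j
        proof -
          have jG: "j \<in> ?G" using linked_in_gap[OF j(1) i1] j by auto
          obtain y where y: "y \<in> ?G" "y \<noteq> j" "a (f i) (f y) * fired L y > fired L i1"
            using second[OF i1 3 j(3,2,1)] dom by blast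
          have "(\<Sum>k\<in>{j, y}. a (f i) (f k) * fired L k) \<le> (\<Sum>k\<in>?G. a (f i) (f k) * fired L k)"
            using jG y nn by (intro sum_mono2) auto
          then show ?thesis using eq y by simp
        qed
        show ?thesis
        proof (cases "\<exists>j. ?G = {j}")
          case True
          then obtain j where j: "?G = {j}" by blast
          note lk = linked_if_gap_single[OF i1 j]
          have eqj: "fired L i = a (f i) (f j) * fired L j - fired L i1" using eq j by simp
          have jG: "j \<in> ?G" using j by simp
          have jL: "f j \<in> L" "j < i" using jG by (auto simp: gap_def)
          show ?thesis
          proof (cases "f j \<in> J")
            case True
            show ?thesis
            proof (rule key)
              show "fired L i > 0" using dom_J[OF jG lk(2) True] eqj by simp
              fix j' r assume "linked j' i" "f j' \<in> L - J"
              then have "j' \<in> ?G" using linked_in_gap i1 by blast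
              then show "chain_values r j' i" using j True \<open>f j' \<in> L - J\<close> by auto
            qed
          next
            case False
            have extend: "fired L i > 0 \<and> chain_values (Suc r) j i" if r: "chain_to L r i1 j" for r
            proof -
              have rm: "enat r < m (f i) (f j)" using not_full[OF i1 3 j False r] .
              have "good j" using jL less.IH by simp
              then have "chain_values r i1 j"
                using lk(2) r 3 i1' jL False by (auto simp: good_def)
              moreover have "enat r < m (f j) (f i1)" using rm m_sym' i1' by metis
              moreover have "a (f j) (f i1) = a (f i) (f j)" unfolding i1'(2) by (rule m_sym'(2))
              ultimately have "fired L i1 < a (f i) (f j) * fired L j" "chain_values (Suc r) j i"
                using advance[of r i1 j] extend_values[of r i1 j i] chain_to_ge_2[OF r] lk(2)
                  eqj i1'(2) by metis+
              then show ?thesis unfolding eqj by (intro conjI) linarith+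
            qed
            show ?thesis
            proof (rule key)
              show "fired L i > 0" using extend chain_to_ex[OF lk(2)] by blast
              fix j' r assume j': "linked j' i" "f j' \<in> L - J" "chain_to L r j' i"
              then have "j' = j" using linked_in_gap[OF j'(1) i1, of L] j by auto
              show "chain_values r j' i" using j'(3)
              proof cases
                case start
                then show ?thesis using i1 j \<open>j' = j\<close> by blast
              next
                case (step r' i1')
                then have "i1' = i1" using consec_unique i1 by blast
                then show ?thesis using step \<open>j' = j\<close> extend by blast
              qed
            qed
          qed
        next
          case False
          show ?thesis
          proof (rule key)
            let ?j = "Max ?G"
            note last = last_in_gap[OF i1 ne]
            show "fired L i > 0"
            proof (cases "f ?j \<in> J")
              case True
              obtain y where y: "y \<in> ?G" "f y = f ?j" "linked i1 y"
                using first_in_gap[OF i1 last(2)] by metis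
              have "fired L i1 < a (f i) (f y) * fired L y" using dom_J[OF y(1,3)] y(2) True by simp
              also have "\<dots> \<le> (\<Sum>k\<in>?G. a (f i) (f k) * fired L k)"
                using y nn by (intro member_le_sum) auto
              finally show ?thesis using eq by simp
            next
              case fJ: False
              have jL: "f ?j \<in> L" "?j < i" using last(2) by (simp_all add: gap_def)
              have "0 < a (f i) (f ?j) * fired L ?j"
                using pos[OF jL(2,1)] a_gap[OF last(2)] by simp
              also have "\<dots> < fired L i" using two[OF last(1)] fJ jL False by blast
              finally show ?thesis .
            qed
            fix j r assume j: "linked j i" "f j \<in> L - J" "chain_to L r j i"
            have r: "r = 2" using j(3)
            proof cases
              case (step r' i1')
              then show ?thesis using consec_unique[OF i1] False by blast
            qed simp
            show "chain_values r j i" unfolding r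
              using two[OF j(1,2)] False j pos[of j] by (intro start_values) (auto simp: linked_def)
          qed
        qed
      qed
    qed
  qed
  then show ?thesis by (intro straight_onI) (auto simp: good_def)
qed

end

section \<open>Periodic sequences and bands\<close>

locale periodic_sequence = letter_sequence +
  fixes n :: nat
  assumes n_pos: "n > 0" and f_period: "f (k + n) = f k"
begin

definition single :: "'a \<Rightarrow> bool" where
  "single z \<longleftrightarrow> (\<forall>i k. f i = z \<longrightarrow> f k = z \<longrightarrow> i < k \<longrightarrow> i + n \<le> k)"

text \<open>Convex alternating chains of the heap: between consecutive occurrences of one of the two
  letters there is no neighbour but the other letter.\<close>

definition cchain :: "'a set \<Rightarrow> (nat \<Rightarrow> nat) \<Rightarrow> nat \<Rightarrow> bool" where
  "cchain L c r \<longleftrightarrow> r \<ge> 2 \<and> f (c 0) \<in> L \<and> f (c 1) \<in> L \<and> linked (c 0) (c 1) \<and>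
     (\<forall>j. j + 2 < r \<longrightarrow> consec (c j) (c (j + 2)) \<and> gap L (c j) (c (j + 2)) = {c (j + 1)})"

text \<open>\<open>i < i1 + n\<close> puts both occurrences into one window of \<open>n\<close>
  positions, that is into one cyclic shift, where an empty gap would let two equal letters
  meet.\<close>

definition no_empty_gap :: "'a set \<Rightarrow> bool" where
  "no_empty_gap L \<longleftrightarrow>
     (\<forall>i1 i. consec i1 i \<longrightarrow> f i \<in> L \<longrightarrow> i < i1 + n \<longrightarrow> gap L i1 i \<noteq> {})"

text \<open>A full chain with \<open>c (r - 1) < c 0 + n\<close> would fit into one cyclic shift,
  where commutations could gather it into one side of a braid relation.\<close>

definition no_short_braid :: "'a set \<Rightarrow> bool" where
  "no_short_braid L \<longleftrightarrow>
     (\<forall>c r. cchain L c r \<longrightarrow> enat r = m (f (c 0)) (f (c 1)) \<longrightarrow> c 0 + n \<le> c (r - 1))"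

definition connected :: "'a set \<Rightarrow> bool" where
  "connected L \<longleftrightarrow> (\<forall>X. X \<subseteq> L \<longrightarrow> X \<noteq> {} \<longrightarrow> X \<noteq> L \<longrightarrow> (\<exists>x\<in>X. \<exists>y\<in>L - X. adj x y))"

text \<open>The only chains of full length that cyclic full commutativity permits: they use all the
  occurrences of two letters and wrap around a period.\<close>

definition band :: "'a set \<Rightarrow> (nat \<Rightarrow> nat) \<Rightarrow> nat \<Rightarrow> bool" where
  "band L c p \<longleftrightarrow> p \<ge> 1 \<and> cchain L c (2 * p + 1) \<and> c (2 * p) = c 0 + n \<and>
     m (f (c 0)) (f (c 1)) = enat (2 * p + 1)"

definition in_large_band :: "'a set \<Rightarrow> 'a \<Rightarrow> bool" where
  "in_large_band L z \<longleftrightarrow> (\<exists>c p. band L c p \<and> p \<ge> 2 \<and> (z = f (c 0) \<or> z = f (c 1)))"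

definition not_finite_dihedral :: "'a set \<Rightarrow> bool" where
  "not_finite_dihedral L \<longleftrightarrow> (\<forall>s t. L = {s, t} \<longrightarrow> s \<noteq> t \<longrightarrow> m s t = \<infinity>)"

section \<open>Translation by periods\<close>

lemma f_period_mult: "f (k + n * e) = f k"
proof (induction e)
  case (Suc e)
  then show ?case using f_period[of "k + n * e"] by (simp add: algebra_simps)
qed simp

lemma f_mod: "k mod n = k' mod n \<Longrightarrow> f k = f k'"
proof -
  have "f k = f (k mod n)" for k
    using f_period_mult[of "k mod n" "k div n"] by simp
  then show "k mod n = k' mod n \<Longrightarrow> ?thesis" by metis
qed

lemma window_rep: obtains k' where "b \<le> k'" "k' < b + n" "k' mod n = k mod n" "f k' = f k"
proof -
  define k' where "k' = b + (k + n * b - b) mod n"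
  have le: "b \<le> k + n * b" using n_pos by (cases n) auto
  have "k' mod n = (b + (k + n * b - b)) mod n" by (simp add: k'_def mod_add_right_eq)
  also have "b + (k + n * b - b) = k + n * b" using le by simp
  finally have "k' mod n = k mod n" by simp
  moreover have "b \<le> k'" "k' < b + n" using n_pos by (auto simp: k'_def)
  ultimately show ?thesis using that f_mod by blast
qed

text \<open>Positions are natural numbers, so both are moved forward to a common position rather
  than one of them back.\<close>

lemma common_shift:
  assumes "k mod n = k' mod n"
  obtains e e' where "k + n * e = k' + n * e'"
proof -
  have "k + n * (k' div n) = (k mod n) + n * (k div n) + n * (k' div n)"
    by (simp add: mod_mult_div_eq)
  also have "\<dots> = (k' mod n) + n * (k' div n) + n * (k div n)" using assms by simp
  also have "\<dots> = k' + n * (k div n)" by (simp add: mod_mult_div_eq)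
  finally show ?thesis using that by blast
qed

lemma mod_eq_window: "k mod n = k' mod n \<Longrightarrow> k < k' \<Longrightarrow> k + n \<le> k'"
  by (metis add.commute less_imp_le mod_eq_dvd_iff_nat dvd_imp_le le_diff_conv2 zero_less_diff)

lemma f_shift_down:
  assumes "n * e \<le> k" shows "f (k - n * e) = f k"
  using f_period_mult[of "k - n * e" e] assms by simp

lemma consec_shift: "consec (i1 + n * e) (i + n * e) \<longleftrightarrow> consec i1 i"
proof -
  have "(\<forall>k. i1 + n * e < k \<longrightarrow> k < i + n * e \<longrightarrow> f k \<noteq> f i) \<longleftrightarrow>
      (\<forall>k. i1 < k \<longrightarrow> k < i \<longrightarrow> f k \<noteq> f i)" (is "?L \<longleftrightarrow> ?R")
  proof
    assume ?L
    then show ?R using f_period_mult by (metis add_less_cancel_right)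
  next
    assume R: ?R
    show ?L
    proof (intro allI impI)
      fix k assume "i1 + n * e < k" "k < i + n * e"
      then have "f (k - n * e) \<noteq> f i" using R by auto
      then show "f k \<noteq> f i" using f_shift_down[of e k] \<open>i1 + n * e < k\<close> by simp
    qed
  qed
  then show ?thesis by (simp add: consec_def f_period_mult)
qed

lemma gap_shift: "gap L (i1 + n * e) (i + n * e) = (\<lambda>k. k + n * e) ` gap L i1 i"
proof (intro Set.set_eqI iffI)
  fix k assume k: "k \<in> gap L (i1 + n * e) (i + n * e)"
  then have "k - n * e \<in> gap L i1 i"
    using f_shift_down[of e k] by (auto simp: gap_def f_period_mult)
  then show "k \<in> (\<lambda>k. k + n * e) ` gap L i1 i"
    using k by (intro image_eqI[of _ _ "k - n * e"]) (auto simp: gap_def)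
qed (auto simp: gap_def f_period_mult)

lemma consec_next_unique: "consec i k \<Longrightarrow> consec i k' \<Longrightarrow> k = k'"
  unfolding consec_def by (metis linorder_neqE_nat)

lemma singleD: "single z \<Longrightarrow> f i = z \<Longrightarrow> f k = z \<Longrightarrow> i < k \<Longrightarrow> i + n \<le> k"
  by (simp add: single_def)

lemma singleI:
  assumes "consec i (i + n)" "f i = z"
  shows "single z"
  unfolding single_def
proof (intro allI impI)
  have uniq: "k mod n = i mod n" if "f k = z" for k
  proof -
    obtain k' where k': "i \<le> k'" "k' < i + n" "k' mod n = k mod n" "f k' = f k"
      using window_rep by metis
    then have "k' = i" using assms that by (cases "k' = i") (auto simp: consec_def f_period)
    then show ?thesis using k' by simp
  qed
  fix a b assume "f a = z" "f b = z" "a < b"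
  then show "a + n \<le> b" using mod_eq_window[of a b] uniq by metis
qed

lemma not_single_consec:
  assumes "\<not> single z"
  obtains i1 i where "consec i1 i" "f i = z" "i < i1 + n"
proof -
  obtain j k where jk: "f j = z" "f k = z" "j < k" "k < j + n"
    using assms unfolding single_def by (metis not_le)
  then obtain i1 where "consec i1 k" "j \<le> i1" using consec_ex[of j k] by metis
  then show ?thesis using that jk by simp
qed

context
  fixes L c r assumes c: "cchain L c r"
begin

lemma cchain_letter: "j < r \<Longrightarrow> f (c j) = (if even j then f (c 0) else f (c 1))"
proof (induction j rule: less_induct)
  case (less j)
  consider "j = 0" | "j = 1" | j' where "j = j' + 2" by (metis One_nat_def add_2_eq_Suc' not0_implies_Suc)
  then show ?case
  proof cases
    case 3
    have "f (c j') = f (c j)" using c less.prems 3 by (auto simp: cchain_def consec_def)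
    then show ?thesis using less.IH[of j'] less.prems 3 by auto
  qed auto
qed

lemma cchain_linked: "j + 1 < r \<Longrightarrow> linked (c j) (c (j + 1))"
proof (cases j)
  case (Suc j')
  assume "j + 1 < r"
  then have "consec (c j') (c (j' + 2))" "gap L (c j') (c (j' + 2)) = {c (j' + 1)}"
    using c Suc by (auto simp: cchain_def)
  then show ?thesis using linked_if_gap_single(1) Suc by fastforce
qed (use c in \<open>auto simp: cchain_def\<close>)

lemma cchain_less: "j < k \<Longrightarrow> k < r \<Longrightarrow> c j < c k"
proof (induction k)
  case (Suc k)
  have "c k < c (Suc k)" using cchain_linked[of k] Suc.prems by (simp add: linked_def)
  then show ?case using Suc by (cases "j = k") auto
qed simp

lemma cchain_consec: "j + 2 < r \<Longrightarrow> consec (c j) (c (j + 2))"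
  and cchain_gap: "j + 2 < r \<Longrightarrow> gap L (c j) (c (j + 2)) = {c (j + 1)}"
  using c by (auto simp: cchain_def)

lemma cchain_letters_neq: "f (c 0) \<noteq> f (c 1)"
  using c linked_neq by (auto simp: cchain_def)

lemma cchain_between:
  assumes "c i \<le> k" "k < c (i + 2 * p)" "i + 2 * p < r"
  obtains j where "j < p" "c (i + 2 * j) \<le> k" "k < c (i + 2 * j + 2)"
proof -
  have "\<exists>j<p. c (i + 2 * j) \<le> k \<and> k < c (i + 2 * j + 2)"
    using assms
  proof (induction p)
    case (Suc p)
    show ?case
    proof (cases "k < c (i + 2 * p)")
      case True
      then show ?thesis using Suc by (metis less_SucI Suc_lessD add_Suc_right mult_Suc_right add_2_eq_Suc)
    next
      case False
      then show ?thesis using Suc.prems by (intro exI[of _ p]) (auto simp: algebra_simps)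
    qed
  qed simp
  then show ?thesis using that by blast
qed

text \<open>The even positions of the chain are consecutive occurrences of the first letter, so
  \<open>c 0 + n\<close> cannot fall strictly between two of them, nor between the last one and a
  final odd position linked to it. The chain is long enough to reach it.\<close>

lemma cchain_wrap:
  assumes "c 0 + n \<le> c (r - 1)"
  obtains p where "p \<ge> 1" "2 * p < r" "c (2 * p) = c 0 + n"
proof -
  have r2: "r \<ge> 2" using c by (simp add: cchain_def)
  define P where "P k \<longleftrightarrow> 2 * k < r \<and> c (2 * k) \<le> c 0 + n" for k
  define p where "p = Greatest P"
  have P0: "P 0" using r2 by (simp add: P_def)
  have bound: "\<And>k. P k \<Longrightarrow> k \<le> r" by (auto simp: P_def)
  have Pp: "P p" unfolding p_def by (rule GreatestI_nat[of P 0 r]) (use P0 bound in auto)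
  have max: "\<not> P (Suc p)"
    using Greatest_le_nat[of P "Suc p" r] bound unfolding p_def[symmetric] by auto
  have eq: "c (2 * p) = c 0 + n"
  proof (rule ccontr)
    assume "c (2 * p) \<noteq> c 0 + n"
    then have lt: "c (2 * p) < c 0 + n" using Pp by (simp add: P_def)
    have fs: "f (c 0 + n) = f (c (2 * p))" using cchain_letter[of "2 * p"] Pp f_period by (simp add: P_def)
    consider "2 * p + 2 < r" | "2 * p + 2 = r" | "2 * p + 1 = r" using Pp by (auto simp: P_def) linarith
    then show False
    proof cases
      case 1
      then have "c 0 + n < c (2 * p + 2)" using max by (auto simp: P_def)
      then show False using cchain_consec[OF 1] lt fs by (auto simp: consec_def)
    next
      case 2
      then have "c 0 + n \<le> c (2 * p + 1)" using assms by (metis add_2_eq_Suc' add_diff_cancel_left' diff_Suc_1 plus_1_eq_Suc Suc_eq_plus1)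
      moreover have l: "linked (c (2 * p)) (c (2 * p + 1))" using cchain_linked 2 by simp
      moreover have "c 0 + n \<noteq> c (2 * p + 1)" using fs linked_neq[OF l] by metis
      ultimately show False using lt fs by (auto simp: linked_def)
    next
      case 3
      then show False using assms lt by auto
    qed
  qed
  moreover have "p \<ge> 1" using eq n_pos by (cases p) auto
  ultimately show ?thesis using that Pp by (auto simp: P_def)
qed

section \<open>Chains that wrap around a period\<close>

context
  fixes p assumes p: "p \<ge> 1" "2 * p < r" "c (2 * p) = c 0 + n"
begin

text \<open>The gaps of the first letter along the chain cover a whole period and contain nothing
  but the second letter.\<close>

lemma wrap_first_neighbours:
  assumes "f k \<in> L" "adj (f k) (f (c 0))"
  shows "f k = f (c 1)"
proof -
  obtain k' where k': "c 0 \<le> k'" "k' < c 0 + n" "f k' = f k" using window_rep by metis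
  obtain j where j: "j < p" "c (2 * j) \<le> k'" "k' < c (2 * j + 2)"
    using cchain_between[of 0 k' p] k' p by auto
  have fj: "f (c (2 * j)) = f (c 0)" "f (c (2 * j + 2)) = f (c 0)" "f (c (2 * j + 1)) = f (c 1)"
    using cchain_letter[of "2 * j"] cchain_letter[of "2 * j + 2"] cchain_letter[of "2 * j + 1"] j p by auto
  have "k' \<noteq> c (2 * j)" using fj k' assms adj_irrefl f_in by metis
  then have "k' \<in> gap L (c (2 * j)) (c (2 * j + 2))"
    using j k' assms fj by (simp add: gap_def)
  also have "\<dots> = {c (2 * j + 1)}" using cchain_gap j p by simp
  finally show ?thesis using k' fj by simp
qed

text \<open>This is the exceptional gap, the only one of the second letter that the chain does not
  control. All neighbours of the second letter outside the pair sit in it.\<close>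

lemma wrap_second_consec: "consec (c (2 * p - 1)) (c 1 + n)"
proof -
  have l: "linked (c (2 * p - 1)) (c (2 * p))" using cchain_linked[of "2 * p - 1"] p by simp
  have l0: "linked (c 0) (c 1)" using cchain_linked[of 0] p by simp
  have f1: "f (c (2 * p - 1)) = f (c 1)" using cchain_letter[of "2 * p - 1"] p by simp
  have f0: "f (c (2 * p)) = f (c 0)" using cchain_letter[of "2 * p"] p by simp
  have "f k \<noteq> f (c 1)" if k: "c (2 * p - 1) < k" "k < c 1 + n" for k
  proof -
    consider "k < c (2 * p)" | "k = c (2 * p)" | "k > c 0 + n" using p by linarith
    then show ?thesis
    proof cases
      case 1
      then show ?thesis using l k f1 by (auto simp: linked_def)
    next
      case 2
      then show ?thesis using f0 cchain_letters_neq by simp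
    next
      case 3
      then have "f (k - n) \<noteq> f (c 1)" using l0 k by (auto simp: linked_def)
      then show ?thesis using f_shift_down[of 1 k] 3 by simp
    qed
  qed
  moreover have "c (2 * p - 1) < c 1 + n"
    using l l0 p by (simp add: linked_def)
  ultimately show ?thesis using f1 by (simp add: consec_def f_period)
qed

lemma wrap_first_positions:
  assumes "c 0 \<le> k" "k < c 0 + n" "f k = f (c 0)"
  obtains j where "j < p" "k = c (2 * j)"
proof -
  obtain j where j: "j < p" "c (2 * j) \<le> k" "k < c (2 * j + 2)"
    using cchain_between[of 0 k p] assms p by auto
  have "consec (c (2 * j)) (c (2 * j + 2))" using cchain_consec j p by simp
  then have "k = c (2 * j)" using j assms cchain_letter[of "2 * j + 2"] p
    by (cases "k = c (2 * j)") (auto simp: consec_def)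
  then show ?thesis using that j by blast
qed

lemma wrap_second_positions:
  assumes "c 1 \<le> k" "k < c 1 + n" "f k = f (c 1)"
  obtains j where "j < p" "k = c (2 * j + 1)"
proof (cases "k \<le> c (2 * p - 1)")
  case False
  then show ?thesis using wrap_second_consec assms by (auto simp: consec_def f_period)
next
  case True
  show ?thesis
  proof (cases "k = c (2 * p - 1)")
    case True
    moreover have "2 * (p - 1) + 1 = 2 * p - 1" using p by simp
    ultimately show ?thesis using that[of "p - 1"] p by simp
  next
    case F: False
    have e: "1 + 2 * (p - 1) = 2 * p - 1" and e': "2 * p - 1 < r" using p by simp_all
    have "k < c (2 * p - 1)" using F True by simp
    then obtain j where j: "j < p - 1" "c (1 + 2 * j) \<le> k" "k < c (1 + 2 * j + 2)"
      by (rule cchain_between[of 1 k "p - 1", unfolded e, OF assms(1) _ e'])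
    have "consec (c (1 + 2 * j)) (c (1 + 2 * j + 2))" using cchain_consec j p by simp
    then have "k = c (1 + 2 * j)" using j assms cchain_letter[of "1 + 2 * j + 2"] p
      by (cases "k = c (1 + 2 * j)") (auto simp: consec_def)
    then show ?thesis using that[of j] j by simp
  qed
qed

lemma wrap_second_neighbours:
  assumes "c 1 \<le> k" "k < c 1 + n" "f k \<in> L" "adj (f k) (f (c 1))" "f k \<noteq> f (c 0)"
  shows "k \<in> gap L (c (2 * p - 1)) (c 1 + n)"
proof -
  have f1: "f (c (2 * p - 1)) = f (c 1)" using cchain_letter[of "2 * p - 1"] p by simp
  have "k > c (2 * p - 1)"
  proof (rule ccontr)
    assume "\<not> k > c (2 * p - 1)"
    moreover have "k \<noteq> c (2 * p - 1)" using f1 assms adj_irrefl f_in by metis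
    ultimately have k: "k < c (2 * p - 1)" by simp
    have e: "1 + 2 * (p - 1) = 2 * p - 1" and e': "2 * p - 1 < r" using p by simp_all
    obtain j where j: "j < p - 1" "c (1 + 2 * j) \<le> k" "k < c (1 + 2 * j + 2)"
      by (rule cchain_between[of 1 k "p - 1", unfolded e, OF assms(1) k e'])
    have fj: "f (c (1 + 2 * j)) = f (c 1)" "f (c (1 + 2 * j + 2)) = f (c 1)" "f (c (1 + 2 * j + 1)) = f (c 0)"
      using cchain_letter[of "1 + 2 * j"] cchain_letter[of "1 + 2 * j + 2"]
        cchain_letter[of "1 + 2 * j + 1"] j p by auto
    have "k \<noteq> c (1 + 2 * j)" using fj assms adj_irrefl f_in by metis
    then have "k \<in> gap L (c (1 + 2 * j)) (c (1 + 2 * j + 2))"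
      using j assms fj by (simp add: gap_def)
    also have "\<dots> = {c (1 + 2 * j + 1)}" using cchain_gap[of "1 + 2 * j"] j p by simp
    finally show False using fj assms by simp
  qed
  then show ?thesis using assms by (simp add: gap_def f_period)
qed

lemma wrap_second_gap_first:
  assumes "k \<in> gap L (c (2 * p - 1)) (c 1 + n)" "f k = f (c 0)"
  shows "k = c 0 + n"
proof -
  have l: "linked (c (2 * p - 1)) (c (2 * p))" using cchain_linked[of "2 * p - 1"] p by simp
  have l0: "linked (c 0) (c 1)" using cchain_linked[of 0] p by simp
  have f0: "f (c (2 * p)) = f (c 0)" using cchain_letter[of "2 * p"] p by simp
  have k: "c (2 * p - 1) < k" "k < c 1 + n" using assms by (auto simp: gap_def)
  have "\<not> k < c (2 * p)" using l k f0 assms(2) by (auto simp: linked_def)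
  moreover have "\<not> k > c 0 + n"
  proof
    assume g: "k > c 0 + n"
    then have "f (k - n) \<noteq> f (c 0)" using l0 k by (auto simp: linked_def)
    then show False using f_shift_down[of 1 k] g assms(2) by simp
  qed
  ultimately show ?thesis using p by simp
qed

text \<open>One more position on the chain makes the exceptional gap a single position as well. Then
  neither letter has a neighbour in \<open>L\<close> outside the pair, and connectedness does the
  rest.\<close>

lemma wrap_dihedral:
  assumes "2 * p + 2 \<le> r" "connected L" "L \<subseteq> range f"
  shows "L = {f (c 0), f (c 1)}"
proof -
  have cons: "consec (c (2 * p - 1)) (c (2 * p + 1))"
    and g: "gap L (c (2 * p - 1)) (c (2 * p + 1)) = {c (2 * p)}"
    using cchain_consec[of "2 * p - 1"] cchain_gap[of "2 * p - 1"] assms(1) p by auto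
  have e: "c (2 * p + 1) = c 1 + n" using consec_next_unique[OF cons wrap_second_consec] .
  have t: "f k = f (c 0)" if k: "f k \<in> L" "adj (f k) (f (c 1))" for k
  proof (rule ccontr)
    assume ne: "f k \<noteq> f (c 0)"
    obtain k' where k': "c 1 \<le> k'" "k' < c 1 + n" "f k' = f k" using window_rep by metis
    then have "k' = c (2 * p)" using wrap_second_neighbours[of k'] k ne g e by auto
    then show False using k' ne cchain_letter[of "2 * p"] p by simp
  qed
  let ?X = "{f (c 0), f (c 1)}"
  have XL: "?X \<subseteq> L" using c by (simp add: cchain_def)
  show ?thesis
  proof (rule ccontr)
    assume "L \<noteq> ?X"
    then obtain x y where xy: "x \<in> ?X" "y \<in> L - ?X" "adj x y"
      using assms(2) XL unfolding connected_def by (metis insert_not_empty)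
    obtain k where "y = f k" using xy assms(3) by auto
    then show False using xy t[of k] wrap_first_neighbours[of k] adj_sym f_in by auto
  qed
qed

end

end

lemma chain_to_cchain:
  assumes "chain_to L r j i" "f j \<in> L" "f i \<in> L"
  obtains c where "cchain L c r" "c (r - 2) = j" "c (r - 1) = i"
proof -
  have "\<exists>c. cchain L c r \<and> c (r - 2) = j \<and> c (r - 1) = i"
    using assms
  proof (induction rule: chain_to.induct)
    case (start j i)
    then show ?case by (intro exI[of _ "\<lambda>k. if k = 0 then j else i"]) (auto simp: cchain_def)
  next
    case (step r i1 j i)
    have "j \<in> gap L i1 i" using step by simp
    then have "f j \<in> L" by (simp add: gap_def)
    moreover have "f i1 \<in> L" using step by (simp add: consec_def)
    ultimately obtain c where c: "cchain L c r" "c (r - 2) = i1" "c (r - 1) = j"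
      using step.IH by blast
    have r: "r \<ge> 2" using c by (simp add: cchain_def)
    have H: "cchain L (c(r := i)) (Suc r)"
      unfolding cchain_def
    proof (intro conjI allI impI)
      fix k assume k: "k + 2 < Suc r"
      show "consec ((c(r := i)) k) ((c(r := i)) (k + 2))"
        using step c k by (cases "k + 2 = r") (auto simp: cchain_def)
      show "gap L ((c(r := i)) k) ((c(r := i)) (k + 2)) = {(c(r := i)) (k + 1)}"
        using step c k by (cases "k + 2 = r") (auto simp: cchain_def)
    qed (use c r in \<open>auto simp: cchain_def\<close>)
    have "(c(r := i)) (Suc r - 2) = j" "(c(r := i)) (Suc r - 1) = i"
      using c r by (auto simp: numeral_2_eq_2)
    then show ?case using H by blast
  qed
  then show ?thesis using that by blast
qed

text \<open>The first \<open>M\<close> positions already form a full chain, which wraps around. As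
  \<open>wrap_dihedral\<close> excludes \<open>2 * p + 2\<close> positions, \<open>2 * p < M\<close>
  and \<open>M \<le> r\<close> leave only \<open>M = r = 2 * p + 1\<close>.\<close>

lemma full_cchain_band:
  assumes "no_short_braid L" "connected L" "L \<subseteq> range f" "not_finite_dihedral L"
    and c: "cchain L c r" and full: "m (f (c 0)) (f (c 1)) \<le> enat r"
  obtains p where "band L c p" "r = 2 * p + 1"
proof -
  obtain M where M: "m (f (c 0)) (f (c 1)) = enat M" "M \<le> r" using full by (cases "m (f (c 0)) (f (c 1))") auto
  have "m (f (c 0)) (f (c 1)) \<ge> 2" using m_ge_2[OF f_in f_in] cchain_letters_neq[OF c] by metis
  then have M2: "M \<ge> 2" using M by (simp add: numeral_eq_enat)
  have cM: "cchain L c M" using c M M2 by (auto simp: cchain_def)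
  then have "c 0 + n \<le> c (M - 1)" using assms(1) M by (auto simp: no_short_braid_def)
  then obtain p where p: "p \<ge> 1" "2 * p < M" "c (2 * p) = c 0 + n"
    using cchain_wrap[OF cM] by metis
  have "\<not> 2 * p + 2 \<le> r"
  proof
    assume "2 * p + 2 \<le> r"
    then have "L = {f (c 0), f (c 1)}"
      using wrap_dihedral[OF c p(1) _ p(3)] p M assms by simp
    then show False using assms(4) cchain_letters_neq[OF c] M by (auto simp: not_finite_dihedral_def)
  qed
  then have "r = 2 * p + 1" "M = r" using p M by auto
  then show ?thesis using that p M c by (auto simp: band_def)
qed

text \<open>The position \<open>i\<close> lengthens the chain to \<open>r + 1\<close>. Had it been
  full before, it would now exceed its label, whereas a full chain has exactly the length of its
  label by \<open>full_cchain_band\<close>.\<close>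

lemma chain_to_not_full:
  assumes "no_short_braid L" "connected L" "L \<subseteq> range f" "not_finite_dihedral L"
    and "consec i1 i" "f i \<in> L" "gap L i1 i = {j}" "chain_to L r i1 j"
  shows "enat r < m (f i) (f j)"
proof (rule ccontr)
  assume "\<not> enat r < m (f i) (f j)"
  then have le: "m (f i) (f j) \<le> enat r" by simp
  have "j \<in> gap L i1 i" using assms by simp
  then have jL: "f j \<in> L" by (simp add: gap_def)
  obtain c where c: "cchain L c (Suc r)" "c (Suc r - 2) = j" "c (Suc r - 1) = i"
    using chain_to_cchain[OF chain_to.step[OF assms(8,5,7)] jL assms(6)] by metis
  have r: "r \<ge> 2" using chain_to_ge_2[OF assms(8)] .
  have "f i = (if even r then f (c 0) else f (c 1))" "f j = (if even (r - 1) then f (c 0) else f (c 1))"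
    using cchain_letter[OF c(1), of r] cchain_letter[OF c(1), of "r - 1"] c(2,3) r
    by (auto simp: numeral_2_eq_2)
  then have m: "m (f (c 0)) (f (c 1)) \<le> enat r" using le m_sym[OF f_in f_in] r by (auto split: if_splits)
  also have "\<dots> \<le> enat (Suc r)" by simp
  finally obtain p where "band L c p" "Suc r = 2 * p + 1"
    using full_cchain_band[OF assms(1-4) c(1)] by metis
  then show False using m by (simp add: band_def)
qed

text \<open>Only single letters of \<open>J\<close> touch \<open>L - J\<close>, so a letter that
  repeats within a period has the same gaps in \<open>J\<close> as in \<open>L\<close>. Short chains
  and large bands involve only gaps of repeating letters.\<close>

lemma removal:
  assumes "no_empty_gap L" "no_short_braid L" "J \<subseteq> L"
    and attach: "\<And>x y. x \<in> L - J \<Longrightarrow> y \<in> J \<Longrightarrow> adj x y \<Longrightarrow> single y"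
  shows "no_empty_gap J" "no_short_braid J"
    and "\<And>c p. band J c p \<Longrightarrow> p \<ge> 2 \<Longrightarrow> band L c p"
proof -
  have same: "gap J i1 i = gap L i1 i" if "f i \<in> J" "\<not> single (f i)" for i1 i
    using attach[of _ "f i"] that assms(3) by (auto simp: gap_def)
  have ns: "\<not> single (f i)" if "consec i1 i" "i < i1 + n" for i1 i
    using that by (auto simp: single_def consec_def not_le)
  show "no_empty_gap J"
    using assms(1,3) same ns unfolding no_empty_gap_def by (metis subsetD)
  have lift: "cchain L c r" if c: "cchain J c r" and "\<And>j. j + 2 < r \<Longrightarrow> \<not> single (f (c (j + 2)))" for c r
  proof -
    have "f (c (j + 2)) \<in> J" if "j + 2 < r" for j
      using cchain_letter[OF c that] c by (auto simp: cchain_def)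
    then show ?thesis using that same assms(3) unfolding cchain_def by auto
  qed
  show "no_short_braid J"
    unfolding no_short_braid_def
  proof (intro allI impI)
    fix c r assume c: "cchain J c r" "enat r = m (f (c 0)) (f (c 1))"
    show "c 0 + n \<le> c (r - 1)"
    proof (rule ccontr)
      assume short: "\<not> c 0 + n \<le> c (r - 1)"
      have "\<not> single (f (c (j + 2)))" if j: "j + 2 < r" for j
      proof (rule ns)
        show "consec (c j) (c (j + 2))" using cchain_consec[OF c(1) j] .
        have "c 0 \<le> c j" using cchain_less[OF c(1), of 0 j] j by (cases j) auto
        moreover have "c (j + 2) \<le> c (r - 1)"
        proof (cases "j + 2 = r - 1")
          case False
          then have "j + 2 < r - 1" "r - 1 < r" using j by simp_all
          then show ?thesis using cchain_less[OF c(1), of "j + 2" "r - 1"] by simp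
        qed simp
        ultimately show "c (j + 2) < c j + n" using short by simp
      qed
      then have "cchain L c r" using lift[OF c(1)] by blast
      then show False using assms(2) c(2) short by (auto simp: no_short_braid_def)
    qed
  qed
  fix c p assume b: "band J c p" "p \<ge> 2"
  have c: "cchain J c (2 * p + 1)" using b by (simp add: band_def)
  have "\<not> single (f (c (j + 2)))" if j: "j + 2 < 2 * p + 1" for j
  proof (rule ns)
    show "consec (c j) (c (j + 2))" using cchain_consec[OF c j] .
    have "c (j + 2) \<le> c (2 * p)" using cchain_less[OF c, of "j + 2" "2 * p"] j by (cases "j + 2 = 2 * p") auto
    moreover have "c (j + 2) < c (2 * p)" if "j = 0"
      using cchain_less[OF c, of "j + 2" "2 * p"] that b by auto
    moreover have "c 0 < c j" if "j \<noteq> 0" using cchain_less[OF c, of 0 j] that j by auto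
    ultimately show "c (j + 2) < c j + n" using b by (cases "j = 0") (auto simp: band_def)
  qed
  then show "band L c p" using lift[OF c] b by (simp add: band_def)
qed

lemma connected_remove:
  assumes "connected L" "K \<subseteq> L" "\<And>x y. x \<in> K \<Longrightarrow> y \<in> L - K \<Longrightarrow> adj x y \<Longrightarrow> y = u" "L \<subseteq> range f"
  shows "connected (L - K)"
  unfolding connected_def
proof (intro allI impI)
  fix X assume X: "X \<subseteq> L - K" "X \<noteq> {}" "X \<noteq> L - K"
  have LS: "L \<subseteq> S" using assms(4) f_in by auto
  \<comment> \<open>\<open>K\<close> hangs on \<open>u\<close> alone, so it is put on the side of
    the cut that contains \<open>u\<close>.\<close>
  define Y where "Y = (if u \<in> X then X \<union> K else X)"
  have "Y \<subseteq> L" "Y \<noteq> {}" "Y \<noteq> L" using X assms(2) by (auto simp: Y_def split: if_splits)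
  then obtain x y where xy: "x \<in> Y" "y \<in> L - Y" "adj x y"
    using assms(1) unfolding connected_def by metis
  have sym: "adj y x" using xy \<open>Y \<subseteq> L\<close> LS adj_sym by blast
  have "x \<notin> K"
  proof
    assume x: "x \<in> K"
    then have "u \<in> X" using xy X by (auto simp: Y_def split: if_splits)
    then show False using x xy assms(3)[of x y] by (auto simp: Y_def)
  qed
  moreover have "y \<notin> K"
  proof
    assume y: "y \<in> K"
    then have "u \<notin> X" using xy by (auto simp: Y_def split: if_splits)
    then show False using y xy X assms(3)[of y x] sym by (auto simp: Y_def)
  qed
  ultimately show "\<exists>x\<in>X. \<exists>y\<in>(L - K) - X. adj x y"
    using xy by (auto simp: Y_def split: if_splits)
qed

text \<open>Cyclically \<open>z\<close> has at least two gaps per period, and each would need its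
  own occurrence of \<open>u\<close>.\<close>

lemma not_pair_single:
  assumes "no_empty_gap L" "single u" "\<not> single z" "z \<in> L" "L = {u, z}"
  shows False
proof -
  have u_in_gap: "f q = u" if "q \<in> gap L i1 i" "f i = z" for q i1 i
    using that assms(5) gap_neq[OF that(1)] by (auto simp: gap_def)
  obtain i1 i where i: "consec i1 i" "f i = z" "i < i1 + n" using not_single_consec[OF assms(3)] .
  obtain q1 where q1: "q1 \<in> gap L i1 i" using assms(1,4) i by (auto simp: no_empty_gap_def)
  have "i < i1 + n" "f i = f (i1 + n)" using i f_period by (auto simp: consec_def)
  then obtain k where k: "consec k (i1 + n)" "i \<le> k" using consec_ex by metis
  have "i1 + n < k + n" using k i by (simp add: consec_def)
  moreover have "f (i1 + n) = z" using i f_period by (auto simp: consec_def)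
  ultimately obtain q2 where q2: "q2 \<in> gap L k (i1 + n)"
    using assms(1,4) k by (metis all_not_in_conv no_empty_gap_def)
  have "f q1 = u" "f q2 = u" using u_in_gap q1 q2 i \<open>f (i1 + n) = z\<close> by auto
  moreover have "q1 < q2" "q2 < q1 + n" using q1 q2 k by (auto simp: gap_def)
  ultimately show False using singleD[OF assms(2), of q1 q2] by simp
qed

text \<open>If the two occurrences are a full period apart, every letter occurs between them;
  otherwise \<open>no_empty_gap\<close> applies.\<close>

lemma gap_nonempty:
  assumes "no_empty_gap L" "L \<subseteq> range f" "consec i1 i" "f i \<in> L" "y \<in> L" "adj y (f i)"
  shows "gap L i1 i \<noteq> {}"
proof (cases "i < i1 + n")
  case True
  then show ?thesis using assms by (auto simp: no_empty_gap_def)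
next
  case False
  obtain ky where "y = f ky" using assms by auto
  then obtain k where k: "i1 \<le> k" "k < i1 + n" "f k = y" using window_rep by metis
  then have "k \<noteq> i1" using assms adj_irrefl f_in by (auto simp: consec_def)
  then have "k \<in> gap L i1 i" using k False assms by (simp add: gap_def)
  then show ?thesis by auto
qed

lemma has_neighbour:
  assumes "no_empty_gap L" "connected L" "z \<in> L" "\<exists>z\<in>L. \<not> single z"
  obtains y where "y \<in> L" "adj z y"
proof -
  have "L \<noteq> {z}"
  proof
    assume L: "L = {z}"
    then obtain i1 i where i: "consec i1 i" "f i = z" "i < i1 + n" using not_single_consec assms by blast
    then obtain q where q: "q \<in> gap L i1 i" using assms by (auto simp: no_empty_gap_def)
    then show False using gap_neq[OF q] L i by (auto simp: gap_def)
  qed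
  then obtain x y where "x \<in> {z}" "y \<in> L - {z}" "adj x y"
    using assms(2,3) unfolding connected_def by (metis empty_subsetI insert_not_empty insert_subset)
  then show ?thesis using that by blast
qed

section \<open>Gaps at congruent positions\<close>

lemma gap_transport:
  assumes "consec i1 i" "consec k1 k" "i mod n = k mod n"
  obtains e e' where "(\<lambda>x. x + n * e) ` gap L i1 i = (\<lambda>x. x + n * e') ` gap L k1 k"
proof -
  obtain e e' where e: "i + n * e = k + n * e'" using common_shift[OF assms(3)] .
  have "consec (i1 + n * e) (i + n * e)" "consec (k1 + n * e') (k + n * e')"
    using assms consec_shift by auto
  then have "i1 + n * e = k1 + n * e'" using e consec_unique by metis
  then have "gap L (i1 + n * e) (i + n * e) = gap L (k1 + n * e') (k + n * e')" using e by simp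
  then show ?thesis using that gap_shift by metis
qed

lemma gap_transport_single:
  assumes "consec i1 i" "consec k1 k" "i mod n = k mod n" "gap L k1 k = {q}"
  obtains q' where "gap L i1 i = {q'}"
proof -
  obtain e e' where "(\<lambda>x. x + n * e) ` gap L i1 i = {q + n * e'}"
    using gap_transport[OF assms(1-3), of L] assms(4) by auto
  then have "inj_on (\<lambda>x. x + n * e) (gap L i1 i)" "card ((\<lambda>x. x + n * e) ` gap L i1 i) = 1"
    by (auto simp: inj_on_def)
  then have "card (gap L i1 i) = 1" by (simp add: card_image)
  then show ?thesis using that by (auto simp: card_1_singleton_iff)
qed

lemma gap_transport_member:
  assumes "consec i1 i" "consec k1 k" "i mod n = k mod n" "q \<in> gap L k1 k"
  obtains q' where "q' \<in> gap L i1 i" "f q' = f q"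
proof -
  obtain e e' where "(\<lambda>x. x + n * e) ` gap L i1 i = (\<lambda>x. x + n * e') ` gap L k1 k"
    using gap_transport[OF assms(1-3)] .
  then have "q + n * e' \<in> (\<lambda>x. x + n * e) ` gap L i1 i" using assms(4) by auto
  then obtain q' where "q' \<in> gap L i1 i" "q + n * e' = q' + n * e" by auto
  moreover from this have "f q' = f q" by (metis f_period_mult)
  ultimately show ?thesis using that by blast
qed

text \<open>Reduces questions about an arbitrary gap of a band letter to the gaps on the chain and
  the exceptional gap. Congruence modulo \<open>n\<close> is enough, since gaps can be transported
  by periods.\<close>

lemma band_consec_cases:
  assumes b: "band L c p" and i: "consec i1 i" "f i \<in> {f (c 0), f (c 1)}"
  obtains j where "j + 2 \<le> 2 * p" "i mod n = c (j + 2) mod n"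
    | "f i = f (c 1)" "i mod n = (c 1 + n) mod n"
proof -
  have c: "cchain L c (2 * p + 1)" and p: "p \<ge> 1" "2 * p < 2 * p + 1" "c (2 * p) = c 0 + n"
    using b by (auto simp: band_def)
  note thesis1 = that(1) and thesis2 = that(2)
  show ?thesis
  proof (cases "f i = f (c 0)")
    case True
    obtain k where k: "c 0 + 1 \<le> k" "k < c 0 + 1 + n" "k mod n = i mod n" "f k = f i" using window_rep .
    show ?thesis
    proof (cases "k = c 0 + n")
      case True
      have e: "2 * p - 2 + 2 = 2 * p" using p by simp
      have "i mod n = c (2 * p - 2 + 2) mod n" unfolding e using True k p by simp
      then show ?thesis using thesis1[of "2 * p - 2"] e by simp
    next
      case False
      then obtain j where j: "j < p" "k = c (2 * j)"
        using wrap_first_positions[OF c p, of k] k True by auto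
      then have "j \<ge> 1" using k by (cases j) auto
      then have e: "2 * j - 2 + 2 = 2 * j" by simp
      have "i mod n = c (2 * j - 2 + 2) mod n" unfolding e using j k by simp
      then show ?thesis using thesis1[of "2 * j - 2"] e j by simp
    qed
  next
    case False
    then have fi: "f i = f (c 1)" using i by auto
    obtain k where k: "c 1 + 1 \<le> k" "k < c 1 + 1 + n" "k mod n = i mod n" "f k = f i" using window_rep .
    show ?thesis
    proof (cases "k = c 1 + n")
      case True
      then show ?thesis using k thesis2 fi by simp
    next
      case False
      then obtain j where j: "j < p" "k = c (2 * j + 1)"
        using wrap_second_positions[OF c p, of k] k fi by auto
      then have "j \<ge> 1" using k by (cases j) auto
      then have e: "2 * j - 1 + 2 = 2 * j + 1" by simp
      have "i mod n = c (2 * j - 1 + 2) mod n" unfolding e using j k by simp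
      then show ?thesis using thesis1[of "2 * j - 1"] e j by simp
    qed
  qed
qed

lemma band_first_gap:
  assumes b: "band L c p" and i: "consec i1 i" "f i = f (c 0)"
  obtains q where "gap L i1 i = {q}"
proof -
  have c: "cchain L c (2 * p + 1)" using b by (simp add: band_def)
  show ?thesis
  proof (rule band_consec_cases[OF b i(1)])
    fix j assume j: "j + 2 \<le> 2 * p" "i mod n = c (j + 2) mod n"
    show ?thesis
      using gap_transport_single[OF i(1) cchain_consec[OF c, of j] j(2)] cchain_gap[OF c, of j] j(1) that
      by auto
  qed (use i cchain_letters_neq[OF c] in auto)
qed

lemma band_second_gap:
  assumes b: "band L c p" and i: "consec i1 i" "f i = f (c 1)"
  shows "(\<exists>q. gap L i1 i = {q}) \<or> i mod n = (c 1 + n) mod n"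
proof -
  have c: "cchain L c (2 * p + 1)" using b by (simp add: band_def)
  show ?thesis
  proof (rule band_consec_cases[OF b i(1)])
    fix j assume j: "j + 2 \<le> 2 * p" "i mod n = c (j + 2) mod n"
    have "consec (c j) (c (j + 2))" "gap L (c j) (c (j + 2)) = {c (j + 1)}"
      using cchain_consec[OF c, of j] cchain_gap[OF c, of j] j(1) by auto
    then show ?thesis using gap_transport_single[OF i(1) _ j(2)] by metis
  qed (use i in auto)
qed

text \<open>The letter \<open>z\<close> survives every removal, because the removed letters are
  single or belong to a large band. It keeps the induction away from finite dihedral remainders:
  next to \<open>z\<close> there remains a single letter \<open>u\<close>, and these two cannot be
  all by \<open>not_pair_single\<close>.\<close>

theorem straight_on_if_repeated_letter:
  assumes "finite L" "L \<subseteq> range f" "no_empty_gap L" "no_short_braid L" "connected L"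
    "not_finite_dihedral L" "z \<in> L" "\<not> single z" "\<not> in_large_band L z"
  shows "straight_on L"
  using assms
proof (induction "card L" arbitrary: L rule: less_induct)
  case less
  note L = less.prems
  note not_full = chain_to_not_full[OF L(4,5,2,6)]
  have nonempty: "gap L i1 i \<noteq> {}" if ic: "consec i1 i" "f i \<in> L" for i1 i
  proof -
    obtain y where y: "y \<in> L" "adj (f i) y" using has_neighbour[OF L(3,5) ic(2)] L(7,8) by metis
    then have "adj y (f i)" using L(2) f_in adj_sym by auto
    then show ?thesis using gap_nonempty[OF L(3,2) ic y(1)] by simp
  qed
  have remove: "straight_on (L - K)"
    if K: "K \<subseteq> L" "K \<noteq> {}" "z \<notin> K" "u \<in> L - K" "single u"
      and att: "\<And>x y. x \<in> K \<Longrightarrow> y \<in> L - K \<Longrightarrow> adj x y \<Longrightarrow> y = u" for K u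
  proof (rule less.hyps)
    have sub: "L - K \<subseteq> L" by auto
    have a: "\<And>x y. x \<in> L - (L - K) \<Longrightarrow> y \<in> L - K \<Longrightarrow> adj x y \<Longrightarrow> single y"
      using att K by auto
    note rem = removal[OF L(3,4) sub a]
    show "card (L - K) < card L" using K L(1) by (intro psubset_card_mono) auto
    show "finite (L - K)" "L - K \<subseteq> range f" "z \<in> L - K" "\<not> single z" using K L by auto
    show ne: "no_empty_gap (L - K)" and "no_short_braid (L - K)" using rem by auto
    show "connected (L - K)" using connected_remove[OF L(5) K(1) att L(2)] .
    show "\<not> in_large_band (L - K) z" using rem(3) L(9) by (auto simp: in_large_band_def)
    show "not_finite_dihedral (L - K)"
      unfolding not_finite_dihedral_def
    proof (intro allI impI)
      fix s t assume st: "L - K = {s, t}" "s \<noteq> t"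
      have "z \<noteq> u" using K L(8) by auto
      moreover have "z \<in> {s, t}" "u \<in> {s, t}" using st K L(7) by auto
      ultimately have "L - K = {u, z}" using st by auto
      then show "m s t = \<infinity>" using not_pair_single[OF ne K(5) L(8)] by auto
    qed
  qed
  \<comment> \<open>In a bad band the exceptional gap contains just one position \<open>q\<close>
    besides \<open>c 0 + n\<close>. The latter closes a full chain and need not outweigh the
    subtracted value, and \<open>q\<close> alone cannot both outweigh it and survive.\<close>
  consider (small) c where "band L c 1"
    | (bad) c p q where "band L c p" "p \<ge> 2" "q \<noteq> c 0 + n"
        "gap L (c (2 * p - 1)) (c 1 + n) = {c 0 + n, q}"
    | (growth) "\<And>c. \<not> band L c 1"
        "\<And>c p q. band L c p \<Longrightarrow> p \<ge> 2 \<Longrightarrow> q \<noteq> c 0 + n \<Longrightarrow>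
          gap L (c (2 * p - 1)) (c 1 + n) \<noteq> {c 0 + n, q}"
    by blast
  then show ?case
  proof cases
    case small
    have c: "cchain L c (2 * 1 + 1)" and p: "(1::nat) \<ge> 1" "(2::nat) * 1 < 2 * 1 + 1" "c (2 * 1) = c 0 + n"
      using small by (auto simp: band_def)
    let ?K = "{f (c 0)}"
    have s0: "single (f (c 0))"
      using cchain_consec[OF c, of 0] p by (intro singleI[of "c 0"]) (simp_all add: numeral_2_eq_2)
    have s1: "single (f (c 1))"
      using wrap_second_consec[OF c p] by (intro singleI[of "c 1"]) simp_all
    have cL: "f (c 0) \<in> L" "f (c 1) \<in> L" using c by (auto simp: cchain_def)
    have "straight_on (L - ?K)"
    proof (rule remove)
      show "f (c 1) \<in> L - ?K" using cL cchain_letters_neq[OF c] by auto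
      show "z \<notin> ?K" using s0 L(8) by auto
      fix x y assume xy: "x \<in> ?K" "y \<in> L - ?K" "adj x y"
      then obtain k where "y = f k" using L(2) by auto
      then show "y = f (c 1)" using wrap_first_neighbours[OF c p, of k] xy adj_sym f_in by auto
    qed (use s1 cL in auto)
    then show ?thesis
    proof (rule straight_on_extend[rotated])
      fix i1 i j assume "f i \<in> L - (L - ?K)" "f j \<in> L - (L - ?K)" "linked j i"
      then show "\<exists>y\<in>gap L i1 i. y \<noteq> j \<and> linked i1 y \<and>
          (f y \<in> L - ?K \<or> (\<forall>r. chain_to L r i1 y \<longrightarrow> enat r < m (f y) (f i)))"
        using linked_neq[of j i] by auto
    qed (use nonempty not_full in auto)
  next
    case bad
    have c: "cchain L c (2 * p + 1)" and p: "p \<ge> 1" "2 * p < 2 * p + 1" "c (2 * p) = c 0 + n"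
      using bad by (auto simp: band_def)
    let ?K = "{f (c 0), f (c 1)}"
    have cL: "f (c 0) \<in> L" "f (c 1) \<in> L" using c by (auto simp: cchain_def)
    have qg: "q \<in> gap L (c (2 * p - 1)) (c 1 + n)" using bad by simp
    have uK: "f q \<notin> ?K"
      using wrap_second_gap_first[OF c p qg] bad(3) gap_neq[OF qg] f_period by auto
    have uL: "f q \<in> L" "adj (f q) (f (c 1))" using qg f_period by (auto simp: gap_def)
    have nbr: "k = q" if k: "c 1 \<le> k" "k < c 1 + n" "f k \<in> L" "adj (f k) (f (c 1))" "f k \<notin> ?K" for k
    proof -
      have "k \<in> gap L (c (2 * p - 1)) (c 1 + n)" using wrap_second_neighbours[OF c p k(1-4)] k(5) by auto
      then show ?thesis using bad(4) k(5) f_period[of "c 0"] by auto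
    qed
    have rep: "k mod n = q mod n" if k: "f k \<in> L" "adj (f k) (f (c 1))" "f k \<notin> ?K" for k
    proof -
      obtain k' where "c 1 \<le> k'" "k' < c 1 + n" "k' mod n = k mod n" "f k' = f k" using window_rep .
      then show ?thesis using nbr[of k'] k by metis
    qed
    have su: "single (f q)"
      unfolding single_def
    proof (intro allI impI)
      fix i k assume "f i = f q" "f k = f q" "i < k"
      then show "i + n \<le> k" using mod_eq_window[of i k] rep uL uK by metis
    qed
    have "straight_on (L - ?K)"
    proof (rule remove)
      show "f q \<in> L - ?K" using uL uK by auto
      show "z \<notin> ?K" using bad L(9) by (auto simp: in_large_band_def)
      fix x y assume xy: "x \<in> ?K" "y \<in> L - ?K" "adj x y"
      then obtain k where k: "y = f k" using L(2) by auto
      have "adj y x" using xy k f_in adj_sym by auto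
      then have "x = f (c 1)" using wrap_first_neighbours[OF c p, of k] xy k by auto
      then have "k mod n = q mod n" using xy k \<open>adj y x\<close> by (intro rep) auto
      then show "y = f q" using k f_mod[of k q] by simp
    qed (use su cL in auto)
    then show ?thesis
    proof (rule straight_on_extend[rotated])
      fix i1 i j
      assume i: "consec i1 i" "f i \<in> L - (L - ?K)" and g: "gap L i1 i \<noteq> {j}"
        and j: "f j \<in> L - (L - ?K)" "linked j i"
      have jg: "j \<in> gap L i1 i" using linked_in_gap[OF j(2) i(1)] j by auto
      \<comment> \<open>Among the gaps of the two removed letters only the exceptional one can hold
        more than one position, and it contains the letter \<open>f q\<close>, which lies in the
        smaller set.\<close>
      have ns: "gap L i1 i \<noteq> {q'}" for q' using jg g by auto
      have "f i \<noteq> f (c 0)" using band_first_gap[OF bad(1) i(1)] ns by metis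
      then have fi: "f i = f (c 1)" using i by auto
      have "i mod n = (c 1 + n) mod n" using band_second_gap[OF bad(1) i(1) fi] ns by blast
      then obtain q' where q': "q' \<in> gap L i1 i" "f q' = f q"
        using gap_transport_member[OF i(1) wrap_second_consec[OF c p] _ qg] by metis
      then obtain y where "y \<in> gap L i1 i" "f y = f q" "linked i1 y"
        using first_in_gap[OF i(1)] by metis
      then show "\<exists>y\<in>gap L i1 i. y \<noteq> j \<and> linked i1 y \<and>
          (f y \<in> L - ?K \<or> (\<forall>r. chain_to L r i1 y \<longrightarrow> enat r < m (f y) (f i)))"
        using uL uK j by (intro bexI[of _ y]) auto
    qed (use nonempty not_full in auto)
  next
    case growth
    show ?thesis
    proof (rule straight_on_extend[of "{}"])
      show "straight_on {}" by (simp add: straight_on_def prefix_on_def red_def)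
      fix i1 i j
      assume i: "consec i1 i" "f i \<in> L - {}" and g: "gap L i1 i \<noteq> {j}"
        and j: "f j \<in> L - {}" "linked j i"
      have fi1: "f i1 = f i" using i by (simp add: consec_def)
      have jg: "j \<in> gap L i1 i" using linked_in_gap[OF j(2) i(1)] j by auto
      have pick: "\<exists>y. y \<in> gap L i1 i \<and> y \<noteq> j \<and> f y = f q \<and> linked i1 y"
        if q: "q \<in> gap L i1 i" "q \<noteq> j" for q
      proof -
        obtain y where y: "y \<in> gap L i1 i" "f y = f q" "y \<le> q" "linked i1 y"
          using first_in_gap[OF i(1) q(1)] .
        have "y \<noteq> j"
        proof
          assume "y = j"
          then have "f q = f j" "j < q" "q < i" using y q by (auto simp: gap_def)
          then show False using j(2) by (auto simp: linked_def)
        qed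
        then show ?thesis using y by blast
      qed
      \<comment> \<open>The positions that do not qualify for \<open>second\<close>. By
        \<open>full_band\<close> each of them closes a large band whose exceptional gap is the
        present one.\<close>
      define full where "full y \<longleftrightarrow> (\<exists>r. chain_to L r i1 y \<and> \<not> enat r < m (f y) (f i))" for y
      have full_band: "\<exists>c p. band L c p \<and> p \<ge> 2 \<and> c (2 * p) = y \<and> c (2 * p - 1) = i1"
        if y: "y \<in> gap L i1 i" "full y" for y
      proof -
        obtain r where r: "chain_to L r i1 y" "\<not> enat r < m (f y) (f i)" using y by (auto simp: full_def)
        have "f y \<in> L" "f i1 \<in> L" using y i fi1 by (auto simp: gap_def)
        then obtain c where c: "cchain L c r" "c (r - 2) = i1" "c (r - 1) = y"
          using chain_to_cchain[OF r(1)] by metis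
        obtain r' where r': "r = r' + 2" using chain_to_ge_2[OF r(1)] by (metis le_add_diff_inverse2)
        have "f y = (if even (r' + 1) then f (c 0) else f (c 1))"
          "f i = (if even r' then f (c 0) else f (c 1))"
          using cchain_letter[OF c(1), of "r' + 1"] cchain_letter[OF c(1), of r'] c(2,3) r' fi1 by auto
        then have "m (f (c 0)) (f (c 1)) = m (f y) (f i)" using m_sym[OF f_in f_in] by auto
        then obtain p where p: "band L c p" "r = 2 * p + 1"
          using full_cchain_band[OF L(4,5,2,6) c(1)] r(2) by (metis not_less)
        have "p \<ge> 1" "p \<noteq> 1" using p growth(1)[of c] by (auto simp: band_def)
        then have "p \<ge> 2" by simp
        then show ?thesis using p c by (intro exI[of _ c] exI[of _ p]) auto
      qed
      have "\<exists>y. y \<in> gap L i1 i \<and> y \<noteq> j \<and> linked i1 y \<and> \<not> full y"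
      proof (cases "\<exists>y. y \<in> gap L i1 i \<and> full y")
        case False
        obtain q where "q \<in> gap L i1 i" "q \<noteq> j" using jg g by blast
        then show ?thesis using pick False by blast
      next
        case True
        then obtain y where y: "y \<in> gap L i1 i" "full y" by blast
        then obtain c p where b: "band L c p" "p \<ge> 2" "c (2 * p) = y" "c (2 * p - 1) = i1"
          using full_band by blast
        have c: "cchain L c (2 * p + 1)" and p: "p \<ge> 1" "2 * p < 2 * p + 1" "c (2 * p) = c 0 + n"
          using b by (auto simp: band_def)
        have ie: "i = c 1 + n" using wrap_second_consec[OF c p] i(1) b(4) consec_next_unique by metis
        have yg: "gap L i1 i \<noteq> {y}"
        proof
          assume yg: "gap L i1 i = {y}"
          obtain r where r: "chain_to L r i1 y" "\<not> enat r < m (f y) (f i)" using y by (auto simp: full_def)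
          then show False using not_full[OF i(1) _ yg r(1)] i m_sym[OF f_in f_in, of i y] by simp
        qed
        have "gap L i1 i \<noteq> {y, j}" if "j \<noteq> y"
          using growth(2)[OF b(1,2), of j] that b p ie by simp
        then obtain q where q: "q \<in> gap L i1 i" "q \<noteq> j" "q \<noteq> y"
          using yg y(1) jg by (cases "j = y") auto
        then obtain y' where y': "y' \<in> gap L i1 i" "y' \<noteq> j" "f y' = f q" "linked i1 y'"
          using pick by blast
        have fy: "f y = f (c 0)" using b p f_period by metis
        have "f q \<noteq> f y"
          using wrap_second_gap_first[OF c p, of q] q fy b p ie by auto
        have "\<not> full y'"
        proof
          assume "full y'"
          then obtain c' p' where b': "band L c' p'" "p' \<ge> 2" "c' (2 * p') = y'" "c' (2 * p' - 1) = i1"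
            using full_band y' by blast
          have c': "cchain L c' (2 * p' + 1)" and p': "c' (2 * p') = c' 0 + n"
            using b' by (auto simp: band_def)
          \<comment> \<open>Both bands pass through \<open>i1\<close>, and the single position in
            the gap before \<open>i1\<close> carries the first letter of either, so the first
            letters agree. The index \<open>2 * p - 3\<close> makes sense because
            \<open>p \<ge> 2\<close>.\<close>
          have e: "2 * p - 3 + 2 = 2 * p - 1" "2 * p' - 3 + 2 = 2 * p' - 1"
            "2 * p - 3 + 1 = 2 * (p - 1)" "2 * p' - 3 + 1 = 2 * (p' - 1)" using b b' by auto
          have "consec (c (2 * p - 3)) i1" "gap L (c (2 * p - 3)) i1 = {c (2 * (p - 1))}"
            using cchain_consec[OF c, of "2 * p - 3"] cchain_gap[OF c, of "2 * p - 3"] b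
            unfolding e by auto
          moreover have "consec (c' (2 * p' - 3)) i1" "gap L (c' (2 * p' - 3)) i1 = {c' (2 * (p' - 1))}"
            using cchain_consec[OF c', of "2 * p' - 3"] cchain_gap[OF c', of "2 * p' - 3"] b'
            unfolding e by auto
          ultimately have "c (2 * (p - 1)) = c' (2 * (p' - 1))" using consec_unique by (metis singleton_inject)
          then have "f (c 0) = f (c' 0)"
            using cchain_letter[OF c, of "2 * (p - 1)"] cchain_letter[OF c', of "2 * (p' - 1)"] b b' by auto
          moreover have "f y' = f (c' 0)" using b' p' f_period by metis
          ultimately show False using \<open>f q \<noteq> f y\<close> y' fy by simp
        qed
        then show ?thesis using y' by blast
      qed
      then show "\<exists>y\<in>gap L i1 i. y \<noteq> j \<and> linked i1 y \<and>
          (f y \<in> {} \<or> (\<forall>r. chain_to L r i1 y \<longrightarrow> enat r < m (f y) (f i)))"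
        by (auto simp: full_def)
    qed (use nonempty not_full in auto)
  qed
qed

end

section \<open>A Perron--Frobenius argument\<close>

text \<open>Bolzano--Weierstrass, one coordinate at a time: every real sequence has a monotone
  subsequence.\<close>

lemma convergent_subseq_finite:
  fixes Y :: "nat \<Rightarrow> 'i \<Rightarrow> real"
  assumes "finite I" "\<And>k i. i \<in> I \<Longrightarrow> \<bar>Y k i\<bar> \<le> B"
  obtains r y where "strict_mono r" "\<And>i. i \<in> I \<Longrightarrow> (\<lambda>k. Y (r k) i) \<longlonglongrightarrow> y i"
proof -
  have "\<exists>r y. strict_mono (r :: nat \<Rightarrow> nat) \<and> (\<forall>i\<in>I. (\<lambda>k. Y (r k) i) \<longlonglongrightarrow> y i)"
    using assms
  proof (induction I rule: finite_induct)
    case empty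
    then show ?case by (intro exI[of _ id]) (auto simp: strict_mono_def)
  next
    case (insert x F)
    then obtain r y where r: "strict_mono r" "\<forall>i\<in>F. (\<lambda>k. Y (r k) i) \<longlonglongrightarrow> y i" by auto
    obtain g where g: "strict_mono g" "monoseq (\<lambda>k. Y (r (g k)) x)"
      using seq_monosub[of "\<lambda>k. Y (r k) x"] by auto
    have "Bseq (\<lambda>k. Y (r (g k)) x)" using insert.prems by (intro BseqI'[of _ B]) auto
    then obtain l where l: "(\<lambda>k. Y (r (g k)) x) \<longlonglongrightarrow> l"
      using Bseq_monoseq_convergent g(2) by (auto simp: convergent_def)
    have "(\<lambda>k. Y ((r \<circ> g) k) i) \<longlonglongrightarrow> y i" if "i \<in> F" for i
      using LIMSEQ_subseq_LIMSEQ[OF r(2)[rule_format, OF that] g(1)] by (simp add: o_def)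
    then have "\<forall>i\<in>insert x F. (\<lambda>k. Y ((r \<circ> g) k) i) \<longlonglongrightarrow> (y(x := l)) i"
      using l insert.hyps by auto
    then show ?case using strict_mono_o[OF r(1) g(1)] by blast
  qed
  then show ?thesis using that by blast
qed

text \<open>A Perron--Frobenius argument for a continuous family of nonnegative matrices: at the largest
  parameter for which a subsolution exists, a subsolution with a maximal set of strict inequalities
  is a solution.\<close>

lemma positive_solution_exists:
  fixes K :: "'i \<Rightarrow> 'i \<Rightarrow> real \<Rightarrow> real" and d :: "'i \<Rightarrow> real \<Rightarrow> real"
  assumes fin: "finite I"
    and cont: "\<And>i j. i \<in> I \<Longrightarrow> j \<in> I \<Longrightarrow> continuous_on {1..} (K i j)"
      "\<And>i. i \<in> I \<Longrightarrow> continuous_on {1..} (d i)"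
    and nonneg: "\<And>i j \<tau>. i \<in> I \<Longrightarrow> j \<in> I \<Longrightarrow> \<tau> \<ge> 1 \<Longrightarrow> K i j \<tau> \<ge> 0"
    and dpos: "\<And>i \<tau>. i \<in> I \<Longrightarrow> \<tau> \<ge> 1 \<Longrightarrow> d i \<tau> > 0"
    and conn: "\<And>X. X \<subseteq> I \<Longrightarrow> X \<noteq> {} \<Longrightarrow> X \<noteq> I \<Longrightarrow>
      \<exists>j\<in>X. \<exists>i\<in>I - X. \<forall>\<tau>\<ge>1. K i j \<tau> > 0"
    and sub: "\<And>i. i \<in> I \<Longrightarrow> w i \<ge> 0" "\<exists>i\<in>I. w i > 0"
      "\<And>i. i \<in> I \<Longrightarrow> d i 1 * w i \<le> (\<Sum>j\<in>I. K i j 1 * w j)"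
    and bound: "\<And>i \<tau>. i \<in> I \<Longrightarrow> \<tau> > T \<Longrightarrow> \<tau> \<ge> 1 \<Longrightarrow> (\<Sum>j\<in>I. K i j \<tau>) < d i \<tau>"
  obtains \<tau> y where "\<tau> \<ge> 1" "\<And>i. i \<in> I \<Longrightarrow> y i > 0"
    "\<And>i. i \<in> I \<Longrightarrow> d i \<tau> * y i = (\<Sum>j\<in>I. K i j \<tau> * y j)"
proof -
  define S where "S \<tau> y \<longleftrightarrow> (\<forall>i\<in>I. y i \<ge> 0) \<and> (\<exists>i\<in>I. y i > 0) \<and>
      (\<forall>i\<in>I. d i \<tau> * y i \<le> (\<Sum>j\<in>I. K i j \<tau> * y j))" for \<tau> and y :: "'i \<Rightarrow> real"
  define F where "F = {\<tau>. \<tau> \<ge> 1 \<and> (\<exists>y. S \<tau> y)}"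
  have F1: "1 \<in> F" using sub by (auto simp: F_def S_def)
  \<comment> \<open>At a largest coordinate of a subsolution the row sum must reach
    \<open>d i \<tau>\<close>, which \<open>bound\<close> excludes beyond \<open>T\<close>.\<close>
  have Fbound: "\<tau> \<le> max T 1" if \<tau>F: "\<tau> \<in> F" for \<tau>
  proof (rule ccontr)
    assume "\<not> \<tau> \<le> max T 1"
    then have \<tau>: "\<tau> > T" "\<tau> \<ge> 1" by auto
    obtain y where y: "S \<tau> y" using \<tau>F by (auto simp: F_def)
    have "I \<noteq> {}" using y by (auto simp: S_def)
    then have "Max (y ` I) \<in> y ` I" using fin by (intro Max_in) auto
    then obtain i where "i \<in> I" "Max (y ` I) = y i" by auto
    then have i: "i \<in> I" "\<And>j. j \<in> I \<Longrightarrow> y j \<le> y i" using fin by (metis Max_ge finite_imageI imageI)+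
    have yi: "y i > 0" using y i by (auto simp: S_def intro: less_le_trans)
    have "d i \<tau> * y i \<le> (\<Sum>j\<in>I. K i j \<tau> * y j)" using y i by (auto simp: S_def)
    also have "\<dots> \<le> (\<Sum>j\<in>I. K i j \<tau> * y i)"
      using i nonneg \<tau> by (intro sum_mono mult_left_mono) auto
    also have "\<dots> = (\<Sum>j\<in>I. K i j \<tau>) * y i" by (simp add: sum_distrib_right)
    also have "\<dots> < d i \<tau> * y i" using bound[OF i(1) \<tau>] yi by simp
    finally show False by simp
  qed
  have bdd: "bdd_above F" using Fbound by (auto simp: bdd_above_def)
  define \<tau> where "\<tau> = Sup F"
  have \<tau>1: "\<tau> \<ge> 1" unfolding \<tau>_def using F1 bdd by (rule cSup_upper)
  have "\<exists>t\<in>F. \<tau> - 1 / real (Suc k) < t" for k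
  proof -
    have "\<tau> - 1 / real (Suc k) < Sup F" by (simp add: \<tau>_def)
    then show ?thesis using F1 bdd less_cSup_iff[of F] by blast
  qed
  then obtain t where t: "\<And>k. t k \<in> F" "\<And>k. \<tau> - 1 / real (Suc k) < t k" by metis
  have t_le: "t k \<le> \<tau>" for k unfolding \<tau>_def using t(1) bdd by (intro cSup_upper)
  have tlim: "t \<longlonglongrightarrow> \<tau>"
  proof (rule tendsto_sandwich)
    show "(\<lambda>k. \<tau> - 1 / real (Suc k)) \<longlonglongrightarrow> \<tau>"
      using tendsto_diff[OF tendsto_const LIMSEQ_inverse_real_of_nat, of \<tau>] by (simp add: divide_inverse)
    show "\<forall>\<^sub>F k in sequentially. \<tau> - 1 / real (Suc k) \<le> t k"
      using t(2) by (intro always_eventually allI less_imp_le)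
    show "\<forall>\<^sub>F k in sequentially. t k \<le> \<tau>" using t_le by simp
  qed simp
  have "\<exists>y. S (t k) y \<and> (\<Sum>i\<in>I. y i) = 1" for k
  proof -
    obtain y where y: "S (t k) y" using t(1) by (auto simp: F_def)
    define s where "s = (\<Sum>i\<in>I. y i)"
    have s: "s > 0"
      unfolding s_def using y fin by (auto simp: S_def intro: sum_pos2)
    have "(\<Sum>j\<in>I. K i j (t k) * (y j / s)) = (\<Sum>j\<in>I. K i j (t k) * y j) / s" for i
      by (simp add: sum_divide_distrib)
    then have "S (t k) (\<lambda>i. y i / s)"
      using y s by (simp add: S_def divide_right_mono zero_less_divide_iff)
    moreover have "(\<Sum>i\<in>I. y i / s) = 1" using s by (simp add: sum_divide_distrib[symmetric] s_def)
    ultimately show ?thesis by blast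
  qed
  then obtain Y where Y: "\<And>k. S (t k) (Y k)" "\<And>k. (\<Sum>i\<in>I. Y k i) = 1" by metis
  have Yb: "\<bar>Y k i\<bar> \<le> 1" if "i \<in> I" for k i
  proof -
    have "Y k i \<le> (\<Sum>i\<in>I. Y k i)" using Y(1)[of k] fin that by (intro member_le_sum) (auto simp: S_def)
    then show ?thesis using Y that by (auto simp: S_def)
  qed
  obtain r y where r: "strict_mono r" and y: "\<And>i. i \<in> I \<Longrightarrow> (\<lambda>k. Y (r k) i) \<longlonglongrightarrow> y i"
    using convergent_subseq_finite[OF fin, of Y 1, OF Yb] by blast
  have tr: "(\<lambda>k. t (r k)) \<longlonglongrightarrow> \<tau>" using LIMSEQ_subseq_LIMSEQ[OF tlim r] by (simp add: o_def)
  have comp: "(\<lambda>k. g (t (r k))) \<longlonglongrightarrow> g \<tau>" if "continuous_on {1..} g" for g :: "real \<Rightarrow> real"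
    by (rule continuous_on_tendsto_compose[OF that tr]) (use \<tau>1 t in \<open>auto simp: F_def\<close>)
  have y_nn: "y i \<ge> 0" if "i \<in> I" for i
    using LIMSEQ_le_const[OF y[OF that], of 0] Y(1) that by (auto simp: S_def)
  have "(\<lambda>k. \<Sum>i\<in>I. Y (r k) i) \<longlonglongrightarrow> (\<Sum>i\<in>I. y i)" using y by (intro tendsto_sum)
  then have ysum: "(\<Sum>i\<in>I. y i) = 1" using Y(2) by (simp add: LIMSEQ_const_iff)
  have Sy: "S \<tau> y"
    unfolding S_def
  proof (intro conjI ballI)
    show "\<exists>i\<in>I. y i > 0"
    proof (rule ccontr)
      assume "\<not> ?thesis"
      then have "y i = 0" if "i \<in> I" for i using y_nn that by force
      then show False using ysum by simp
    qed
    fix i assume i: "i \<in> I"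
    have "(\<lambda>k. d i (t (r k)) * Y (r k) i) \<longlonglongrightarrow> d i \<tau> * y i"
      using comp[OF cont(2)[OF i]] y[OF i] by (intro tendsto_mult)
    moreover have "(\<lambda>k. \<Sum>j\<in>I. K i j (t (r k)) * Y (r k) j) \<longlonglongrightarrow> (\<Sum>j\<in>I. K i j \<tau> * y j)"
      using comp cont(1) y i by (intro tendsto_sum tendsto_mult) auto
    ultimately show "d i \<tau> * y i \<le> (\<Sum>j\<in>I. K i j \<tau> * y j)"
      by (rule LIMSEQ_le) (use Y(1) i in \<open>auto simp: S_def\<close>)
  qed (use y_nn in auto)
  define strict where "strict y = {i\<in>I. d i \<tau> * y i < (\<Sum>j\<in>I. K i j \<tau> * y j)}" for y
  define P where "P c \<longleftrightarrow> (\<exists>y. S \<tau> y \<and> card (strict y) = c)" for c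
  have "P (card (strict y))" using Sy by (auto simp: P_def)
  moreover have "c \<le> card I" if "P c" for c
    using that fin by (auto simp: P_def strict_def intro!: card_mono)
  ultimately have "P (Greatest P)" "\<And>c. P c \<Longrightarrow> c \<le> Greatest P"
    using GreatestI_nat[of P _ "card I"] Greatest_le_nat[of P _ "card I"] by auto
  then obtain z where z: "S \<tau> z" and max: "\<And>z'. S \<tau> z' \<Longrightarrow> card (strict z') \<le> card (strict z)"
    unfolding P_def by metis
  have "strict z = {}"
  proof (rule ccontr)
    assume ne: "strict z \<noteq> {}"
    show False
    proof (cases "strict z = I")
      case True
      \<comment> \<open>If all inequalities are strict, continuity keeps \<open>z\<close> a
        subsolution slightly beyond \<open>\<tau>\<close>, against the choice of
        \<open>\<tau>\<close> as supremum.\<close>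
      have ev: "eventually (\<lambda>t. d i t * z i < (\<Sum>j\<in>I. K i j t * z j)) (at_right \<tau>)" if i: "i \<in> I" for i
      proof -
        have lim: "(g \<longlongrightarrow> g \<tau>) (at_right \<tau>)" if "continuous_on {1..} g" for g :: "real \<Rightarrow> real"
        proof -
          have "(g \<longlongrightarrow> g \<tau>) (at \<tau> within {1..})" using that \<tau>1 by (auto simp: continuous_on_def)
          then show ?thesis by (rule tendsto_within_subset) (use \<tau>1 in auto)
        qed
        have "((\<lambda>t. (\<Sum>j\<in>I. K i j t * z j) - d i t * z i) \<longlongrightarrow>
            (\<Sum>j\<in>I. K i j \<tau> * z j) - d i \<tau> * z i) (at_right \<tau>)"
          using lim cont i by (intro tendsto_diff tendsto_sum tendsto_mult tendsto_const) auto
        moreover have "(\<Sum>j\<in>I. K i j \<tau> * z j) - d i \<tau> * z i > 0" using True i by (auto simp: strict_def)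
        ultimately have "eventually (\<lambda>t. (\<Sum>j\<in>I. K i j t * z j) - d i t * z i > 0) (at_right \<tau>)"
          by (rule order_tendstoD(1))
        then show ?thesis by simp
      qed
      have "eventually (\<lambda>t. \<forall>i\<in>I. d i t * z i < (\<Sum>j\<in>I. K i j t * z j)) (at_right \<tau>)"
        using ev fin by (simp add: eventually_ball_finite)
      then obtain b where b: "b > \<tau>" "\<And>t. \<tau> < t \<Longrightarrow> t < b \<Longrightarrow> \<forall>i\<in>I. d i t * z i < (\<Sum>j\<in>I. K i j t * z j)"
        unfolding eventually_at_right_field by blast
      define t' where "t' = (\<tau> + b) / 2"
      have t': "\<tau> < t'" "t' < b" using b by (auto simp: t'_def)
      have "S t' z" using z b(2)[OF t'] by (auto simp: S_def intro: less_imp_le)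
      then have "t' \<in> F" using t' \<tau>1 by (auto simp: F_def)
      then have "t' \<le> \<tau>" unfolding \<tau>_def using bdd by (rule cSup_upper)
      then show False using t' by simp
    next
      case False
      have "strict z \<subseteq> I" by (auto simp: strict_def)
      then obtain j i where ij: "j \<in> strict z" "i \<in> I - strict z" "K i j \<tau> > 0"
        using conn[of "strict z"] ne False \<tau>1 by blast
      have jI: "j \<in> I" using ij by (simp add: strict_def)
      \<comment> \<open>Half of what the strict inequality at \<open>j\<close> allows. Raising
        \<open>z j\<close> by it keeps row \<open>j\<close> strict, weakens no other row, and makes
        row \<open>i\<close> strict because \<open>K i j \<tau> > 0\<close>.\<close>
      define \<epsilon> where "\<epsilon> = ((\<Sum>l\<in>I. K j l \<tau> * z l) - d j \<tau> * z j) / (2 * d j \<tau>)"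
      have dj: "d j \<tau> > 0" using dpos jI \<tau>1 by auto
      have e: "\<epsilon> > 0" using ij dj by (auto simp: \<epsilon>_def strict_def)
      have ej: "d j \<tau> * (z j + \<epsilon>) < (\<Sum>l\<in>I. K j l \<tau> * z l)"
        using ij dj by (simp add: \<epsilon>_def strict_def field_simps)
      define z' where "z' = z(j := z j + \<epsilon>)"
      have sum: "(\<Sum>k\<in>I. K l k \<tau> * z' k) = (\<Sum>k\<in>I. K l k \<tau> * z k) + K l j \<tau> * \<epsilon>" for l
      proof -
        have "(\<Sum>k\<in>I. K l k \<tau> * z' k) = (\<Sum>k\<in>I. K l k \<tau> * z k + (if k = j then K l j \<tau> * \<epsilon> else 0))"
          by (intro sum.cong) (auto simp: z'_def algebra_simps)
        then show ?thesis using jI fin by (simp add: sum.distrib)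
      qed
      have ge: "(\<Sum>k\<in>I. K l k \<tau> * z k) \<le> (\<Sum>k\<in>I. K l k \<tau> * z' k)" if "l \<in> I" for l
        using sum nonneg[OF that jI \<tau>1] e by simp
      have S': "S \<tau> z'"
        unfolding S_def
      proof (intro conjI ballI)
        show "\<exists>i\<in>I. z' i > 0" using jI z e by (intro bexI[of _ j]) (auto simp: z'_def S_def intro: add_nonneg_pos)
        fix l assume l: "l \<in> I"
        show "z' l \<ge> 0" using z l e by (auto simp: z'_def S_def)
        show "d l \<tau> * z' l \<le> (\<Sum>k\<in>I. K l k \<tau> * z' k)"
        proof (cases "l = j")
          case True
          then show ?thesis using ej ge[OF l] by (simp add: z'_def)
        next
          case False
          then have "d l \<tau> * z' l \<le> (\<Sum>k\<in>I. K l k \<tau> * z k)" using z l by (auto simp: z'_def S_def)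
          then show ?thesis using ge[OF l] by simp
        qed
      qed
      have "insert i (strict z) \<subseteq> strict z'"
      proof
        fix l assume l: "l \<in> insert i (strict z)"
        then have lI: "l \<in> I" using ij by (auto simp: strict_def)
        show "l \<in> strict z'"
        proof (cases "l = j")
          case True
          then show ?thesis using ej ge[OF lI] lI by (simp add: strict_def z'_def)
        next
          case False
          show ?thesis
          proof (cases "l = i")
            case True
            have "d i \<tau> * z i \<le> (\<Sum>k\<in>I. K i k \<tau> * z k)" using z ij by (auto simp: S_def)
            also have "\<dots> < (\<Sum>k\<in>I. K i k \<tau> * z' k)" using sum ij e by simp
            finally show ?thesis using False lI True by (simp add: strict_def z'_def)
          next
            case False
            then have "d l \<tau> * z l < (\<Sum>k\<in>I. K l k \<tau> * z k)" using l by (simp add: strict_def)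
            then show ?thesis using ge[OF lI] lI \<open>l \<noteq> j\<close> by (simp add: strict_def z'_def)
          qed
        qed
      qed
      moreover have finS: "finite (strict w)" for w using fin by (simp add: strict_def)
      ultimately have "card (insert i (strict z)) \<le> card (strict z')" by (intro card_mono)
      then show False using max[OF S'] ij finS by simp
    qed
  qed
  then have eq: "d i \<tau> * z i = (\<Sum>j\<in>I. K i j \<tau> * z j)" if "i \<in> I" for i
    using z that by (force simp: S_def strict_def)
  have "z i > 0" if i: "i \<in> I" for i
  proof (rule ccontr)
    assume "\<not> z i > 0"
    \<comment> \<open>A zero coordinate of a solution has a zero row sum, yet \<open>conn\<close>
      gives one of them positive weight on a positive coordinate.\<close>
    define X where "X = {i\<in>I. z i > 0}"
    have "X \<subseteq> I" "X \<noteq> {}" "X \<noteq> I" using z i \<open>\<not> z i > 0\<close> by (auto simp: X_def S_def)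
    then obtain j l where jl: "j \<in> X" "l \<in> I - X" "K l j \<tau> > 0" using conn \<tau>1 by blast
    have "z l = 0" using jl z by (force simp: X_def S_def)
    then have "(\<Sum>k\<in>I. K l k \<tau> * z k) = 0" using eq[of l] jl by simp
    moreover have "K l j \<tau> * z j \<le> (\<Sum>k\<in>I. K l k \<tau> * z k)"
      using jl fin nonneg z \<tau>1 by (intro member_le_sum) (auto simp: X_def S_def)
    moreover have "K l j \<tau> * z j > 0" using jl by (simp add: X_def)
    ultimately show False by simp
  qed
  then show ?thesis using that[OF \<tau>1] eq by blast
qed

section \<open>Positive definite forms and finite groups\<close>

lemma sum_upd:
  fixes g :: "'i \<Rightarrow> real"
  assumes "finite I" "j \<in> I"
  shows "(\<Sum>k\<in>I. g k * (v(j := v j + e)) k) = (\<Sum>k\<in>I. g k * v k) + g j * e"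
proof -
  have "(\<Sum>k\<in>I. g k * (v(j := v j + e)) k) = (\<Sum>k\<in>I. g k * v k + (if k = j then g j * e else 0))"
    by (intro sum.cong) (auto simp: algebra_simps)
  then show ?thesis using assms by (simp add: sum.distrib)
qed

context coxeter_data
begin

text \<open>Twice the quadratic form of the geometric representation, since \<open>a\<close> carries
  the factor \<open>-2\<close>. Roots have the value 2.\<close>

definition form :: "('a \<Rightarrow> real) \<Rightarrow> real" where
  "form v = (\<Sum>s\<in>S. v s * - (\<Sum>t\<in>S. a s t * v t))"

lemma form_upd:
  assumes "x \<in> S"
  shows "form (v(x := v x + e)) = form v - 2 * e * (\<Sum>t\<in>S. a x t * v t) + 2 * e\<^sup>2"
proof -
  let ?w = "v(x := v x + e)"
  have "form ?w = (\<Sum>s\<in>S. ?w s * - ((\<Sum>t\<in>S. a s t * v t) + a s x * e))"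
    unfolding form_def by (simp only: sum_upd[OF finite_S assms])
  also have "\<dots> = (\<Sum>s\<in>S. - ((\<Sum>t\<in>S. a s t * v t) + a s x * e) * ?w s)"
    by (simp add: mult.commute)
  also have "\<dots> = (\<Sum>s\<in>S. - ((\<Sum>t\<in>S. a s t * v t) + a s x * e) * v s)
      - ((\<Sum>t\<in>S. a x t * v t) + a x x * e) * e"
    by (subst sum_upd[OF finite_S assms, of "\<lambda>s. - ((\<Sum>t\<in>S. a s t * v t) + a s x * e)"]) (simp add: algebra_simps)
  also have "(\<Sum>s\<in>S. - ((\<Sum>t\<in>S. a s t * v t) + a s x * e) * v s) =
      form v - e * (\<Sum>s\<in>S. a s x * v s)"
    unfolding form_def sum_distrib_left[of e] sum_subtractf[symmetric]
    by (intro sum.cong refl) (simp_all add: algebra_simps)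
  also have "(\<Sum>s\<in>S. a s x * v s) = (\<Sum>t\<in>S. a x t * v t)"
    using assms a_sym by (intro sum.cong) auto
  finally show ?thesis using assms by (simp add: a_self power2_eq_square algebra_simps fun_upd_def)
qed

text \<open>The update is the simple reflection in \<open>x\<close>, in coordinates with respect to
  the simple roots.\<close>

lemma form_refl:
  "x \<in> S \<Longrightarrow> form (v(x := v x + (\<Sum>t\<in>S. a x t * v t))) = form v"
  by (simp add: form_upd power2_eq_square)

text \<open>By duality this is the coefficient of the simple root of \<open>t\<close> in the image
  under \<open>u\<close> of the simple root of \<open>s\<close>.\<close>

definition root :: "'a list \<Rightarrow> 'a \<Rightarrow> 'a \<Rightarrow> real" where
  "root u s t = play u (unit_at t) s"

lemma root_Cons:
  assumes "x \<in> S" "u \<in> lists S" "s \<in> S" "t \<in> S"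
  shows "root (x # u) s t = ((root u s)(x := root u s x + (\<Sum>z\<in>S. a x z * root u s z))) t"
proof -
  have uS: "set u \<subseteq> S" using assms by (auto simp: in_lists_conv_set)
  show ?thesis
  proof (cases "t = x")
    case False
    then have "fire x (unit_at t) = unit_at t" by (auto simp: fire_def unit_at_def)
    then show ?thesis using False by (simp add: root_def)
  next
    case True
    have "fire x (unit_at x) = (\<lambda>z. unit_at x z + a z x)" by (auto simp: fire_def unit_at_def)
    then have "root (x # u) s x = root u s x + play u (\<lambda>z. a z x) s"
      by (simp add: root_def play_add)
    also have "play u (\<lambda>z. a z x) s = (\<Sum>z\<in>S. a z x * root u s z)"
      unfolding root_def by (rule play_expand[OF uS assms(3)])
    also have "\<dots> = (\<Sum>z\<in>S. a x z * root u s z)"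
      using assms a_sym by (intro sum.cong) auto
    finally show ?thesis using True by simp
  qed
qed

lemma form_cong: "(\<And>s. s \<in> S \<Longrightarrow> v s = w s) \<Longrightarrow> form v = form w"
  unfolding form_def by (intro sum.cong) (auto intro!: sum.cong)

lemma form_root:
  assumes "u \<in> lists S" "s \<in> S"
  shows "form (root u s) = 2"
  using assms(1)
proof (induction u)
  case Nil
  have "form (root [] s) = form ((\<lambda>_. 0)(s := (\<lambda>_. 0) s + 1))"
    by (rule form_cong) (auto simp: root_def unit_at_def)
  also have "\<dots> = 2" by (subst form_upd[OF assms(2)]) (simp add: form_def)
  finally show ?case .
next
  case (Cons x u)
  have "form (root (x # u) s) = form ((root u s)(x := root u s x + (\<Sum>z\<in>S. a x z * root u s z)))"
    by (rule form_cong) (use Cons root_Cons assms in auto)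
  then show ?case using Cons form_refl by simp
qed

lemma reduced_representative:
  assumes "u \<in> lists S"
  obtains v where "eqv u v" "red v"
proof -
  define v where "v = arg_min length (\<lambda>v. eqv u v)"
  have ex: "eqv u u" using assms by (rule coxeter_cong.refl)
  have v: "eqv u v" unfolding v_def by (rule arg_min_natI[of "eqv u", OF ex])
  have "red v"
    unfolding red_def
  proof (intro conjI allI impI)
    show "v \<in> lists S" using eqv_lists[OF v] by simp
    fix w assume "eqv v w"
    then have "eqv u w" using v by (rule coxeter_cong.trans[rotated])
    then show "length v \<le> length w" unfolding v_def by (rule arg_min_nat_le)
  qed
  then show ?thesis using that v by blast
qed

text \<open>All roots have form value 2 and hence bounded coefficients, so the maps
  \<open>play u\<close> and their inverses are uniformly bounded. Then the vectors
  \<open>V u\<close> of different elements stay a fixed distance apart, and infinitely many of them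
  in a bounded set would accumulate.\<close>

lemma finite_group_if_positive_definite:
  assumes \<kappa>: "\<kappa> > 0" "\<And>v. \<kappa> * (\<Sum>s\<in>S. (v s)\<^sup>2) \<le> form v"
  shows "finite (carrier (coxeter_group S m))"
proof (rule ccontr)
  assume inf: "infinite (carrier (coxeter_group S m))"
  define B where "B = sqrt (2 / \<kappa>)"
  have root_bound: "\<bar>root u s t\<bar> \<le> B" if "u \<in> lists S" "s \<in> S" "t \<in> S" for u s t
  proof -
    have "(root u s t)\<^sup>2 \<le> (\<Sum>t\<in>S. (root u s t)\<^sup>2)" using that finite_S by (intro member_le_sum) auto
    moreover have "\<kappa> * (\<Sum>t\<in>S. (root u s t)\<^sup>2) \<le> 2" using \<kappa>(2)[of "root u s"] form_root[OF that(1,2)] by simp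
    ultimately have "\<kappa> * (root u s t)\<^sup>2 \<le> 2" using \<kappa>(1) by (smt (verit) mult_left_mono)
    then have "(root u s t)\<^sup>2 \<le> 2 / \<kappa>" using \<kappa>(1) by (simp add: field_simps)
    then show ?thesis unfolding B_def by (metis real_sqrt_abs real_sqrt_le_iff)
  qed
  have expand: "play u V s = (\<Sum>t\<in>S. V t * root u s t)" if "u \<in> lists S" "s \<in> S" for u V s
    unfolding root_def using that by (intro play_expand) (auto simp: in_lists_conv_set)
  define C where "C = real (card S) * B"
  have abs_bound: "\<bar>play u V s\<bar> \<le> D * C" if "u \<in> lists S" "s \<in> S" "\<And>t. t \<in> S \<Longrightarrow> \<bar>V t\<bar> \<le> D" for u V s D
  proof -
    have D: "D \<ge> 0" using that(3)[OF that(2)] by simp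
    have "\<bar>play u V s\<bar> \<le> (\<Sum>t\<in>S. \<bar>V t * root u s t\<bar>)" unfolding expand[OF that(1,2)] by (rule sum_abs)
    also have "\<dots> \<le> (\<Sum>t\<in>S. D * B)"
      using that root_bound D by (intro sum_mono) (auto simp: abs_mult intro!: mult_mono)
    finally show ?thesis by (simp add: C_def algebra_simps)
  qed
  define V where "V u = play u (\<lambda>_. 1)" for u
  have separated: "\<exists>t\<in>S. \<bar>V u t - V v t\<bar> * C > 1 / 2"
    if uv: "u \<in> lists S" "v \<in> lists S" "\<not> eqv u v" for u v
  proof (rule ccontr)
    assume small: "\<not> (\<exists>t\<in>S. \<bar>V u t - V v t\<bar> * C > 1 / 2)"
    have rv: "rev v \<in> lists S" "rev (rev v) \<in> lists S" using uv by (auto simp: in_lists_conv_set)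
    have "u @ rev v \<in> lists S" using uv rv by simp
    then obtain w where w: "eqv (u @ rev v) w" "red w" using reduced_representative by metis
    have "w \<noteq> []"
    proof
      assume "w = []"
      then have "eqv (u @ rev v) (v @ rev v)"
        using w eqv_rev[OF uv(2)] by (meson coxeter_cong.sym coxeter_cong.trans)
      then show False using eqv_cancel_right uv by blast
    qed
    then obtain w' s where ws: "w = w' @ [s]" by (metis rev_exhaust)
    have s: "s \<in> S" using w ws by (auto simp: red_def)
    have "play w' (\<lambda>_. 1) s > 0" using w ws by (intro play_pos) auto
    \<comment> \<open>A nontrivial element makes the all-ones vector negative at the last letter of
      a reduced word, while \<open>v\<close> followed by its inverse leaves the value 1
      there.\<close>
    then have neg: "play (u @ rev v) (\<lambda>_. 1) s < 0"
      using play_eqv[OF w(1)] ws s by (simp add: play_snoc a_self)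
    have "play (v @ rev v) (\<lambda>_. 1) s = 1" using play_eqv[OF eqv_rev[OF uv(2)]] by simp
    then have "\<bar>play (rev v) (\<lambda>t. 1 * V u t + (-1) * V v t) s\<bar> > 1"
      using neg unfolding play_linear by (simp add: V_def play_append)
    moreover have "\<bar>play (rev v) (\<lambda>t. 1 * V u t + (-1) * V v t) s\<bar> \<le>
        Max ((\<lambda>t. \<bar>V u t - V v t\<bar>) ` S) * C"
      by (rule abs_bound[OF rv(1) s]) (use finite_S in auto)
    moreover have "Max ((\<lambda>t. \<bar>V u t - V v t\<bar>) ` S) \<in> (\<lambda>t. \<bar>V u t - V v t\<bar>) ` S"
      using finite_S s by (intro Max_in) auto
    ultimately obtain t where "t \<in> S" "\<bar>V u t - V v t\<bar> * C > 1" by auto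
    then show False using small by force
  qed
  obtain X :: "nat \<Rightarrow> 'a list set" where X: "inj X" "range X \<subseteq> lists S // coxeter_cong S m"
    using infinite_countable_subset[OF inf] by (auto simp: coxeter_group_def)
  have "\<exists>u. u \<in> lists S \<and> X k = coxeter_cong S m `` {u}" for k
  proof -
    have "X k \<in> lists S // coxeter_cong S m" using X(2) by auto
    then show ?thesis by (auto simp: quotient_def)
  qed
  then obtain U where U: "\<And>k. U k \<in> lists S" "\<And>k. X k = coxeter_cong S m `` {U k}" by metis
  have neq: "\<not> eqv (U k) (U l)" if "k \<noteq> l" for k l
    using equiv_class_eq[OF equiv_coxeter_cong, of "U k" "U l"] U that X(1) by (metis injD)
  have "\<bar>V (U k) t\<bar> \<le> 1 * C" if "t \<in> S" for k t
    unfolding V_def by (rule abs_bound) (use U that in auto)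
  then obtain r y where r: "strict_mono r" "\<And>t. t \<in> S \<Longrightarrow> (\<lambda>k. V (U (r k)) t) \<longlonglongrightarrow> y t"
    using convergent_subseq_finite[OF finite_S, of "\<lambda>k. V (U k)"] by metis
  have "(\<lambda>k. \<bar>V (U (r k)) t - V (U (r (Suc k))) t\<bar> * C) \<longlonglongrightarrow> \<bar>y t - y t\<bar> * C" if "t \<in> S" for t
    using r(2)[OF that] LIMSEQ_Suc[OF r(2)[OF that]]
    by (intro tendsto_mult tendsto_rabs tendsto_diff tendsto_const) auto
  then have "eventually (\<lambda>k. \<bar>V (U (r k)) t - V (U (r (Suc k))) t\<bar> * C < 1 / 2) sequentially"
    if "t \<in> S" for t using that order_tendstoD(2)[of _ _ sequentially "1/2"] by fastforce
  then have "eventually (\<lambda>k. \<forall>t\<in>S. \<bar>V (U (r k)) t - V (U (r (Suc k))) t\<bar> * C < 1 / 2) sequentially"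
    using finite_S by (simp add: eventually_ball_finite)
  then obtain k where k: "\<forall>t\<in>S. \<bar>V (U (r k)) t - V (U (r (Suc k))) t\<bar> * C < 1 / 2"
    using eventually_happens by force
  have "r k \<noteq> r (Suc k)" using r(1) by (metis n_not_Suc_n strict_mono_eq)
  then show False using separated[OF U(1) U(1) neq] k by fastforce
qed

text \<open>The witness minimises the form on the nonnegative part of the unit sphere.\<close>

lemma subsolution_if_infinite:
  assumes inf: "infinite (carrier (coxeter_group S m))"
  obtains y where "\<And>s. s \<in> S \<Longrightarrow> y s \<ge> 0" "\<exists>s\<in>S. y s > 0"
    "\<And>s. s \<in> S \<Longrightarrow> (\<Sum>t\<in>S. a s t * y t) \<ge> 0"
proof -
  define \<Delta> where "\<Delta> = {v :: 'a \<Rightarrow> real. (\<forall>s\<in>S. v s \<ge> 0) \<and> (\<Sum>s\<in>S. (v s)\<^sup>2) = 1}"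
  have scale: "form (\<lambda>s. c * v s) = c\<^sup>2 * form v" for c v
    by (simp add: form_def sum_distrib_left power2_eq_square algebra_simps)
  \<comment> \<open>Off the diagonal \<open>a\<close> is nonnegative, so absolute values can only
    lower the form. Positive definiteness can therefore be tested on nonnegative vectors.\<close>
  have abs_le: "form (\<lambda>s. \<bar>v s\<bar>) \<le> form v" for v
  proof -
    have "v s * - (a s t * v t) \<ge> \<bar>v s\<bar> * - (a s t * \<bar>v t\<bar>)" if "s \<in> S" "t \<in> S" for s t
    proof (cases "s = t")
      case True
      then show ?thesis using that by (simp add: a_self)
    next
      case False
      then have "a s t * (v s * v t) \<le> a s t * \<bar>v s * v t\<bar>"
        using a_nonneg[OF that] by (intro mult_left_mono) auto
      then show ?thesis by (simp add: abs_mult algebra_simps)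
    qed
    then have "(\<Sum>s\<in>S. \<Sum>t\<in>S. \<bar>v s\<bar> * - (a s t * \<bar>v t\<bar>)) \<le> (\<Sum>s\<in>S. \<Sum>t\<in>S. v s * - (a s t * v t))"
      by (intro sum_mono)
    then show ?thesis by (simp add: form_def sum_distrib_left sum_negf)
  qed
  have comp: "\<bar>v s\<bar> \<le> 1" if "v \<in> \<Delta>" "s \<in> S" for v s
  proof -
    have "(v s)\<^sup>2 \<le> (\<Sum>s\<in>S. (v s)\<^sup>2)" using that finite_S by (intro member_le_sum) auto
    also have "\<dots> = 1" using that by (simp add: \<Delta>_def)
    finally show ?thesis by (simp only: abs_square_le_1)
  qed
  have sphere: "\<kappa> * (\<Sum>s\<in>S. (w s)\<^sup>2) \<le> form w"
    if \<kappa>: "\<And>v. v \<in> \<Delta> \<Longrightarrow> \<kappa> \<le> form v" and w: "\<And>s. s \<in> S \<Longrightarrow> w s \<ge> 0" for \<kappa> w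
  proof -
    define N where "N = (\<Sum>s\<in>S. (w s)\<^sup>2)"
    show ?thesis
    proof (cases "N = 0")
      case True
      then have "\<forall>s\<in>S. w s = 0" using finite_S by (simp add: N_def sum_nonneg_eq_0_iff)
      then have "form w = 0" by (simp add: form_def)
      then show ?thesis using True by (simp add: N_def)
    next
      case False
      then have N: "N > 0" using sum_nonneg[of S "\<lambda>s. (w s)\<^sup>2"] by (simp add: N_def less_le)
      have "(\<Sum>s\<in>S. (1 / sqrt N * w s)\<^sup>2) = (\<Sum>s\<in>S. (w s)\<^sup>2) / N"
        using N by (simp add: power_mult_distrib power_divide sum_divide_distrib)
      then have "(\<lambda>s. 1 / sqrt N * w s) \<in> \<Delta>" using N w by (simp add: \<Delta>_def N_def)
      then have "\<kappa> \<le> (1 / sqrt N)\<^sup>2 * form w" using \<kappa> scale by metis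
      also have "(1 / sqrt N)\<^sup>2 = 1 / N" using N by (simp add: power_divide)
      finally show ?thesis using N by (simp add: N_def[symmetric] field_simps)
    qed
  qed
  have not_pd: "\<not> (\<exists>\<kappa>>0. \<forall>v\<in>\<Delta>. \<kappa> \<le> form v)"
  proof
    assume "\<exists>\<kappa>>0. \<forall>v\<in>\<Delta>. \<kappa> \<le> form v"
    then obtain \<kappa> where k: "\<kappa> > 0" "\<And>v. v \<in> \<Delta> \<Longrightarrow> \<kappa> \<le> form v" by blast
    have "\<kappa> * (\<Sum>s\<in>S. (v s)\<^sup>2) \<le> form v" for v
      using sphere[OF k(2), of "\<lambda>s. \<bar>v s\<bar>"] abs_le[of v] by simp
    then show False using finite_group_if_positive_definite[OF k(1)] inf by blast
  qed
  have "S \<noteq> {}"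
  proof
    assume "S = {}"
    then have "carrier (coxeter_group S m) \<subseteq> {coxeter_cong S m `` {[]}}"
      by (auto simp: coxeter_group_def quotient_def)
    then show False using inf finite_subset by blast
  qed
  define c where "c = (\<Sum>s\<in>S. \<Sum>t\<in>S. \<bar>a s t\<bar>)"
  have low: "form v \<ge> - c" if "v \<in> \<Delta>" for v
  proof -
    have "v s * - (a s t * v t) \<ge> - \<bar>a s t\<bar>" if "s \<in> S" "t \<in> S" for s t
    proof -
      have "\<bar>v s\<bar> * \<bar>v t\<bar> \<le> 1 * 1" using comp[OF \<open>v \<in> \<Delta>\<close>] that by (intro mult_mono) auto
      then have "\<bar>a s t\<bar> * (\<bar>v s\<bar> * \<bar>v t\<bar>) \<le> \<bar>a s t\<bar> * 1" by (intro mult_left_mono) auto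
      then have "\<bar>v s * - (a s t * v t)\<bar> \<le> \<bar>a s t\<bar>" by (simp add: abs_mult algebra_simps)
      then show ?thesis by linarith
    qed
    then have "(\<Sum>s\<in>S. \<Sum>t\<in>S. - \<bar>a s t\<bar>) \<le> (\<Sum>s\<in>S. \<Sum>t\<in>S. v s * - (a s t * v t))"
      by (intro sum_mono)
    then show ?thesis by (simp add: form_def sum_distrib_left sum_negf c_def)
  qed
  obtain s0 where s0: "s0 \<in> S" using \<open>S \<noteq> {}\<close> by blast
  have "(\<Sum>s\<in>S. (unit_at s0 s)\<^sup>2) = (\<Sum>s\<in>S. if s = s0 then 1 else 0)"
    by (intro sum.cong) (auto simp: unit_at_def)
  then have "unit_at s0 \<in> \<Delta>" using s0 finite_S by (simp add: \<Delta>_def) (simp add: unit_at_def)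
  then have ne: "form ` \<Delta> \<noteq> {}" by blast
  have bdd: "bdd_below (form ` \<Delta>)" using low by (auto simp: bdd_below_def)
  define \<kappa> where "\<kappa> = Inf (form ` \<Delta>)"
  have \<kappa>_le: "\<kappa> \<le> form v" if "v \<in> \<Delta>" for v unfolding \<kappa>_def using bdd that by (intro cInf_lower) auto
  then have \<kappa>: "\<kappa> \<le> 0" using not_pd by (meson not_le)
  have "\<exists>v\<in>\<Delta>. form v < \<kappa> + 1 / real (Suc k)" for k
  proof -
    have "Inf (form ` \<Delta>) < \<kappa> + 1 / real (Suc k)" by (simp add: \<kappa>_def)
    then show ?thesis using cInf_less_iff[OF ne bdd] by blast
  qed
  then obtain Y where Y: "\<And>k. Y k \<in> \<Delta>" "\<And>k. form (Y k) < \<kappa> + 1 / real (Suc k)" by metis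
  obtain r y where r: "strict_mono r" and lim: "\<And>s. s \<in> S \<Longrightarrow> (\<lambda>k. Y (r k) s) \<longlonglongrightarrow> y s"
    using convergent_subseq_finite[OF finite_S, of Y 1, OF comp[OF Y(1)]] by blast
  have y_nn: "y s \<ge> 0" if "s \<in> S" for s
    using LIMSEQ_le_const[OF lim[OF that], of 0] Y(1) that by (auto simp: \<Delta>_def)
  have "(\<lambda>k. \<Sum>s\<in>S. (Y (r k) s)\<^sup>2) \<longlonglongrightarrow> (\<Sum>s\<in>S. (y s)\<^sup>2)" using lim by (intro tendsto_sum tendsto_power)
  then have y1: "(\<Sum>s\<in>S. (y s)\<^sup>2) = 1" using Y(1) by (simp add: \<Delta>_def LIMSEQ_const_iff)
  have yD: "y \<in> \<Delta>" using y_nn y1 by (simp add: \<Delta>_def)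
  have "(\<lambda>k. form (Y (r k))) \<longlonglongrightarrow> form y"
    unfolding form_def using lim by (intro tendsto_sum tendsto_mult tendsto_minus tendsto_const) auto
  moreover have "(\<lambda>k. \<kappa> + 1 / real (Suc k)) \<longlonglongrightarrow> \<kappa> + 0"
    using LIMSEQ_inverse_real_of_nat by (intro tendsto_add tendsto_const) (simp add: divide_inverse)
  then have "(\<lambda>k. \<kappa> + 1 / real (Suc (r k))) \<longlonglongrightarrow> \<kappa> + 0"
    using LIMSEQ_subseq_LIMSEQ[OF _ r] by (fastforce simp: o_def)
  ultimately have "form y \<le> \<kappa> + 0"
    by (rule LIMSEQ_le) (use Y(2) in \<open>auto intro: less_imp_le\<close>)
  then have fy: "form y = \<kappa>" using \<kappa>_le[OF yD] by simp
  have "(\<Sum>t\<in>S. a s t * y t) \<ge> 0" if s: "s \<in> S" for s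
  proof (cases "y s = 0")
    case True
    then show ?thesis using a_nonneg s y_nn by (intro sum_nonneg) (metis mult_nonneg_nonneg mult_zero_right order_refl)
  next
    case False
    then have ys: "y s > 0" using y_nn[OF s] by simp
    define g where "g = (\<Sum>t\<in>S. a s t * y t)"
    \<comment> \<open>First variation at the minimiser when coordinate \<open>s\<close> is
      decreased; \<open>\<delta> \<le> y s\<close> keeps the vector nonnegative, and
      \<open>sphere\<close> compares it with the minimum in spite of its changed norm.\<close>
    have var: "- g \<le> \<kappa> * y s + \<delta> * (1 - \<kappa> / 2)" if d: "0 < \<delta>" "\<delta> \<le> y s" for \<delta>
    proof -
      define w where "w = y(s := y s + (- \<delta>))"
      have w_nn: "\<forall>t\<in>S. w t \<ge> 0" using y_nn d by (simp add: w_def)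
      have "(\<Sum>t\<in>S. (w t)\<^sup>2) = (\<Sum>t\<in>S. (y t)\<^sup>2 + (if t = s then \<delta>\<^sup>2 - 2 * \<delta> * y s else 0))"
        by (intro sum.cong) (auto simp: w_def power2_eq_square algebra_simps)
      also have "\<dots> = 1 + (\<delta>\<^sup>2 - 2 * \<delta> * y s)" using s finite_S y1 by (simp add: sum.distrib)
      finally have N: "(\<Sum>t\<in>S. (w t)\<^sup>2) = 1 + (\<delta>\<^sup>2 - 2 * \<delta> * y s)" .
      define M where "M = 1 + (\<delta>\<^sup>2 - 2 * \<delta> * y s)"
      have "\<kappa> * M \<le> form w" using sphere[OF \<kappa>_le, of w] w_nn N by (simp add: M_def)
      also have "form w = \<kappa> + 2 * \<delta> * g + 2 * \<delta>\<^sup>2" unfolding w_def by (simp only: form_upd[OF s] fy g_def) simp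
      finally have "0 \<le> (2 * \<delta>) * (g + \<kappa> * y s + \<delta> * (1 - \<kappa> / 2))"
        by (simp add: M_def power2_eq_square algebra_simps)
      then have "0 \<le> g + \<kappa> * y s + \<delta> * (1 - \<kappa> / 2)" using d by (simp add: zero_le_mult_iff)
      then show ?thesis by simp
    qed
    have "- g \<le> \<kappa> * y s"
    proof (rule field_le_epsilon)
      fix e :: real assume e: "e > 0"
      have k2: "1 - \<kappa> / 2 > 0" using \<kappa> by simp
      define \<delta> where "\<delta> = min (y s) (e / (1 - \<kappa> / 2))"
      have "0 < \<delta>" "\<delta> \<le> y s" using ys e k2 by (auto simp: \<delta>_def)
      then have "- g \<le> \<kappa> * y s + \<delta> * (1 - \<kappa> / 2)" by (rule var)
      also have "\<delta> * (1 - \<kappa> / 2) \<le> e / (1 - \<kappa> / 2) * (1 - \<kappa> / 2)"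
        using k2 by (intro mult_right_mono) (auto simp: \<delta>_def)
      also have "\<dots> = e" using k2 by simp
      finally show "- g \<le> \<kappa> * y s + e" by simp
    qed
    also have "\<kappa> * y s \<le> 0" using \<kappa> ys by (simp add: mult_nonpos_nonneg)
    finally show ?thesis by (simp add: g_def)
  qed
  moreover have "\<exists>s\<in>S. y s > 0"
  proof (rule ccontr)
    assume "\<not> ?thesis"
    then have "\<forall>s\<in>S. y s = 0" using y_nn by force
    then show False using y1 by simp
  qed
  ultimately show ?thesis using that y_nn by blast
qed

end

section \<open>Single letters and large bands\<close>

text \<open>Summing the recurrence over every other index expresses \<open>b\<close> times one sum
  by twice the other, up to boundary terms. This evaluates the normalisation in
  \<open>band_weight\<close>.\<close>

lemma sinseq_sums:
  "b * (\<Sum>j<p. sinseq b (2 * j + 1)) = 2 * (\<Sum>j<p. sinseq b (2 * j + 2)) - sinseq b (2 * p)"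
  "b * (\<Sum>j<p. sinseq b (2 * j + 2)) = 2 * (\<Sum>j<p. sinseq b (2 * j + 1)) - 1 + sinseq b (2 * p + 1)"
proof (induction p)
  case (Suc p)
  have "sinseq b (2 * Suc p) = b * sinseq b (2 * p + 1) - sinseq b (2 * p)"
    "sinseq b (2 * Suc p + 1) = b * sinseq b (2 * p + 2) - sinseq b (2 * p + 1)"
    by (simp_all add: numeral_2_eq_2)
  then show "b * (\<Sum>j<Suc p. sinseq b (2 * j + 1)) = 2 * (\<Sum>j<Suc p. sinseq b (2 * j + 2)) - sinseq b (2 * Suc p)"
    "b * (\<Sum>j<Suc p. sinseq b (2 * j + 2)) = 2 * (\<Sum>j<Suc p. sinseq b (2 * j + 1)) - 1 + sinseq b (2 * Suc p + 1)"
    using Suc by (simp_all add: algebra_simps)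
qed auto

lemma sum_periodic_window:
  fixes g :: "nat \<Rightarrow> real"
  assumes "\<And>k. g (k + n) = g k"
  shows "(\<Sum>k\<in>{b..<b + n}. g k) = (\<Sum>k<n. g k)"
proof (induction b)
  case 0
  then show ?case by (simp add: atLeast0LessThan)
next
  case (Suc b)
  show ?case
  proof (cases "n = 0")
    case False
    have "{b..<b + n} = insert b {Suc b..<b + n}" "{Suc b..<Suc b + n} = insert (b + n) {Suc b..<b + n}"
      using False by auto
    then have "(\<Sum>k\<in>{Suc b..<Suc b + n}. g k) = (\<Sum>k\<in>{b..<b + n}. g k)"
      using assms[of b] by simp
    then show ?thesis using Suc by simp
  qed simp
qed

context letter_sequence
begin

definition additive_at :: "'a set \<Rightarrow> (nat \<Rightarrow> real) \<Rightarrow> nat \<Rightarrow> nat \<Rightarrow> bool" where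
  "additive_at L x i1 i \<longleftrightarrow> x i + x i1 = (\<Sum>k\<in>gap L i1 i. a (f i) (f k) * x k)"

text \<open>The starting vector is recovered from \<open>x\<close>: from the value at the first
  occurrence of a letter, subtract what the earlier firings contribute to it. From then on the
  additive relations make the game reproduce \<open>x\<close>.\<close>

lemma straight_on_if_additive:
  assumes pos: "\<And>i. f i \<in> L \<Longrightarrow> x i > 0"
    and add: "\<And>i1 i. consec i1 i \<Longrightarrow> f i \<in> L \<Longrightarrow> additive_at L x i1 i"
  shows "straight_on L"
proof -
  define A where "A k = {k'. k' < k \<and> f k' \<in> L}" for k
  define first where "first y = (LEAST i. f i = y)" for y
  define V where "V y = x (first y) - (\<Sum>k\<in>A (first y). a y (f k) * x k)" for y
  define W where "W k y = V y + (\<Sum>k'\<in>A k. a y (f k') * x k')" for k y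
  have finA: "finite (A k)" for k by (simp add: A_def)
  have A_Suc: "A (Suc k) = (if f k \<in> L then insert k (A k) else A k)" "k \<notin> A k" for k
    by (auto simp: A_def less_Suc_eq)
  have W: "W i (f i) = x i" if "f i \<in> L" for i
    using that
  proof (induction i rule: less_induct)
    case (less i)
    show ?case
    proof (cases "\<exists>j<i. f j = f i")
      case False
      have "first (f i) = i"
        unfolding first_def using False by (intro Least_equality) (auto simp: not_less[symmetric])
      then show ?thesis by (simp add: W_def V_def)
    next
      case True
      then obtain i1 where i1: "consec i1 i" using consec_ex by blast
      then have i1': "i1 < i" "f i1 = f i" by (auto simp: consec_def)
      have Ai: "A i = A i1 \<union> insert i1 {k. i1 < k \<and> k < i \<and> f k \<in> L}"
        using i1' less.prems by (auto simp: A_def)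
      have "W i (f i) = W i1 (f i) + (\<Sum>k\<in>insert i1 {k. i1 < k \<and> k < i \<and> f k \<in> L}. a (f i) (f k) * x k)"
        unfolding W_def Ai by (subst sum.union_disjoint) (auto simp: A_def)
      also have "(\<Sum>k\<in>insert i1 {k. i1 < k \<and> k < i \<and> f k \<in> L}. a (f i) (f k) * x k) =
          - 2 * x i1 + (\<Sum>k\<in>{k. i1 < k \<and> k < i \<and> f k \<in> L}. a (f i) (f k) * x k)"
        using i1' a_self[OF f_in, of i] by simp
      also have "(\<Sum>k\<in>{k. i1 < k \<and> k < i \<and> f k \<in> L}. a (f i) (f k) * x k) =
          (\<Sum>k\<in>gap L i1 i. a (f i) (f k) * x k)"
        by (subst sum_restrict_adj) (use i1 f_in in \<open>auto simp: consec_def gap_def intro!: sum.cong\<close>)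
      also have "\<dots> = x i + x i1" using add[OF i1 less.prems] by (simp add: additive_at_def)
      finally show ?thesis using less.IH[OF i1'(1)] i1' less.prems by simp
    qed
  qed
  have play: "play (prefix_on L k) V = W k" for k
  proof (induction k)
    case 0
    then show ?case by (simp add: prefix_on_def W_def A_def)
  next
    case (Suc k)
    show ?case
    proof (cases "f k \<in> L")
      case True
      then have "play (prefix_on L (Suc k)) V y = W (Suc k) y" for y
        using Suc W[OF True] A_Suc[of k] finA by (simp add: prefix_on_Suc play_snoc W_def)
      then show ?thesis by blast
    next
      case False
      then show ?thesis using Suc A_Suc[of k] by (simp add: prefix_on_Suc W_def fun_eq_iff)
    qed
  qed
  show ?thesis
    by (rule straight_on_if_legal[of _ V]) (use play W pos in simp)
qed

end

context periodic_sequence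
begin

lemma additive_at_transport:
  assumes x: "\<And>k. x (k + n) = \<rho> * x k" "\<rho> > 0"
    and "consec i1 i" "consec k1 k" "i mod n = k mod n" "additive_at L x k1 k"
  shows "additive_at L x i1 i"
proof -
  obtain e e' where e: "i + n * e = k + n * e'" using common_shift[OF assms(5)] .
  have "consec (i1 + n * e) (i + n * e)" "consec (k1 + n * e') (k + n * e')"
    using assms consec_shift by auto
  then have e1: "i1 + n * e = k1 + n * e'" using e consec_unique by metis
  have x': "x (k + n * e) = \<rho> ^ e * x k" for k e
  proof (induction e)
    case (Suc e)
    then show ?case using x(1)[of "k + n * e"] by (simp add: algebra_simps)
  qed simp
  have shift: "additive_at L x (j1 + n * e) (j + n * e) \<longleftrightarrow> additive_at L x j1 j" for j1 j e
  proof -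
    have "(\<Sum>k\<in>gap L (j1 + n * e) (j + n * e). a (f (j + n * e)) (f k) * x k) =
        (\<Sum>k\<in>gap L j1 j. a (f (j + n * e)) (f (k + n * e)) * x (k + n * e))"
      unfolding gap_shift by (subst sum.reindex) (auto simp: inj_on_def)
    also have "\<dots> = (\<Sum>k\<in>gap L j1 j. \<rho> ^ e * (a (f j) (f k) * x k))"
      by (simp only: f_period_mult x' mult.left_commute)
    also have "\<dots> = \<rho> ^ e * (\<Sum>k\<in>gap L j1 j. a (f j) (f k) * x k)"
      by (simp add: sum_distrib_left)
    finally have "(\<Sum>k\<in>gap L (j1 + n * e) (j + n * e). a (f (j + n * e)) (f k) * x k) =
        \<rho> ^ e * (\<Sum>k\<in>gap L j1 j. a (f j) (f k) * x k)" .
    then have "additive_at L x (j1 + n * e) (j + n * e) \<longleftrightarrow>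
        \<rho> ^ e * (x j + x j1) = \<rho> ^ e * (\<Sum>k\<in>gap L j1 j. a (f j) (f k) * x k)"
      unfolding additive_at_def x' by (simp only: distrib_left)
    then show ?thesis using x(2) by (simp add: additive_at_def)
  qed
  show ?thesis using shift[of i1 e i] shift[of k1 e' k] e e1 assms(6) by simp
qed

text \<open>Along a band the values solve the Chebyshev recurrence between two endpoints whose ratio is
  \<open>\<tau> ^ n\<close>; the weights are normalised so that those of the second letter stay bounded in \<open>\<tau>\<close>.\<close>

definition band_weight :: "(nat \<Rightarrow> nat) \<Rightarrow> nat \<Rightarrow> (real \<Rightarrow> nat \<Rightarrow> real) \<Rightarrow> real \<Rightarrow> bool" where
  "band_weight c p h B \<longleftrightarrow>
    (\<forall>\<tau> q. h \<tau> (q + n) = h \<tau> q) \<and>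
    (\<forall>q. continuous_on {1..} (\<lambda>\<tau>. h \<tau> q)) \<and>
    (\<forall>\<tau>\<ge>1. \<forall>q. f q \<in> {f (c 0), f (c 1)} \<longrightarrow> h \<tau> q > 0) \<and>
    (\<forall>\<tau>\<ge>1. \<forall>q. f q = f (c 1) \<longrightarrow> h \<tau> q \<le> B) \<and>
    (\<forall>\<tau>\<ge>1. \<forall>j. j + 2 \<le> 2 * p \<longrightarrow>
        \<tau> ^ c (j + 2) * h \<tau> (c (j + 2)) + \<tau> ^ c j * h \<tau> (c j) =
        a (f (c 0)) (f (c 1)) * (\<tau> ^ c (j + 1) * h \<tau> (c (j + 1)))) \<and>
    (\<forall>\<tau>\<ge>1.
        \<tau> ^ (c 1 + n) * h \<tau> (c 1 + n) + \<tau> ^ c (2 * p - 1) * h \<tau> (c (2 * p - 1)) =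
        a (f (c 0)) (f (c 1)) * (\<tau> ^ (c 0 + n) * h \<tau> (c 0 + n)) +
        \<tau> ^ c 1 * (\<tau> ^ n + a (f (c 0)) (f (c 1)) + 1 / \<tau> ^ n)) \<and>
    (\<Sum>k<n. if f k = f (c 1) then h 1 k else 0) * (2 - a (f (c 0)) (f (c 1))) = 2"

lemma band_weights:
  assumes b: "band L c p"
  obtains h B where "band_weight c p h B"
proof -
  have c: "cchain L c (2 * p + 1)" and p: "p \<ge> 1" "2 * p < 2 * p + 1" "c (2 * p) = c 0 + n"
    using b by (auto simp: band_def)
  define A where "A = a (f (c 0)) (f (c 1))"
  have A: "A = angle_coeff (enat (2 * p + 1))" using b by (simp add: A_def a_def band_def)
  have m2: "2 * p + 1 \<ge> 2" using p by simp
  define u where "u = sinseq A"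
  have u_rec: "u (k + 2) = A * u (k + 1) - u k" for k by (simp add: u_def numeral_2_eq_2)
  have u0: "u 0 = 0" "u 1 = 1" by (simp_all add: u_def)
  have u_end: "u (2 * p + 1) = 0" "u (2 * p) = 1"
    using sinseq_order(1,2)[OF m2] by (simp_all add: u_def A)
  have u_end2: "u (2 * p - 1) = A"
    using u_rec[of "2 * p - 1"] p u_end by (simp add: le_imp_diff_is_add)
  have u_nn: "u j \<ge> 0" if "j \<le> 2 * p" for j
    unfolding u_def A by (rule sinseq_nonneg) (use that m2 in \<open>auto simp: numeral_eq_enat\<close>)
  have u_pos: "u j > 0" if "0 < j" "j \<le> 2 * p" for j
    unfolding u_def A by (rule sinseq_pos) (use that m2 in \<open>auto simp: numeral_eq_enat\<close>)
  define idx where "idx q = (LEAST j. j < 2 * p \<and> c j mod n = q mod n)" for q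
  have idx: "idx q = j" if "j < 2 * p" "c j mod n = q mod n" for q j
    unfolding idx_def
  proof (rule Least_equality)
    fix i assume i: "i < 2 * p \<and> c i mod n = q mod n"
    show "j \<le> i"
    proof (rule ccontr)
      assume "\<not> j \<le> i"
      then have "c i < c j" using cchain_less[OF c, of i j] that by simp
      then have "c i + n \<le> c j" using mod_eq_window i that by metis
      moreover have "c j < c (2 * p)" using cchain_less[OF c, of j "2 * p"] that by simp
      moreover have "c 0 \<le> c i" using cchain_less[OF c, of 0 i] i by (cases i) auto
      ultimately show False using p by simp
    qed
  qed (use that in auto)
  \<comment> \<open>With this choice the value at \<open>c j\<close> is
    \<open>\<tau> ^ c 1 / \<tau> ^ n\<close> times \<open>u (j + 1) + \<tau> ^ n * u j\<close>, a
    solution of the recurrence. The end values \<open>u (2 * p + 1) = 0\<close> and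
    \<open>u (2 * p) = 1\<close> make it grow by the factor \<open>\<tau> ^ n\<close> from
    \<open>c 0\<close> to \<open>c 0 + n\<close>.\<close>
  define h where "h \<tau> q = \<tau> ^ (c 1 + n - c (idx q)) * (u (idx q + 1) + \<tau> ^ n * u (idx q)) / \<tau> ^ (2 * n)"
    for \<tau> :: real and q
  have h_per: "h \<tau> (q + n) = h \<tau> q" for \<tau> q by (simp add: h_def idx_def)
  have cover: "\<exists>j<2 * p. c j mod n = q mod n \<and> (f q = f (c 1) \<longrightarrow> j \<ge> 1)" if "f q \<in> {f (c 0), f (c 1)}" for q
  proof (cases "f q = f (c 0)")
    case True
    obtain k where k: "c 0 \<le> k" "k < c 0 + n" "k mod n = q mod n" "f k = f q" using window_rep .
    then obtain j where "j < p" "k = c (2 * j)" using wrap_first_positions[OF c p k(1,2)] True by auto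
    then show ?thesis using k True cchain_letters_neq[OF c] by (intro exI[of _ "2 * j"]) auto
  next
    case False
    then have fq: "f q = f (c 1)" using that by auto
    obtain k where k: "c 1 \<le> k" "k < c 1 + n" "k mod n = q mod n" "f k = f q" using window_rep .
    then obtain j where "j < p" "k = c (2 * j + 1)"
      using wrap_second_positions[OF c p k(1,2)] fq by auto
    then show ?thesis using k by (intro exI[of _ "2 * j + 1"]) auto
  qed
  have c_le: "c j \<le> c 1 + n" if "j \<le> 2 * p" for j
  proof -
    have "c j \<le> c (2 * p)" using cchain_less[OF c, of j "2 * p"] that by (cases "j = 2 * p") auto
    moreover have "c 0 \<le> c 1" using cchain_less[OF c, of 0 1] p by simp
    ultimately show ?thesis using p by simp
  qed
  have val: "\<tau> ^ c j * h \<tau> (c j) = \<tau> ^ c 1 / \<tau> ^ n * (u (j + 1) + \<tau> ^ n * u j)"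
    if \<tau>: "\<tau> \<ge> 1" and j: "j \<le> 2 * p" for \<tau> j
  proof (cases "j = 2 * p")
    case False
    then have "idx (c j) = j" using j by (intro idx) auto
    moreover have "\<tau> ^ c j * \<tau> ^ (c 1 + n - c j) = \<tau> ^ (c 1 + n)"
      using c_le[OF j] by (simp flip: power_add)
    ultimately have "\<tau> ^ c j * h \<tau> (c j) = \<tau> ^ (c 1 + n) * (u (j + 1) + \<tau> ^ n * u j) / \<tau> ^ (2 * n)"
      by (simp add: h_def)
    also have "\<dots> = \<tau> ^ c 1 * (\<tau> ^ n * (u (j + 1) + \<tau> ^ n * u j)) / (\<tau> ^ n * \<tau> ^ n)"
      by (simp only: power_add mult_2 mult.assoc)
    finally show ?thesis using \<tau> by simp
  next
    case True
    have i0: "idx (c 0) = 0" using p by (intro idx) auto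
    have "h \<tau> (c j) = h \<tau> (c 0)" using True p h_per by simp
    also have "\<dots> = \<tau> ^ (c 1 + n - c 0) / \<tau> ^ (2 * n)" using u0 by (simp add: h_def i0)
    finally have "\<tau> ^ c j * h \<tau> (c j) = \<tau> ^ (c 0 + n) * \<tau> ^ (c 1 + n - c 0) / \<tau> ^ (2 * n)"
      using True p by simp
    also have "\<tau> ^ (c 0 + n) * \<tau> ^ (c 1 + n - c 0) = \<tau> ^ (c 1 + 2 * n)"
      using c_le[of 0] by (simp flip: power_add) (simp add: mult_2 add.left_commute)
    finally show ?thesis using \<tau> True u_end by (simp add: power_add)
  qed
  define B where "B = (\<Sum>j<2 * p. u (j + 1) + u j)"
  show ?thesis
  proof (rule that[of h B], unfold band_weight_def, intro conjI allI impI)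
    show "h \<tau> (q + n) = h \<tau> q" for \<tau> q by (rule h_per)
    show "continuous_on {1..} (\<lambda>\<tau>. h \<tau> q)" for q
      unfolding h_def by (intro continuous_intros) auto
    show "h \<tau> q > 0" if \<tau>: "\<tau> \<ge> 1" and q: "f q \<in> {f (c 0), f (c 1)}" for \<tau> q
    proof -
      obtain j where j: "j < 2 * p" "c j mod n = q mod n" using cover[OF q] by blast
      have "u (j + 1) + \<tau> ^ n * u j > 0"
        using u_pos[of "j + 1"] u_nn[of j] j \<tau> by (intro add_pos_nonneg mult_nonneg_nonneg) auto
      then show ?thesis using \<tau> by (simp add: h_def idx[OF j])
    qed
    show "h \<tau> q \<le> B" if \<tau>: "\<tau> \<ge> 1" and q: "f q = f (c 1)" for \<tau> q
    proof -
      obtain j where j: "j < 2 * p" "c j mod n = q mod n" "j \<ge> 1" using cover[of q] q by blast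
      have "c 1 \<le> c j" using cchain_less[OF c, of 1 j] j by (cases "j = 1") auto
      then have "c 1 + n - c j \<le> n" by simp
      then have "\<tau> ^ (c 1 + n - c j) \<le> \<tau> ^ n" using \<tau> by (intro power_increasing) auto
      moreover have "1 * u (j + 1) \<le> \<tau> ^ n * u (j + 1)"
        using u_nn[of "j + 1"] j \<tau> by (intro mult_right_mono) auto
      ultimately have le: "\<tau> ^ (c 1 + n - c j) * (u (j + 1) + \<tau> ^ n * u j) \<le> \<tau> ^ n * (\<tau> ^ n * (u (j + 1) + u j))"
        using u_nn[of "j + 1"] u_nn[of j] j \<tau> by (intro mult_mono) (auto simp: algebra_simps)
      have "h \<tau> q \<le> \<tau> ^ n * (\<tau> ^ n * (u (j + 1) + u j)) / \<tau> ^ (2 * n)"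
        unfolding h_def idx[OF j(1,2)] using le \<tau> by (intro divide_right_mono) auto
      also have "\<dots> = u (j + 1) + u j" using \<tau> by (simp add: mult_2 power_add)
      also have "\<dots> \<le> B"
        unfolding B_def using j u_nn by (intro member_le_sum) auto
      finally show ?thesis .
    qed
    show "\<tau> ^ c (j + 2) * h \<tau> (c (j + 2)) + \<tau> ^ c j * h \<tau> (c j) =
        a (f (c 0)) (f (c 1)) * (\<tau> ^ c (j + 1) * h \<tau> (c (j + 1)))"
      if "\<tau> \<ge> 1" "j + 2 \<le> 2 * p" for \<tau> j
    proof -
      have r: "u (j + 2 + 1) = A * u (j + 1 + 1) - u (j + 1)" "u (j + 2) = A * u (j + 1) - u j"
        using u_rec[of "j + 1"] u_rec[of j] by (simp_all add: numeral_3_eq_3)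
      show ?thesis
        using val[OF that(1), of j] val[OF that(1), of "j + 1"] val[OF that(1), of "j + 2"] that(2)
        unfolding A_def[symmetric] r by (simp add: algebra_simps)
    qed
    show "\<tau> ^ (c 1 + n) * h \<tau> (c 1 + n) + \<tau> ^ c (2 * p - 1) * h \<tau> (c (2 * p - 1)) =
        a (f (c 0)) (f (c 1)) * (\<tau> ^ (c 0 + n) * h \<tau> (c 0 + n)) +
        \<tau> ^ c 1 * (\<tau> ^ n + a (f (c 0)) (f (c 1)) + 1 / \<tau> ^ n)" if \<tau>: "\<tau> \<ge> 1" for \<tau>
    proof -
      have u2: "u 2 = A" using u_rec[of 0] u0 by (simp add: numeral_2_eq_2)
      have "\<tau> ^ (c 1 + n) * h \<tau> (c 1 + n) = \<tau> ^ n * (\<tau> ^ c 1 * h \<tau> (c 1))"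
        using h_per by (simp add: power_add)
      also have "\<dots> = \<tau> ^ c 1 * (A + \<tau> ^ n)"
        using val[OF \<tau>, of 1] p u2 u0 \<tau> by (simp add: numeral_2_eq_2)
      finally have 1: "\<tau> ^ (c 1 + n) * h \<tau> (c 1 + n) = \<tau> ^ c 1 * (A + \<tau> ^ n)" .
      have "2 * p - 1 + 1 = 2 * p" using p by simp
      then have 2: "\<tau> ^ c (2 * p - 1) * h \<tau> (c (2 * p - 1)) = \<tau> ^ c 1 / \<tau> ^ n * (1 + \<tau> ^ n * A)"
        using val[OF \<tau>, of "2 * p - 1"] u_end u_end2 by simp
      have 3: "\<tau> ^ (c 0 + n) * h \<tau> (c 0 + n) = \<tau> ^ c 1"
        using val[OF \<tau>, of "2 * p"] p u_end \<tau> by simp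
      show ?thesis unfolding 1 2 3 A_def[symmetric] using \<tau> by (simp add: field_simps)
    qed
    \<comment> \<open>At \<open>\<tau> = 1\<close> the weights are \<open>u (j + 1) + u j\<close>;
      over odd \<open>j\<close> they add up to \<open>2 / (2 - A)\<close>, the factor by which the
      band amplifies its second letter towards the outside.\<close>
    show "(\<Sum>k<n. if f k = f (c 1) then h 1 k else 0) * (2 - a (f (c 0)) (f (c 1))) = 2"
    proof -
      have "(\<Sum>k<n. if f k = f (c 1) then h 1 k else 0) =
          (\<Sum>k\<in>{c 1..<c 1 + n}. if f k = f (c 1) then h 1 k else 0)"
        by (rule sum_periodic_window[symmetric]) (simp add: h_per f_period)
      also have "\<dots> = (\<Sum>k\<in>(\<lambda>j. c (2 * j + 1)) ` {..<p}. h 1 k)"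
      proof (rule sum.mono_neutral_cong_right)
        show "(\<lambda>j. c (2 * j + 1)) ` {..<p} \<subseteq> {c 1..<c 1 + n}"
        proof
          fix k assume "k \<in> (\<lambda>j. c (2 * j + 1)) ` {..<p}"
          then obtain j where j: "j < p" "k = c (2 * j + 1)" by auto
          have "c 1 \<le> k" using cchain_less[OF c, of 1 "2 * j + 1"] j by (cases "j = 0") auto
          moreover have "k < c (2 * p)" using cchain_less[OF c, of "2 * j + 1" "2 * p"] j by auto
          ultimately show "k \<in> {c 1..<c 1 + n}" using c_le[of "2 * p"] by simp
        qed
        show "\<forall>k\<in>{c 1..<c 1 + n} - (\<lambda>j. c (2 * j + 1)) ` {..<p}. (if f k = f (c 1) then h 1 k else 0) = 0"
        proof
          fix k assume k: "k \<in> {c 1..<c 1 + n} - (\<lambda>j. c (2 * j + 1)) ` {..<p}"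
          show "(if f k = f (c 1) then h 1 k else 0) = 0"
          proof (cases "f k = f (c 1)")
            case True
            obtain j where "j < p" "k = c (2 * j + 1)"
              using wrap_second_positions[OF c p, of k] k True by auto
            then show ?thesis using k by blast
          qed simp
        qed
        fix k assume "k \<in> (\<lambda>j. c (2 * j + 1)) ` {..<p}"
        then obtain j where j: "j < p" "k = c (2 * j + 1)" by auto
        then have "f k = f (c 1)" using cchain_letter[OF c, of "2 * j + 1"] by simp
        then show "(if f k = f (c 1) then h 1 k else 0) = h 1 k" by simp
      qed auto
      also have "\<dots> = (\<Sum>j<p. h 1 (c (2 * j + 1)))"
      proof (rule sum.reindex_cong[of "\<lambda>j. c (2 * j + 1)"])
        show "inj_on (\<lambda>j. c (2 * j + 1)) {..<p}"
        proof (rule linorder_inj_onI)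
          fix i j assume "i < j" "i \<in> {..<p}" "j \<in> {..<p}"
          then show "c (2 * i + 1) \<noteq> c (2 * j + 1)" using cchain_less[OF c, of "2 * i + 1" "2 * j + 1"] by simp
        qed auto
      qed auto
      also have "\<dots> = (\<Sum>j<p. u (2 * j + 2)) + (\<Sum>j<p. u (2 * j + 1))"
        unfolding sum.distrib[symmetric]
      proof (rule sum.cong)
        fix j assume "j \<in> {..<p}"
        then have "idx (c (2 * j + 1)) = 2 * j + 1" by (intro idx) auto
        then show "h 1 (c (2 * j + 1)) = u (2 * j + 2) + u (2 * j + 1)" by (simp add: h_def)
      qed simp
      finally have "(\<Sum>k<n. if f k = f (c 1) then h 1 k else 0) =
          (\<Sum>j<p. u (2 * j + 2)) + (\<Sum>j<p. u (2 * j + 1))" .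
      then show ?thesis
        using sinseq_sums[of A p] u_end unfolding u_def A_def[symmetric] by (simp add: algebra_simps)
    qed
  qed
qed

lemma a_le_2: "a s t \<le> 2"
  by (cases "m s t") (auto simp: a_def angle_coeff_def)

lemma single_positions: "single z \<Longrightarrow> f i = z \<Longrightarrow> f k = z \<Longrightarrow> i mod n = k mod n"
proof -
  assume z: "single z" "f i = z" "f k = z"
  obtain k' where k': "i \<le> k'" "k' < i + n" "k' mod n = k mod n" "f k' = f k" using window_rep .
  then have "k' = i" using singleD[OF z(1), of i k'] z by (cases "k' = i") auto
  then show ?thesis using k' by simp
qed

text \<open>All occurrences of a different first letter would lie in the exceptional gap of the
  second letter. There are at least two because \<open>p' \<ge> 2\<close>, and between two
  consecutive ones the second letter has to occur, which that gap excludes.\<close>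

lemma large_band_first_unique:
  assumes b: "band L c p" and b': "band L c' p'" "p' \<ge> 2" and t: "f (c' 1) = f (c 1)"
  shows "f (c' 0) = f (c 0)"
proof (rule ccontr)
  assume ne: "f (c' 0) \<noteq> f (c 0)"
  have c: "cchain L c (2 * p + 1)" and p: "p \<ge> 1" "2 * p < 2 * p + 1" "c (2 * p) = c 0 + n"
    using b by (auto simp: band_def)
  have c': "cchain L c' (2 * p' + 1)" and p': "p' \<ge> 1" "2 * p' < 2 * p' + 1" "c' (2 * p') = c' 0 + n"
    using b' by (auto simp: band_def)
  let ?s = "f (c' 0)"
  have sL: "?s \<in> L" and adj: "adj ?s (f (c 1))"
    using c' t cchain_linked[OF c', of 0] b'(2) by (auto simp: cchain_def linked_def)
  have in_gap: "k \<in> gap L (c (2 * p - 1)) (c 1 + n)" if "c 1 \<le> k" "k < c 1 + n" "f k = ?s" for k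
    using wrap_second_neighbours[OF c p that(1,2)] that(3) sL adj ne by simp
  have no: False if kk: "k1 < k2" "f k1 = ?s" "f k2 = ?s"
    "k1 \<in> gap L (c (2 * p - 1)) (c 1 + n)" "k2 \<in> gap L (c (2 * p - 1)) (c 1 + n)" for k1 k2
  proof -
    obtain i1 where i1: "consec i1 k2" "k1 \<le> i1" using consec_ex[of k1 k2] kk by metis
    obtain q where q: "gap L i1 k2 = {q}" using band_first_gap[OF b'(1) i1(1) kk(3)] .
    then have "q \<in> gap L i1 k2" by simp
    then have qq: "i1 < q" "q < k2" "f q \<in> L" "adj (f q) ?s" using kk(3) by (auto simp: gap_def)
    have "f q = f (c 1)" using wrap_first_neighbours[OF c' p' qq(3,4)] t by simp
    moreover have "c (2 * p - 1) < q" "q < c 1 + n" using qq i1 kk(4,5) by (auto simp: gap_def)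
    ultimately show False using wrap_second_consec[OF c p] f_period by (auto simp: consec_def)
  qed
  obtain k1 where k1: "c 1 \<le> k1" "k1 < c 1 + n" "k1 mod n = c' 0 mod n" "f k1 = ?s" using window_rep .
  obtain k2 where k2: "c 1 \<le> k2" "k2 < c 1 + n" "k2 mod n = c' 2 mod n" "f k2 = f (c' 2)" using window_rep .
  have f2: "f (c' 2) = ?s" using cchain_letter[OF c', of 2] b'(2) by simp
  have lt: "c' 0 < c' 2" "c' 2 < c' (2 * p')" using cchain_less[OF c'] b'(2) by auto
  have "k1 \<noteq> k2"
  proof
    assume "k1 = k2"
    then have "c' 0 + n \<le> c' 2" using mod_eq_window[OF _ lt(1)] k1 k2 by metis
    then show False using lt p' by simp
  qed
  then consider "k1 < k2" | "k2 < k1" by linarith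
  then show False using no in_gap k1 k2 f2 by cases metis+
qed

text \<open>The ansatz is a value \<open>\<tau> ^ q\<close> times a band weight times an unknown
  \<open>Y\<close> of the letter. The first letter of a band shares the unknown of the second one
  and is thereby eliminated, which leaves one unknown and one equation for each letter of
  \<open>I\<close>.\<close>

theorem straight_on_if_single_or_large_band:
  assumes fin: "finite L" and range: "L \<subseteq> range f" and conn: "connected L"
    and nfd: "not_finite_dihedral L"
    and letters: "\<And>z. z \<in> L \<Longrightarrow> single z \<or> in_large_band L z"
    and y: "\<And>z. z \<in> L \<Longrightarrow> y z \<ge> 0" "\<exists>z\<in>L. y z > 0"
      "\<And>z. z \<in> L \<Longrightarrow> (\<Sum>t\<in>L. a z t * y t) \<ge> 0"
  shows "straight_on L"
proof -
  have LS: "L \<subseteq> S" using range f_in by auto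
  define T where "T = {t. \<exists>c p. band L c p \<and> p \<ge> 2 \<and> f (c 1) = t}"
  have "\<forall>t\<in>T. \<exists>c p. band L c p \<and> p \<ge> 2 \<and> f (c 1) = t" by (auto simp: T_def)
  then obtain C P where CP: "\<And>t. t \<in> T \<Longrightarrow> band L (C t) (P t)" "\<And>t. t \<in> T \<Longrightarrow> P t \<ge> 2"
    "\<And>t. t \<in> T \<Longrightarrow> f (C t 1) = t" by metis
  define s where "s t = f (C t 0)" for t
  have chain: "cchain L (C t) (2 * P t + 1)" and
    wrap: "P t \<ge> 1" "2 * P t < 2 * P t + 1" "C t (2 * P t) = C t 0 + n" if "t \<in> T" for t
    using CP(1)[OF that] by (auto simp: band_def)
  have sL: "s t \<in> L" and TL: "t \<in> L" and st: "s t \<noteq> t" and adj_st: "adj (s t) t" "adj t (s t)"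
    if "t \<in> T" for t
  proof -
    have "f (C t 0) \<in> L" "f (C t 1) \<in> L" "adj (f (C t 0)) (f (C t 1))"
      using chain[OF that] cchain_linked[OF chain[OF that], of 0] CP(2)[OF that]
      by (auto simp: cchain_def linked_def)
    then show "s t \<in> L" "t \<in> L" "s t \<noteq> t" "adj (s t) t" "adj t (s t)"
      using CP(3)[OF that] adj_sym[OF f_in f_in, of "C t 0" "C t 1"] adj_irrefl[OF f_in, of "C t 1"]
      by (auto simp: s_def)
  qed
  have nbr: "z = t" if z: "t \<in> T" "z \<in> L" "adj z (s t)" for z t
  proof -
    obtain k where "z = f k" using range z by auto
    then show ?thesis
      using wrap_first_neighbours[OF chain[OF z(1)] wrap[OF z(1)], of k] z CP(3)[OF z(1)]
      by (simp add: s_def)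
  qed
  have nbr': "z = t" if "t \<in> T" "z \<in> L" "adj (s t) z" for z t
    using nbr[OF that(1,2)] that adj_sym sL LS by blast
  have s_inj: "t = t'" if "t \<in> T" "t' \<in> T" "s t = s t'" for t t'
    using nbr[OF that(1) TL[OF that(2)], unfolded that(3), OF adj_st(2)[OF that(2)]] by (rule HOL.sym)
  define Bs where "Bs = s ` T"
  \<comment> \<open>A letter that is first in one band and second in another has only one neighbour,
    and its partner has no other neighbour either. The two would be a finite dihedral
    component.\<close>
  have disj: "t \<notin> Bs" if t: "t \<in> T" for t
  proof
    assume "t \<in> Bs"
    then obtain t' where t': "t' \<in> T" "t = s t'" by (auto simp: Bs_def)
    have "s t = t'" using nbr[OF t'(1) sL[OF t]] adj_st(1)[OF t] t' by simp
    have "{t, s t} = L"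
    proof (rule ccontr)
      assume "{t, s t} \<noteq> L"
      then obtain x z where xz: "x \<in> {t, s t}" "z \<in> L - {t, s t}" "adj x z"
        using conn TL[OF t] sL[OF t] unfolding connected_def
        by (metis empty_subsetI insert_not_empty insert_subset)
      then consider "x = t" | "x = s t" by blast
      then show False
      proof cases
        case 1
        then have "z = t'" using nbr'[OF t'(1), of z] xz t' by simp
        then show False using xz \<open>s t = t'\<close> by simp
      next
        case 2
        then show False using nbr'[OF t, of z] xz by simp
      qed
    qed
    then have "m (s t) t = \<infinity>" using nfd st[OF t] unfolding not_finite_dihedral_def by (metis insert_commute)
    then show False using CP(1)[OF t] CP(3)[OF t] by (simp add: band_def s_def)
  qed
  define I where "I = L - Bs"
  have TI: "T \<subseteq> I" using TL disj by (auto simp: I_def)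
  have IL: "I \<subseteq> L" by (auto simp: I_def)
  have single: "single z" if z: "z \<in> I" "z \<notin> T" for z
  proof (rule ccontr)
    assume "\<not> single z"
    then obtain c p where c: "band L c p" "p \<ge> 2" "z = f (c 0) \<or> z = f (c 1)"
      using letters[of z] z IL by (auto simp: in_large_band_def)
    then have t: "f (c 1) \<in> T" by (auto simp: T_def)
    then have "z = f (c 0)" using c z by auto
    also have "\<dots> = s (f (c 1))"
      unfolding s_def by (rule large_band_first_unique[OF CP(1)[OF t] c(1,2)]) (rule CP(3)[OF t, symmetric])
    finally show False using t z by (auto simp: I_def Bs_def)
  qed
  have adj_Bs: "z \<in> T \<and> x = s z" if "x \<in> Bs" "z \<in> L" "adj x z" for x z
    using that nbr' by (auto simp: Bs_def)
  have finI: "finite I" and finT: "finite T" using fin TI by (auto simp: I_def intro: finite_subset)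
  have "\<forall>t\<in>T. \<exists>h B. band_weight (C t) (P t) h B" using band_weights CP(1) by metis
  then obtain h B where hB: "\<And>t. t \<in> T \<Longrightarrow> band_weight (C t) (P t) (h t) (B t)" by metis
  have h: "(\<forall>\<tau> q. h t \<tau> (q + n) = h t \<tau> q) \<and>
    (\<forall>q. continuous_on {1..} (\<lambda>\<tau>. h t \<tau> q)) \<and>
    (\<forall>\<tau>\<ge>1. \<forall>q. f q \<in> {s t, t} \<longrightarrow> h t \<tau> q > (0::real)) \<and>
    (\<forall>\<tau>\<ge>1. \<forall>q. f q = t \<longrightarrow> h t \<tau> q \<le> B t) \<and>
    (\<forall>\<tau>\<ge>1. \<forall>j. j + 2 \<le> 2 * P t \<longrightarrow>
        \<tau> ^ C t (j + 2) * h t \<tau> (C t (j + 2)) + \<tau> ^ C t j * h t \<tau> (C t j) =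
        a (s t) t * (\<tau> ^ C t (j + 1) * h t \<tau> (C t (j + 1)))) \<and>
    (\<forall>\<tau>\<ge>1.
        \<tau> ^ (C t 1 + n) * h t \<tau> (C t 1 + n) + \<tau> ^ C t (2 * P t - 1) * h t \<tau> (C t (2 * P t - 1)) =
        a (s t) t * (\<tau> ^ (C t 0 + n) * h t \<tau> (C t 0 + n)) +
        \<tau> ^ C t 1 * (\<tau> ^ n + a (s t) t + 1 / \<tau> ^ n)) \<and>
    (\<Sum>k<n. if f k = t then h t 1 k else 0) * (2 - a (s t) t) = 2" if "t \<in> T" for t
    using hB[OF that, unfolded band_weight_def CP(3)[OF that] s_def[symmetric]] .
  define H where "H \<tau> k = (if f k \<in> T then h (f k) \<tau> k else 1)" for \<tau> k
  have "\<exists>b. z \<in> I \<longrightarrow> f b = z \<and> (z \<in> T \<longrightarrow> b = C z 1)" for z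
    using CP(3) IL range by (cases "z \<in> T") auto
  then obtain b where b: "\<And>z. z \<in> I \<Longrightarrow> f (b z) = z" "\<And>z. z \<in> T \<Longrightarrow> b z = C z 1"
    using TI by (metis subsetD)
  define G where "G z = {k. b z < k \<and> k < b z + n \<and> f k \<in> I \<and> adj (f k) z}" for z
  have finG: "finite (G z)" for z by (rule finite_subset[of _ "{..<b z + n}"]) (auto simp: G_def)
  \<comment> \<open>Row \<open>i\<close> collects what the letters of \<open>I\<close> contribute to
    \<open>i\<close> over one period after \<open>b i\<close>. The factor \<open>d i\<close> comes
    from the two occurrences of \<open>i\<close> at the ends; for a band letter it is what the last
    equation of \<open>band_weight\<close> leaves after the band's own contribution is taken
    out.\<close>
  define K where "K i j \<tau> = (\<Sum>k\<in>{k\<in>G i. f k = j}. a i (f k) * \<tau> ^ (k - b i) * H \<tau> k)" for i j \<tau>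
  define d where "d i \<tau> = \<tau> ^ n + (if i \<in> T then a (s i) i + 1 / \<tau> ^ n else 1)" for i and \<tau> :: real
  have K_sum: "(\<Sum>j\<in>I. K i j \<tau> * Y j) = (\<Sum>k\<in>G i. a i (f k) * \<tau> ^ (k - b i) * H \<tau> k * Y (f k))" for i \<tau> Y
  proof -
    have "(\<Sum>j\<in>I. K i j \<tau> * Y j) =
        (\<Sum>j\<in>I. \<Sum>k\<in>{k\<in>G i. f k = j}. a i (f k) * \<tau> ^ (k - b i) * H \<tau> k * Y (f k))"
      unfolding K_def sum_distrib_right by (intro sum.cong) auto
    also have "\<dots> = (\<Sum>k\<in>G i. a i (f k) * \<tau> ^ (k - b i) * H \<tau> k * Y (f k))"
      by (rule sum.group[OF finG finI]) (auto simp: G_def)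
    finally show ?thesis .
  qed
  have a_G: "a i (f k) \<ge> 1" if "k \<in> G i" "i \<in> I" for i k
    using that a_adj adj_sym LS IL f_in unfolding G_def by blast
  have H_pos: "H \<tau> k > 0" if "\<tau> \<ge> 1" for \<tau> k
    using h[of "f k"] that by (auto simp: H_def)
  have A_lt: "a (s t) t < 2" and A_ge: "a (s t) t \<ge> 1" if "t \<in> T" for t
  proof -
    have "m (s t) t = enat (2 * P t + 1)" using CP(1,3)[OF that] by (simp add: band_def s_def)
    then show "a (s t) t < 2" using angle_coeff_lt_2[of "2 * P t + 1"] wrap[OF that] by (simp add: a_def)
    show "a (s t) t \<ge> 1" using a_adj adj_st(1)[OF that] by blast
  qed
  have A_sym: "a t (s t) = a (s t) t" if "t \<in> T" for t
    using a_sym sL TL LS that by blast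
  \<comment> \<open>The factor \<open>(2 - a (s j) j) / 2\<close> undoes the total weight of the
    occurrences of \<open>j\<close> at \<open>\<tau> = 1\<close>, so each row turns back into a row
    of \<open>a\<close>.\<close>
  have rows_sub: "(\<Sum>j\<in>I. K i j 1 * (if j \<in> T then y j * (2 - a (s j) j) / 2 else y j)) =
      (\<Sum>j\<in>I - {i}. a i j * y j)" if i: "i \<in> I" for i
  proof -
    have "K i j 1 * (if j \<in> T then y j * (2 - a (s j) j) / 2 else y j) = (if j = i then 0 else a i j * y j)"
      if j: "j \<in> I" for j
    proof (cases "j \<noteq> i \<and> adj j i")
      case False
      have "{k \<in> G i. f k = j} = {}" using False adj_irrefl LS IL i by (auto simp: G_def)
      then have "K i j 1 = 0" unfolding K_def by (simp only: sum.empty)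
      moreover have "a i j = 0" if "j \<noteq> i" using False that a_not_adj[of i j] adj_sym[of i j] LS IL i j by auto
      ultimately show ?thesis by simp
    next
      case True
      have set: "{k \<in> G i. f k = j} = {k \<in> {b i..<b i + n}. f k = j}"
        using True j b(1)[OF i] by (auto simp: G_def less_le)
      have K1: "K i j 1 = a i j * (\<Sum>k\<in>{b i..<b i + n}. if f k = j then H 1 k else 0)"
        unfolding K_def set by (simp add: sum_distrib_left sum.inter_filter[symmetric])
      show ?thesis
      proof (cases "j \<in> T")
        case jT: True
        have "(\<Sum>k\<in>{b i..<b i + n}. if f k = j then H 1 k else 0) = (\<Sum>k<n. if f k = j then H 1 k else 0)"
          by (rule sum_periodic_window) (use h in \<open>auto simp: H_def f_period\<close>)
        also have "\<dots> = (\<Sum>k<n. if f k = j then h j 1 k else 0)"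
          using jT by (intro sum.cong) (auto simp: H_def)
        finally have "(\<Sum>k\<in>{b i..<b i + n}. if f k = j then H 1 k else 0) * (2 - a (s j) j) = 2"
          using h[OF jT] by simp
        then have "K i j 1 * (y j * (2 - a (s j) j) / 2) = a i j * y j"
          unfolding K1 by (simp add: mult.commute mult.left_commute)
        then show ?thesis using jT True by simp
      next
        case jT: False
        obtain q where "f q = j" using b(1)[OF j] by blast
        then obtain k where k: "b i \<le> k" "k < b i + n" "f k = j" using window_rep by metis
        have uniq: "k' = k" if "b i \<le> k'" "k' < b i + n" "f k' = j" for k'
        proof (rule ccontr)
          assume "k' \<noteq> k"
          then consider "k' < k" | "k < k'" by linarith
          then show False using singleD[OF single[OF j jT]] that k by cases force+
        qed
        have "(\<Sum>k\<in>{b i..<b i + n}. if f k = j then H 1 k else 0) =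
            (\<Sum>k'\<in>{b i..<b i + n}. if k' = k then 1 else 0)"
        proof (rule sum.cong)
          fix k' assume k': "k' \<in> {b i..<b i + n}"
          show "(if f k' = j then H 1 k' else 0) = (if k' = k then 1 else 0)"
          proof (cases "k' = k")
            case True
            then show ?thesis using k jT by (simp add: H_def)
          next
            case False
            then have "f k' \<noteq> j" using uniq[of k'] k' by auto
            then show ?thesis using False by simp
          qed
        qed simp
        also have "\<dots> = 1" using k by simp
        finally show ?thesis using jT True by (simp add: K1)
      qed
    qed
    then have "(\<Sum>j\<in>I. K i j 1 * (if j \<in> T then y j * (2 - a (s j) j) / 2 else y j)) =
        (\<Sum>j\<in>I. if j = i then 0 else a i j * y j)" by (intro sum.cong) auto
    also have "\<dots> = (\<Sum>j\<in>I - {i}. a i j * y j)"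
      using finI i by (subst sum.remove[of I i]) (auto intro!: sum.cong)
    finally show ?thesis .
  qed
  have L_split: "(\<Sum>t\<in>L. a i t * y t) = (\<Sum>j\<in>I - {i}. a i j * y j) - 2 * y i +
      (if i \<in> T then a (s i) i * y (s i) else 0)" if i: "i \<in> I" for i
  proof -
    have "L = I \<union> Bs" "I \<inter> Bs = {}" using sL by (auto simp: I_def Bs_def)
    moreover have finB: "finite Bs" using finT by (simp add: Bs_def)
    ultimately have "(\<Sum>t\<in>L. a i t * y t) = (\<Sum>t\<in>I. a i t * y t) + (\<Sum>t\<in>Bs. a i t * y t)"
      using finI by (simp add: sum.union_disjoint)
    also have "(\<Sum>t\<in>I. a i t * y t) = (\<Sum>j\<in>I - {i}. a i j * y j) - 2 * y i"
      using finI i a_self[of i] LS IL by (subst sum.remove[of I i]) auto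
    also have "(\<Sum>t\<in>Bs. a i t * y t) = (\<Sum>x\<in>Bs. if i \<in> T \<and> x = s i then a (s i) i * y (s i) else 0)"
    proof (rule sum.cong)
      fix x assume x: "x \<in> Bs"
      have xi: "x \<noteq> i" "x \<in> S" "i \<in> S" using x i sL LS by (auto simp: I_def Bs_def)
      show "a i x * y x = (if i \<in> T \<and> x = s i then a (s i) i * y (s i) else 0)"
        using adj_Bs[OF x, of i] a_not_adj[of i x] adj_sym[of i x] A_sym xi i IL by auto
    qed simp
    also have "\<dots> = (if i \<in> T then a (s i) i * y (s i) else 0)"
      using finB by (auto simp: Bs_def)
    finally show ?thesis .
  qed
  \<comment> \<open>This is the inequality for \<open>y\<close> at \<open>s t\<close>, whose only
    neighbour is \<open>t\<close>. It bounds the eliminated coordinate by one that is kept.\<close>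
  have y_s: "2 * y (s t) \<le> a (s t) t * y t" if t: "t \<in> T" for t
  proof -
    have "(\<Sum>x\<in>L. a (s t) x * y x) = (\<Sum>x\<in>L. (if x = s t then - 2 * y (s t) else 0) +
        (if x = t then a (s t) t * y t else 0))"
    proof (rule sum.cong)
      fix x assume x: "x \<in> L"
      show "a (s t) x * y x = (if x = s t then - 2 * y (s t) else 0) + (if x = t then a (s t) t * y t else 0)"
        using nbr'[OF t x] a_not_adj[of "s t" x] a_self[of "s t"] st[OF t] sL[OF t] x LS by auto
    qed simp
    also have "\<dots> = - 2 * y (s t) + a (s t) t * y t"
      using fin sL[OF t] TL[OF t] by (simp add: sum.distrib)
    finally show ?thesis using y(3)[OF sL[OF t]] by simp
  qed
  have "\<exists>\<tau> Y. \<tau> \<ge> 1 \<and> (\<forall>i\<in>I. Y i > 0) \<and> (\<forall>i\<in>I. d i \<tau> * Y i = (\<Sum>j\<in>I. K i j \<tau> * Y j))"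
  \<comment> \<open>The bound for \<open>\<tau>\<close>: a row has at most \<open>n\<close> terms,
    each at most \<open>2 * M * \<tau> ^ (n - 1)\<close> where \<open>M\<close> bounds the weights,
    against \<open>\<tau> ^ n \<le> d i \<tau>\<close>.\<close>
  proof (rule positive_solution_exists[OF finI,
      where K = K and d = d and T = "2 * real n * (1 + (\<Sum>t\<in>T. \<bar>B t\<bar>))" and
        w = "\<lambda>j. if j \<in> T then y j * (2 - a (s j) j) / 2 else y j"])
    show "continuous_on {1..} (K i j)" if "i \<in> I" "j \<in> I" for i j
    proof -
      have "continuous_on {1..} (\<lambda>\<tau>. H \<tau> k)" for k
        using h[of "f k"] by (cases "f k \<in> T") (auto simp: H_def)
      then show ?thesis unfolding K_def by (intro continuous_intros)
    qed
    show "continuous_on {1..} (d i)" for i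
      unfolding d_def by (cases "i \<in> T") (auto intro!: continuous_intros)
    show "K i j \<tau> \<ge> 0" if "i \<in> I" "\<tau> \<ge> 1" for i j \<tau>
      unfolding K_def using a_G[OF _ that(1)] H_pos[OF that(2)] that(2)
      by (intro sum_nonneg mult_nonneg_nonneg) (auto intro: less_imp_le order_trans[OF zero_le_one])
    show "d i \<tau> > 0" if "\<tau> \<ge> 1" for i \<tau>
      using that A_ge[of i] by (auto simp: d_def intro!: add_pos_nonneg add_nonneg_nonneg)
    show "\<exists>j\<in>X. \<exists>i\<in>I - X. \<forall>\<tau>\<ge>1. K i j \<tau> > 0" if X: "X \<subseteq> I" "X \<noteq> {}" "X \<noteq> I" for X
    proof -
      \<comment> \<open>Putting the eliminated first letters on the side of their second letters
        turns a cut of \<open>I\<close> into a cut of \<open>L\<close>.\<close>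
      define X' where "X' = X \<union> s ` (X \<inter> T)"
      have "X' \<subseteq> L" "X' \<noteq> {}" using X sL IL by (auto simp: X'_def)
      moreover have "X' \<noteq> L"
      proof
        assume "X' = L"
        obtain i where i: "i \<in> I" "i \<notin> X" using X by blast
        then have "i \<in> X'" using \<open>X' = L\<close> IL by blast
        then show False using i by (auto simp: X'_def I_def Bs_def)
      qed
      ultimately obtain x z where xz: "x \<in> X'" "z \<in> L - X'" "adj x z"
        using conn unfolding connected_def by metis
      have "x \<notin> Bs"
      proof
        assume x: "x \<in> Bs"
        then have z: "z \<in> T" "x = s z" using adj_Bs[OF x] xz by auto
        have "x \<notin> X" using x X by (auto simp: I_def)
        then obtain t where t: "t \<in> X \<inter> T" "x = s t" using xz by (auto simp: X'_def)
        have "t = z" by (rule s_inj) (use t z in auto)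
        then show False using t xz by (simp add: X'_def)
      qed
      then have xX: "x \<in> X" using xz by (auto simp: X'_def Bs_def)
      have "z \<notin> Bs"
      proof
        assume z: "z \<in> Bs"
        have "adj z x" using xz adj_sym[of x z] xX X IL LS by blast
        then have "x \<in> T" "z = s x" using adj_Bs[OF z, of x] xX X IL by auto
        then show False using xX xz by (auto simp: X'_def)
      qed
      then have zI: "z \<in> I - X" using xz by (auto simp: I_def X'_def)
      have "K z x \<tau> > 0" if \<tau>: "\<tau> \<ge> 1" for \<tau>
        unfolding K_def
      proof (rule sum_pos)
        obtain q where "f q = x" using b(1) xX X by blast
        then obtain k where k: "b z \<le> k" "k < b z + n" "f k = x" using window_rep by metis
        have "f (b z) = z" using b(1) zI by blast
        then have "k \<noteq> b z" using k xX zI by auto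
        then have "k \<in> G z" using k xX X xz by (auto simp: G_def)
        then show "{k \<in> G z. f k = x} \<noteq> {}" using k by blast
        fix k assume "k \<in> {k \<in> G z. f k = x}"
        then show "a z (f k) * \<tau> ^ (k - b z) * H \<tau> k > 0"
          using a_G[of k z] zI H_pos[OF \<tau>, of k] \<tau> by (intro mult_pos_pos) auto
      qed (use finG in simp)
      then show ?thesis using xX zI by blast
    qed
    show "(if i \<in> T then y i * (2 - a (s i) i) / 2 else y i) \<ge> 0" if "i \<in> I" for i
      using y(1)[of i] A_lt[of i] that IL by auto
    show "\<exists>i\<in>I. (if i \<in> T then y i * (2 - a (s i) i) / 2 else y i) > 0"
    proof -
      obtain z where z: "z \<in> L" "y z > 0" using y(2) by blast
      have "\<exists>i\<in>I. y i > 0"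
      proof (cases "z \<in> I")
        case False
        then obtain t where t: "t \<in> T" "z = s t" using z by (auto simp: I_def Bs_def)
        have "0 < a (s t) t * y t" using y_s[OF t(1)] z t by simp
        then have "y t > 0" using A_ge[OF t(1)] by (simp add: zero_less_mult_iff)
        then show ?thesis using t TI by blast
      qed (use z in blast)
      then show ?thesis using A_lt by fastforce
    qed
    show "d i 1 * (if i \<in> T then y i * (2 - a (s i) i) / 2 else y i) \<le>
        (\<Sum>j\<in>I. K i j 1 * (if j \<in> T then y j * (2 - a (s j) j) / 2 else y j))" if i: "i \<in> I" for i
    proof -
      have nn: "(\<Sum>j\<in>I - {i}. a i j * y j) - 2 * y i + (if i \<in> T then a (s i) i * y (s i) else 0) \<ge> 0"
        using L_split[OF i] y(3)[of i] i IL by auto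
      show ?thesis
      proof (cases "i \<in> T")
        case False
        then show ?thesis using nn rows_sub[OF i] by (simp add: d_def)
      next
        case True
        \<comment> \<open>Here \<open>d i 1 = 2 + A\<close>, so the left side is
          \<open>(2 + A) * (2 - A) / 2 * y i\<close>. By \<open>y_s\<close> this is at most
          \<open>2 * y i - A * y (s i)\<close>, which the inequality for \<open>y\<close> at
          \<open>i\<close> bounds by the row sum.\<close>
        define A where "A = a (s i) i"
        have "A * (2 * y (s i)) \<le> A * (A * y i)"
          using y_s[OF True] A_ge[OF True] unfolding A_def by (intro mult_left_mono) auto
        moreover have "d i 1 * (y i * (2 - A) / 2) = 2 * y i - A * (A * y i) / 2"
          using True by (simp add: d_def A_def field_simps)
        ultimately show ?thesis using nn rows_sub[OF i] True by (simp add: A_def)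
      qed
    qed
    show "(\<Sum>j\<in>I. K i j \<tau>) < d i \<tau>"
      if i: "i \<in> I" and \<tau>: "\<tau> > 2 * real n * (1 + (\<Sum>t\<in>T. \<bar>B t\<bar>))" "\<tau> \<ge> 1" for i \<tau>
    proof -
      define M where "M = 1 + (\<Sum>t\<in>T. \<bar>B t\<bar>)"
      have M: "M \<ge> 1" by (simp add: M_def sum_nonneg)
      have HM: "H \<tau> k \<le> M" for k
      proof (cases "f k \<in> T")
        case True
        have "h (f k) \<tau> k \<le> B (f k)" using h[OF True] \<tau>(2) by blast
        also have "\<dots> \<le> \<bar>B (f k)\<bar>" by simp
        also have "\<dots> \<le> (\<Sum>t\<in>T. \<bar>B t\<bar>)"
          by (rule member_le_sum[OF True, where f = "\<lambda>t. \<bar>B t\<bar>"]) (use finT in auto)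
        finally show ?thesis using True by (simp add: H_def M_def)
      qed (use M in \<open>simp add: H_def\<close>)
      have "(\<Sum>j\<in>I. K i j \<tau>) = (\<Sum>k\<in>G i. a i (f k) * \<tau> ^ (k - b i) * H \<tau> k)"
        using K_sum[of i \<tau> "\<lambda>_. 1"] by simp
      also have "\<dots> \<le> (\<Sum>k\<in>G i. 2 * \<tau> ^ (n - 1) * M)"
      proof (rule sum_mono)
        fix k assume k: "k \<in> G i"
        have "\<tau> ^ (k - b i) \<le> \<tau> ^ (n - 1)" using k \<tau> by (intro power_increasing) (auto simp: G_def)
        moreover have "0 \<le> a i (f k)" using a_G[OF k i] by simp
        ultimately show "a i (f k) * \<tau> ^ (k - b i) * H \<tau> k \<le> 2 * \<tau> ^ (n - 1) * M"
          using a_le_2[of i "f k"] HM[of k] H_pos[OF \<tau>(2), of k] \<tau> by (intro mult_mono) auto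
      qed
      also have "\<dots> = real (card (G i)) * (2 * \<tau> ^ (n - 1) * M)" by simp
      also have "\<dots> \<le> real n * (2 * \<tau> ^ (n - 1) * M)"
      proof (rule mult_right_mono)
        have "card (G i) \<le> card {b i..<b i + n}" by (rule card_mono) (auto simp: G_def)
        then show "real (card (G i)) \<le> real n" by simp
      qed (use M \<tau> in auto)
      also have "\<dots> = (2 * real n * M) * \<tau> ^ (n - 1)" by simp
      also have "\<dots> < \<tau> * \<tau> ^ (n - 1)" using \<tau> by (intro mult_strict_right_mono) (auto simp: M_def)
      also have "\<dots> = \<tau> ^ n" using n_pos by (simp flip: power_Suc)
      also have "\<dots> \<le> d i \<tau>"
      proof (cases "i \<in> T")
        case True
        then have "0 \<le> a (s i) i" "0 \<le> 1 / \<tau> ^ n" using A_ge[of i] \<tau>(2) by auto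
        then show ?thesis unfolding d_def if_P[OF True] by linarith
      qed (simp add: d_def)
      finally show ?thesis .
    qed
  qed blast
  then obtain \<tau> Y where \<tau>: "\<tau> \<ge> 1" and Y: "\<And>i. i \<in> I \<Longrightarrow> Y i > 0"
    and eqs: "\<And>i. i \<in> I \<Longrightarrow> d i \<tau> * Y i = (\<Sum>k\<in>G i. a i (f k) * \<tau> ^ (k - b i) * H \<tau> k * Y (f k))"
    unfolding K_sum by blast
  define own where "own z = (SOME t. t \<in> T \<and> s t = z)" for z
  have own: "own (s t) = t" if "t \<in> T" for t
    unfolding own_def by (rule some_equality) (use that s_inj in auto)
  define x where "x q = \<tau> ^ q * (if f q \<in> Bs then h (own (f q)) \<tau> q * Y (own (f q)) else H \<tau> q * Y (f q))" for q
  have x_s: "x q = \<tau> ^ q * h t \<tau> q * Y t" if "t \<in> T" "f q \<in> {s t, t}" for q t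
    using that own[OF that(1)] disj[OF that(1)] by (auto simp: x_def H_def Bs_def)
  have x_I: "x q = \<tau> ^ q * H \<tau> q * Y (f q)" if "f q \<in> I" for q
    using that by (simp add: x_def I_def)
  have x_per: "x (q + n) = \<tau> ^ n * x q" for q
  proof -
    have "h (own (f q)) \<tau> (q + n) = h (own (f q)) \<tau> q" if "f q \<in> Bs"
      using h own that by (auto simp: Bs_def)
    moreover have "H \<tau> (q + n) = H \<tau> q" using h[of "f q"] by (simp add: H_def f_period)
    ultimately show ?thesis by (simp add: x_def f_period power_add)
  qed
  have \<tau>n: "\<tau> ^ n > 0" using \<tau> by simp
  have G_sum: "(\<Sum>k\<in>G i. a i (f k) * x k) = \<tau> ^ b i * (d i \<tau> * Y i)" if i: "i \<in> I" for i
  proof -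
    have "(\<Sum>k\<in>G i. a i (f k) * x k) =
        (\<Sum>k\<in>G i. \<tau> ^ b i * (a i (f k) * \<tau> ^ (k - b i) * H \<tau> k * Y (f k)))"
    proof (rule sum.cong)
      fix k assume k: "k \<in> G i"
      then have "\<tau> ^ k = \<tau> ^ b i * \<tau> ^ (k - b i)" by (simp add: G_def flip: power_add)
      then show "a i (f k) * x k = \<tau> ^ b i * (a i (f k) * \<tau> ^ (k - b i) * H \<tau> k * Y (f k))"
        using x_I[of k] k by (simp add: G_def)
    qed simp
    then show ?thesis using eqs[OF i] by (simp add: sum_distrib_left)
  qed
  show ?thesis
  proof (rule straight_on_if_additive[of _ x])
    fix i assume i: "f i \<in> L"
    show "x i > 0"
    proof (cases "f i \<in> Bs")
      case True
      then obtain t where t: "t \<in> T" "f i = s t" by (auto simp: Bs_def)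
      then show ?thesis using x_s[of t i] h[OF t(1)] \<tau> Y[of t] TI by auto
    next
      case False
      then have "f i \<in> I" using i by (simp add: I_def)
      then show ?thesis using x_I[of i] H_pos[OF \<tau>, of i] \<tau> Y[of "f i"] by simp
    qed
    fix i1 assume i1: "consec i1 i"
    note transport = additive_at_transport[of x "\<tau> ^ n", OF x_per \<tau>n i1]
    show "additive_at L x i1 i"
    proof (cases "f i \<in> T \<union> Bs")
      case False
      then have z: "f i \<in> I" "f i \<notin> T" using i by (auto simp: I_def)
      have fb: "f (b (f i)) = f i" using b(1)[OF z(1)] .
      have cons: "consec (b (f i)) (b (f i) + n)"
        using singleD[OF single[OF z], of "b (f i)"] fb n_pos by (auto simp: consec_def f_period) force
      have g: "gap L (b (f i)) (b (f i) + n) = G (f i)"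
        using adj_Bs[of _ "f i"] z fb by (auto simp: gap_def G_def I_def f_period)
      have "additive_at L x (b (f i)) (b (f i) + n)"
        unfolding additive_at_def g f_period fb
        using G_sum[OF z(1)] x_I[of "b (f i)"] x_per[of "b (f i)"] fb z
        by (simp add: d_def H_def algebra_simps)
      moreover have "i mod n = (b (f i) + n) mod n" using single_positions[OF single[OF z], of i "b (f i)"] fb by simp
      ultimately show ?thesis using transport cons by blast
    next
      case True
      then obtain t where t: "t \<in> T" "f i \<in> {s t, t}" by (auto simp: Bs_def)
      have f1: "f (C t 1) = t" and f0: "f (C t 0) = s t" using CP(3)[OF t(1)] by (auto simp: s_def)
      have xC: "x (C t j) = \<tau> ^ C t j * h t \<tau> (C t j) * Y t" and fC: "f (C t j) = (if even j then s t else t)"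
        if "j \<le> 2 * P t" for j
      proof -
        show "f (C t j) = (if even j then s t else t)"
          using cchain_letter[OF chain[OF t(1)], of j] that f0 f1 by simp
        then show "x (C t j) = \<tau> ^ C t j * h t \<tau> (C t j) * Y t" using x_s[OF t(1)] by simp
      qed
      have "f i \<in> {f (C t 0), f (C t 1)}" using t f0 f1 by simp
      then show ?thesis
      proof (rule band_consec_cases[OF CP(1)[OF t(1)] i1])
        fix j assume j: "j + 2 \<le> 2 * P t" "i mod n = C t (j + 2) mod n"
        have co: "consec (C t j) (C t (j + 2))" and g: "gap L (C t j) (C t (j + 2)) = {C t (j + 1)}"
          using cchain_consec[OF chain[OF t(1)], of j] cchain_gap[OF chain[OF t(1)], of j] j by auto
        have "\<tau> ^ C t (j + 2) * h t \<tau> (C t (j + 2)) + \<tau> ^ C t j * h t \<tau> (C t j) =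
            a (s t) t * (\<tau> ^ C t (j + 1) * h t \<tau> (C t (j + 1)))"
          using h[OF t(1)] \<tau> j(1) by blast
        then have "(\<tau> ^ C t (j + 2) * h t \<tau> (C t (j + 2)) + \<tau> ^ C t j * h t \<tau> (C t j)) * Y t =
            a (s t) t * (\<tau> ^ C t (j + 1) * h t \<tau> (C t (j + 1))) * Y t" by simp
        moreover have "a (f (C t (j + 2))) (f (C t (j + 1))) = a (s t) t"
          using fC[of "j + 2"] fC[of "j + 1"] j A_sym[OF t(1)] by auto
        ultimately have "additive_at L x (C t j) (C t (j + 2))"
          unfolding additive_at_def g using xC[of j] xC[of "j + 1"] xC[of "j + 2"] j
          by (simp add: algebra_simps)
        then show ?thesis using transport co j(2) by blast
      next
        assume fi: "f i = f (C t 1)" and im: "i mod n = (C t 1 + n) mod n"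
        note co = wrap_second_consec[OF chain[OF t(1)] wrap[OF t(1)]]
        have tI: "t \<in> I" using t TI by blast
        have bt: "b t = C t 1" using b(2) t by blast
        have lk: "linked (C t (2 * P t - 1)) (C t (2 * P t))"
          using cchain_linked[OF chain[OF t(1)], of "2 * P t - 1"] wrap[OF t(1)] by simp
        have le: "C t 1 \<le> C t (2 * P t - 1)" "C t 0 < C t 1"
        proof -
          have "1 < 2 * P t - 1" "2 * P t - 1 < 2 * P t + 1" using CP(2)[OF t(1)] by auto
          then show "C t 1 \<le> C t (2 * P t - 1)"
            using cchain_less[OF chain[OF t(1)], of 1 "2 * P t - 1"] by simp
          show "C t 0 < C t 1"
            using cchain_less[OF chain[OF t(1)], of 0 1] CP(2)[OF t(1)] by simp
        qed
        \<comment> \<open>The exceptional gap holds one position of the band itself and all other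
          neighbours of \<open>t\<close> in a period, so \<open>G t\<close> describes the rest of
          it.\<close>
        have g: "gap L (C t (2 * P t - 1)) (C t 1 + n) = insert (C t 0 + n) (G t)"
        proof (intro equalityI subsetI)
          fix k assume k: "k \<in> gap L (C t (2 * P t - 1)) (C t 1 + n)"
          then have kt: "adj (f k) t" "f k \<in> L" "C t 1 < k" "k < C t 1 + n"
            using le f1 f_period by (auto simp: gap_def)
          show "k \<in> insert (C t 0 + n) (G t)"
          proof (cases "f k \<in> Bs")
            case True
            then have "f k = s t" using adj_Bs[OF True TL[OF t(1)] kt(1)] by simp
            then show ?thesis
              using wrap_second_gap_first[OF chain[OF t(1)] wrap[OF t(1)] k] f0 by simp
          next
            case False
            then show ?thesis using kt bt by (simp add: G_def I_def)
          qed
        next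
          fix k assume "k \<in> insert (C t 0 + n) (G t)"
          then show "k \<in> gap L (C t (2 * P t - 1)) (C t 1 + n)"
          proof
            assume "k = C t 0 + n"
            then show ?thesis
              using lk wrap[OF t(1)] le f0 f1 f_period sL[OF t(1)] adj_st(1)[OF t(1)]
              by (simp add: gap_def linked_def)
          next
            assume k: "k \<in> G t"
            have "f k \<noteq> s t" using k t by (auto simp: G_def I_def Bs_def)
            then show ?thesis
              using wrap_second_neighbours[OF chain[OF t(1)] wrap[OF t(1)], of k] k bt f0 f1 IL
              by (auto simp: G_def)
          qed
        qed
        have "C t 0 + n \<notin> G t" using t f0 f_period[of "C t 0"] by (auto simp: G_def I_def Bs_def)
        then have "(\<Sum>k\<in>gap L (C t (2 * P t - 1)) (C t 1 + n). a t (f k) * x k) =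
            a t (s t) * x (C t 0 + n) + \<tau> ^ C t 1 * (d t \<tau> * Y t)"
          unfolding g using finG G_sum[OF tI] bt f0 f_period by simp
        moreover have "x (C t 1 + n) + x (C t (2 * P t - 1)) =
            a (s t) t * x (C t 0 + n) + \<tau> ^ C t 1 * (d t \<tau> * Y t)"
        proof -
          have "\<tau> ^ (C t 1 + n) * h t \<tau> (C t 1 + n) + \<tau> ^ C t (2 * P t - 1) * h t \<tau> (C t (2 * P t - 1)) =
            a (s t) t * (\<tau> ^ (C t 0 + n) * h t \<tau> (C t 0 + n)) +
            \<tau> ^ C t 1 * (\<tau> ^ n + a (s t) t + 1 / \<tau> ^ n)"
            using h[OF t(1)] \<tau> by blast
          then have "(\<tau> ^ (C t 1 + n) * h t \<tau> (C t 1 + n) + \<tau> ^ C t (2 * P t - 1) * h t \<tau> (C t (2 * P t - 1))) * Y t =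
            (a (s t) t * (\<tau> ^ (C t 0 + n) * h t \<tau> (C t 0 + n)) +
            \<tau> ^ C t 1 * (\<tau> ^ n + a (s t) t + 1 / \<tau> ^ n)) * Y t" by simp
          moreover have "x (C t 1 + n) = \<tau> ^ (C t 1 + n) * h t \<tau> (C t 1 + n) * Y t"
            "x (C t 0 + n) = \<tau> ^ (C t 0 + n) * h t \<tau> (C t 0 + n) * Y t"
            by (rule x_s[OF t(1)], unfold f_period f0 f1, simp)+
          moreover have "x (C t (2 * P t - 1)) =
              \<tau> ^ C t (2 * P t - 1) * h t \<tau> (C t (2 * P t - 1)) * Y t" by (rule xC) simp
          ultimately show ?thesis using t(1) by (simp add: d_def algebra_simps)
        qed
        ultimately have "additive_at L x (C t (2 * P t - 1)) (C t 1 + n)"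
          unfolding additive_at_def using A_sym[OF t(1)] f1 f_period by simp
        then show ?thesis using transport co im by blast
      qed
    qed
  qed
qed

end

section \<open>Commutation classes\<close>

context coxeter_data
begin

abbreviation comm :: "'a list \<Rightarrow> 'a list \<Rightarrow> bool" where
  "comm u v \<equiv> commutation_equivalent S m u v"

lemma comm_trans: "comm u v \<Longrightarrow> comm v w \<Longrightarrow> comm u w"
  by (simp add: commutation_equivalent_def)

lemma comm_append:
  assumes "comm u v" "x \<in> lists S" "y \<in> lists S"
  shows "comm (x @ u @ y) (x @ v @ y)"
  using assms(1) unfolding commutation_equivalent_def
proof (induction rule: rtrancl_induct)
  case (step v w)
  from step(2) obtain p q s t where st: "v = p @ [s, t] @ q" "w = p @ [t, s] @ q"
    "p \<in> lists S" "q \<in> lists S" "s \<in> S" "t \<in> S" "m s t = 2"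
    by (auto simp: commutation_moves_def)
  have "(x @ v @ y, x @ w @ y) \<in> commutation_moves S m"
    unfolding commutation_moves_def mem_Collect_eq
    by (rule exI[of _ "x @ p"], rule exI[of _ "q @ y"], rule exI[of _ s], rule exI[of _ t])
      (use st assms in simp)
  then show ?case using step(3) by (rule rtrancl_into_rtrancl[rotated])
qed simp

lemma comm_eqv: "comm u v \<Longrightarrow> u \<in> lists S \<Longrightarrow> eqv u v \<and> length v = length u \<and> set v = set u"
  unfolding commutation_equivalent_def
proof (induction rule: rtrancl_induct)
  case base
  then show ?case by (simp add: coxeter_cong.refl)
next
  case (step v w)
  from step(2) obtain p q s t where st: "v = p @ [s, t] @ q" "w = p @ [t, s] @ q"
    "p \<in> lists S" "q \<in> lists S" "s \<in> S" "t \<in> S" "m s t = 2"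
    by (auto simp: commutation_moves_def)
  have "eqv v w" unfolding st
    by (intro eqv_append coxeter_cong.refl st eqv_commute)
  then show ?case using step st by (auto intro: coxeter_cong.trans)
qed

text \<open>Two letters that are swapped cannot both belong to a pair that does not commute. This
  invariant tells the two sides of a braid relation apart.\<close>

lemma comm_filter:
  assumes "comm u v" "m s t \<noteq> 2" "s \<in> S" "t \<in> S"
  shows "filter (\<lambda>x. x \<in> {s, t}) u = filter (\<lambda>x. x \<in> {s, t}) v"
  using assms(1) unfolding commutation_equivalent_def
proof (induction rule: rtrancl_induct)
  case (step v w)
  from step(2) obtain p q x y where xy: "v = p @ [x, y] @ q" "w = p @ [y, x] @ q"
    "x \<in> S" "y \<in> S" "m x y = 2"
    by (auto simp: commutation_moves_def)
  have "x \<noteq> y" using xy m_self by (auto simp: one_enat_def numeral_eq_enat)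
  then have "\<not> (x \<in> {s, t} \<and> y \<in> {s, t})"
    using xy assms(2-4) m_sym by auto
  then have "filter (\<lambda>x. x \<in> {s, t}) [x, y] = filter (\<lambda>x. x \<in> {s, t}) [y, x]" by auto
  then show ?case using step(3) xy by (simp only: filter_append)
qed simp

lemma comm_letter_word:
  assumes "e \<in> S" "A \<in> lists S" "\<And>x. x \<in> set A \<Longrightarrow> m e x = 2"
  shows "comm (e # A) (A @ [e])" "comm (A @ [e]) (e # A)"
proof -
  have "comm (e # A) (A @ [e]) \<and> comm (A @ [e]) (e # A)"
    using assms(2,3)
  proof (induction A rule: list.induct)
    case Nil
    then show ?case by (simp add: commutation_equivalent_def)
  next
    case (Cons x A)
    have x: "x \<in> S" "A \<in> lists S" "m e x = 2" "m x e = 2"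
      using Cons.prems m_sym[OF assms(1), of x] by auto
    have 1: "comm [e, x] [x, e]" and 2: "comm [x, e] [e, x]"
      unfolding commutation_equivalent_def commutation_moves_def
      by (rule r_into_rtrancl, unfold mem_Collect_eq, rule exI[of _ "[]"], rule exI[of _ "[]"],
        use x assms(1) in fastforce)+
    have IH: "comm (e # A) (A @ [e])" "comm (A @ [e]) (e # A)" using Cons.IH Cons.prems by auto
    have "comm (e # x # A) (x # e # A)" "comm (x # e # A) (e # x # A)"
      using comm_append[OF 1, of "[]" A] comm_append[OF 2, of "[]" A] x by auto
    moreover have "comm (x # e # A) (x # A @ [e])" "comm (x # A @ [e]) (x # e # A)"
      using comm_append[OF IH(1), of "[x]" "[]"] comm_append[OF IH(2), of "[x]" "[]"] x by auto
    ultimately show ?case by (auto intro: comm_trans)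
  qed
  then show "comm (e # A) (A @ [e])" "comm (A @ [e]) (e # A)" by auto
qed

lemma comm_word_word:
  assumes "u \<in> lists S" "A \<in> lists S" "\<And>x e. x \<in> set A \<Longrightarrow> e \<in> set u \<Longrightarrow> m e x = 2"
  shows "comm (u @ A) (A @ u)"
  using assms
proof (induction u rule: list.induct)
  case Nil
  then show ?case by (simp add: commutation_equivalent_def)
next
  case (Cons e u)
  have "comm ([e] @ (u @ A) @ []) ([e] @ (A @ u) @ [])"
    using Cons by (intro comm_append) auto
  moreover have "comm ([] @ (e # A) @ u) ([] @ (A @ [e]) @ u)"
    using Cons.prems by (intro comm_append comm_letter_word) auto
  ultimately show ?case by (auto intro: comm_trans)
qed

lemma eqv_filter_split:
  assumes "u \<in> lists S" "\<And>x y. x \<in> set u \<Longrightarrow> y \<in> set u \<Longrightarrow> x \<in> C \<Longrightarrow> y \<notin> C \<Longrightarrow> m x y = 2"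
  shows "eqv u (filter (\<lambda>x. x \<in> C) u @ filter (\<lambda>x. x \<notin> C) u)"
  using assms
proof (induction u rule: list.induct)
  case Nil
  then show ?case by (simp add: coxeter_cong.refl)
next
  case (Cons x u)
  let ?A = "filter (\<lambda>x. x \<in> C) u" and ?B = "filter (\<lambda>x. x \<notin> C) u"
  have x: "x \<in> S" "u \<in> lists S" "?A \<in> lists S" "?B \<in> lists S"
    using Cons.prems by (auto simp: in_lists_conv_set)
  have "eqv u (?A @ ?B)" using Cons by auto
  then have e: "eqv (x # u) (x # ?A @ ?B)"
    using coxeter_cong_append_left[of u _ S m "[x]"] x by simp
  show ?case
  proof (cases "x \<in> C")
    case True
    then show ?thesis using e by simp
  next
    case False
    have "m x y = 2" if "y \<in> set ?A" for y
      using Cons.prems(2)[of y x] that False m_sym[of x y] x by (auto simp: in_lists_conv_set)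
    then have "comm (x # ?A) (?A @ [x])" using x by (intro comm_letter_word) auto
    then have "eqv (x # ?A) (?A @ [x])" using comm_eqv x by auto
    then have "eqv ((x # ?A) @ ?B) ((?A @ [x]) @ ?B)"
      using x by (intro eqv_append coxeter_cong.refl)
    then show ?thesis using e False by (auto intro: coxeter_cong.trans)
  qed
qed

definition wpow :: "nat \<Rightarrow> 'a list \<Rightarrow> 'a list" where
  "wpow k u = concat (replicate k u)"

lemma wpow_add: "wpow (i + j) u = wpow i u @ wpow j u"
  by (simp add: wpow_def replicate_add)

lemma length_wpow: "length (wpow k u) = k * length u"
  by (induction k) (auto simp: wpow_def)

lemma filter_wpow: "filter P (wpow k u) = wpow k (filter P u)"
  by (induction k) (auto simp: wpow_def)

lemma wpow_lists: "u \<in> lists S \<Longrightarrow> wpow k u \<in> lists S"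
  by (induction k) (auto simp: wpow_def)

lemma coxeter_cong_mono:
  assumes "(u, v) \<in> coxeter_cong C m" "C \<subseteq> S"
  shows "eqv u v"
  using assms(1)
proof (induction rule: coxeter_cong.induct)
  case (relator u v s t k)
  then show ?case using assms(2) by (intro coxeter_cong.relator) (auto simp: in_lists_conv_set)
qed (use assms(2) in \<open>auto simp: in_lists_conv_set intro: coxeter_cong.refl coxeter_cong.sym coxeter_cong.trans\<close>)

lemma finite_order:
  assumes "C \<subseteq> S" "finite (carrier (coxeter_group C m))" "v \<in> lists C"
  obtains k where "k \<ge> 1" "eqv (wpow k v) []"
proof -
  have vC: "wpow k v \<in> lists C" for k using assms(3) by (induction k) (auto simp: wpow_def)
  have vS: "v \<in> lists S" using assms by (auto simp: in_lists_conv_set)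
  have "range (\<lambda>k. coxeter_cong C m `` {wpow k v}) \<subseteq> carrier (coxeter_group C m)"
    using vC by (auto simp: coxeter_group_def intro: quotientI)
  then have "finite (range (\<lambda>k. coxeter_cong C m `` {wpow k v}))"
    using assms(2) finite_subset by blast
  then have "\<not> inj (\<lambda>k. coxeter_cong C m `` {wpow k v})" using finite_imageD by blast
  then obtain i j where ij: "i < j" "coxeter_cong C m `` {wpow i v} = coxeter_cong C m `` {wpow j v}"
    unfolding inj_def by (metis linorder_neqE_nat)
  have "(wpow i v, wpow j v) \<in> coxeter_cong C m"
    using eq_equiv_class[OF ij(2) equiv_coxeter_cong vC] .
  then have "eqv (wpow i v) (wpow j v)" using coxeter_cong_mono assms(1) by blast
  also have "wpow j v = wpow (j - i) v @ wpow i v" using ij by (simp flip: wpow_add)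
  finally have "eqv ([] @ wpow i v) (wpow (j - i) v @ wpow i v)" by simp
  then have "eqv [] (wpow (j - i) v)" by (rule eqv_cancel_right)
  then have "eqv (wpow (j - i) v) []" by (rule coxeter_cong.sym)
  then show ?thesis using that[of "j - i"] ij by simp
qed

end

context letter_sequence
begin

text \<open>Letters of different components do not influence each other, so positivity can be
  checked one component at a time.\<close>

lemma fired_component:
  assumes "C \<subseteq> L" "\<And>x y. x \<in> L - C \<Longrightarrow> y \<in> C \<Longrightarrow> \<not> adj y x" "L \<subseteq> S" "f i \<in> C"
  shows "fired L i = fired C i"
proof -
  have "\<forall>y\<in>C. state L k y = state C k y" for k
  proof (induction k)
    case 0
    then show ?case by (simp add: state_def prefix_on_def)
  next
    case (Suc k)
    show ?case
    proof
      fix y assume y: "y \<in> C"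
      show "state L (Suc k) y = state C (Suc k) y"
      proof (cases "f k \<in> C")
        case True
        then show ?thesis using Suc y assms(1) by (auto simp: state_Suc fired_def)
      next
        case False
        have "a y (f k) = 0" if "f k \<in> L"
          using a_not_adj[of y "f k"] assms(1-3) that False y by blast
        then show ?thesis using Suc y False by (simp add: state_Suc)
      qed
    qed
  qed
  then show ?thesis using assms(4) by (simp add: fired_def)
qed

text \<open>The letters between two neighbouring positions of the chain commute with both chain
  letters, except that the first block is only known to commute with the first letter and the last
  block with the final one. So the last block moves out to the right and all others to the
  left.\<close>

lemma chain_window_comm:
  assumes c: "\<And>j. j + 1 < r \<Longrightarrow> linked (c j) (c (j + 1))"
    "\<And>j. j + 2 < r \<Longrightarrow> consec (c j) (c (j + 2)) \<and> gap (range f) (c j) (c (j + 2)) = {c (j + 1)}"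
    "\<And>j. j < r \<Longrightarrow> f (c j) = (if even j then s else t)"
    and r: "r \<ge> 3"
  obtains P Q where "P \<in> lists S" "Q \<in> lists S"
    "comm (map f [c 0..<c (r - 1) + 1]) (P @ alt s t r @ Q)"
proof -
  have lS: "map f xs \<in> lists S" for xs using f_in by (auto simp: in_lists_conv_set)
  have fc: "f (c j) \<in> S" for j using f_in .
  have less: "c j < c (j + 1)" if "j + 1 < r" for j using c(1)[OF that] by (simp add: linked_def)
  have le: "c 0 \<le> c j" if "j < r" for j
    using that
  proof (induction j)
    case (Suc j)
    then show ?case using less[of j] by simp
  qed simp
  define A where "A j = map f [c j + 1..<c (j + 1)]" for j
  have AS: "A j \<in> lists S" for j unfolding A_def by (rule lS)
  have split: "map f [c 0..<c (j + 1) + 1] = map f [c 0..<c j + 1] @ A j @ [f (c (j + 1))]"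
    if "j + 1 < r" for j
  proof -
    have le': "c 0 \<le> c j + 1" "c j + 1 \<le> c (j + 1)" "c 0 \<le> c (j + 1)"
      using less[OF that] le[of j] that by auto
    have "[c 0..<c (j + 1)] = [c 0..<c j + 1] @ [c j + 1..<c (j + 1)]"
      using upt_add_eq_append[OF le'(1), of "c (j + 1) - (c j + 1)"]
      unfolding le_add_diff_inverse[OF le'(2)] .
    then have "[c 0..<c (j + 1) + 1] = [c 0..<c j + 1] @ [c j + 1..<c (j + 1)] @ [c (j + 1)]"
      using upt_Suc_append[OF le'(3)] by (simp del: upt_Suc)
    then show ?thesis by (simp add: A_def)
  qed
  have m2: "m (f (c i)) x = 2"
    if xj: "x \<in> set (A j)" "j + 1 < r" "(i = j + 1 \<and> j \<ge> 1) \<or> (i = j \<and> j + 2 < r)" for i j x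
  proof -
    obtain k where k: "x = f k" "c j < k" "k < c (j + 1)" using xj(1) by (auto simp: A_def)
    have ne: "f k \<noteq> f (c j)" "f k \<noteq> f (c (j + 1))"
      using c(1)[OF xj(2)] k by (auto simp: linked_def)
    have "\<not> adj (f k) (f (c i))"
      using xj(3)
    proof
      assume i: "i = j + 1 \<and> j \<ge> 1"
      then have "gap (range f) (c (j - 1)) (c (j + 1)) = {c j}"
        using c(2)[of "j - 1"] xj(2) by (simp add: Suc_diff_le numeral_2_eq_2)
      moreover have "c (j - 1) < c j" using less[of "j - 1"] xj(2) i by simp
      then have "adj (f k) (f (c (j + 1))) \<Longrightarrow> k \<in> gap (range f) (c (j - 1)) (c (j + 1))"
        using k by (auto simp: gap_def)
      ultimately show ?thesis using k i by auto
    next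
      assume i: "i = j \<and> j + 2 < r"
      then have g: "gap (range f) (c j) (c (j + 2)) = {c (j + 1)}" "f (c (j + 2)) = f (c j)"
        using c(2)[of j] by (auto simp: consec_def)
      moreover have "c (j + 1) < c (j + 2)" using less[of "j + 1"] i by simp
      then have "adj (f k) (f (c (j + 2))) \<Longrightarrow> k \<in> gap (range f) (c j) (c (j + 2))"
        using k by (auto simp: gap_def)
      ultimately show ?thesis using k i by auto
    qed
    then show ?thesis
      using m_not_adj[of "f (c i)" "f k"] adj_sym[OF f_in f_in, of "c i" k] f_in ne k(1) xj(3) by auto
  qed
  have alt_S: "alt s t k \<in> lists S" for k
    using set_alt[of s t k] c(3)[of 0] c(3)[of 1] fc[of 0] fc[of 1] r by (auto simp: in_lists_conv_set)
  have main: "\<exists>P\<in>lists S. comm (map f [c 0..<c k + 1]) (P @ alt s t (k + 1))"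
    if "1 \<le> k" "k + 1 < r" for k
    using that
  proof (induction k rule: dec_induct)
    case base
    have f01: "f (c 0) = s" "f (c 1) = t" using c(3)[of 0] c(3)[of 1] r by auto
    have "map f [c 0..<c 1 + 1] = [] @ (s # A 0) @ [t]"
      using split[of 0] f01 r by simp
    moreover have "comm ([] @ (s # A 0) @ [t]) ([] @ (A 0 @ [s]) @ [t])"
      using fc[of 0] fc[of 1] f01 m2[of _ 0 0] r lS
      by (intro comm_append comm_letter_word) (auto simp: A_def)
    ultimately show ?case using lS by (intro bexI[of _ "A 0"]) (auto simp: A_def numeral_2_eq_2)
  next
    case (step k)
    then obtain P where P: "P \<in> lists S" "comm (map f [c 0..<c k + 1]) (P @ alt s t (k + 1))" by auto
    let ?e = "f (c (k + 1))"
    have "comm ([] @ map f [c 0..<c k + 1] @ (A k @ [?e])) ([] @ (P @ alt s t (k + 1)) @ (A k @ [?e]))"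
      using lS f_in by (intro comm_append P) (auto simp: A_def)
    then have 1: "comm (map f [c 0..<c (k + 1) + 1]) (P @ (alt s t (k + 1) @ A k) @ [?e])"
      using split[of k] step by simp
    have kr: "k + 1 < r" "k + 2 < r" "k \<ge> 1" using step by auto
    have st: "{s, t} = {f (c k), f (c (k + 1))}"
      using c(3)[of k] c(3)[of "k + 1"] kr by (cases "even k") auto
    have "m e x = 2" if "x \<in> set (A k)" "e \<in> set (alt s t (k + 1))" for x e
    proof -
      have "e \<in> {s, t}" by (rule subsetD[OF set_alt that(2)])
      then have "e \<in> {f (c k), f (c (k + 1))}" by (simp only: st)
      then consider "e = f (c k)" | "e = f (c (k + 1))" by blast
      then show ?thesis
      proof cases
        case 1
        then show ?thesis using m2[OF that(1) kr(1), of k] kr by simp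
      next
        case 2
        then show ?thesis using m2[OF that(1) kr(1), of "k + 1"] kr by simp
      qed
    qed
    then have "comm (alt s t (k + 1) @ A k) (A k @ alt s t (k + 1))"
      by (rule comm_word_word[OF alt_S AS])
    then have 2: "comm (P @ (alt s t (k + 1) @ A k) @ [?e]) (P @ (A k @ alt s t (k + 1)) @ [?e])"
      using P f_in by (intro comm_append) auto
    have "alt s t (k + 1) @ [?e] = alt s t (k + 1 + 1)"
      using c(3)[of "k + 1"] step.prems alt_snoc[of s t "k + 1"] by simp
    then have "P @ (A k @ alt s t (k + 1)) @ [?e] = (P @ A k) @ alt s t (Suc k + 1)"
      by simp
    then show ?case
      using comm_trans[OF 1 2] P lS by (intro bexI[of _ "P @ A k"]) (auto simp: A_def)
  qed
  define k where "k = r - 2"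
  have k: "r = k + 2" "1 \<le> k" using r by (simp_all add: k_def)
  obtain P where P: "P \<in> lists S" "comm (map f [c 0..<c k + 1]) (P @ alt s t (k + 1))"
    using main[of k] k by auto
  let ?e = "f (c (k + 1))"
  have "comm ([] @ map f [c 0..<c k + 1] @ (A k @ [?e])) ([] @ (P @ alt s t (k + 1)) @ (A k @ [?e]))"
    using lS f_in by (intro comm_append P) (auto simp: A_def)
  then have 1: "comm (map f [c 0..<c (r - 1) + 1]) ((P @ alt s t (k + 1)) @ (A k @ [?e]) @ [])"
    using split[of k] k by simp
  have "comm (A k @ [?e]) (?e # A k)"
    using m2[of _ k "k + 1"] k lS f_in by (intro comm_letter_word) (auto simp: A_def)
  then have 2: "comm ((P @ alt s t (k + 1)) @ (A k @ [?e]) @ []) ((P @ alt s t (k + 1)) @ (?e # A k) @ [])"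
  proof (rule comm_append)
    show "P @ alt s t (k + 1) \<in> lists S" using P(1) alt_S[of "k + 1"] by (simp del: alt.simps)
  qed simp
  have "alt s t (k + 1) @ [?e] = alt s t r"
    using c(3)[of "k + 1"] k alt_snoc[of s t "k + 1"] by simp
  then have e: "(P @ alt s t (k + 1)) @ (?e # A k) @ [] = P @ alt s t r @ A k"
    by (metis append.assoc append_Cons append_Nil append_Nil2)
  have "comm (map f [c 0..<c (r - 1) + 1]) (P @ alt s t r @ A k)"
    using comm_trans[OF 1 2] unfolding e .
  then show ?thesis by (rule that[OF P(1) AS])
qed

end

section \<open>Coxeter groups\<close>

lemma graph_component_connected:
  assumes C: "C \<in> graph_components m J" and X: "X \<subseteq> C" "X \<noteq> {}" "X \<noteq> C"
    and sym: "\<And>s t. s \<in> J \<Longrightarrow> t \<in> J \<Longrightarrow> m s t = m t s"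
  shows "\<exists>x\<in>X. \<exists>y\<in>C - X. m x y \<ge> 3"
proof (rule ccontr)
  assume no: "\<not> ?thesis"
  let ?E = "coxeter_edges m J"
  have symE: "sym ?E" using sym by (auto simp: sym_def coxeter_edges_def)
  obtain s0 where s0: "s0 \<in> J" "C = ?E\<^sup>* `` {s0}" using C by (auto simp: graph_components_def quotient_def)
  obtain x where x: "x \<in> X" using X by blast
  have closed: "z \<in> X" if "(x, z) \<in> ?E\<^sup>*" for z
    using that
  proof (induction rule: rtrancl_induct)
    case (step y z)
    have "(s0, y) \<in> ?E\<^sup>*" using step X s0 by auto
    then have "z \<in> C" using step(2) s0(2) by (auto intro: rtrancl_into_rtrancl)
    moreover have "m y z \<ge> 3" using step(2) by (auto simp: coxeter_edges_def)
    ultimately show ?case using no step(3) by blast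
  qed (use x in simp)
  have "(s0, x) \<in> ?E\<^sup>*" using x X s0 by auto
  then have "(x, s0) \<in> ?E\<^sup>*" by (rule symD[OF sym_rtrancl[OF symE]])
  then have "C \<subseteq> X" using closed s0 by (auto intro: rtrancl_trans)
  then show False using X by blast
qed

lemma graph_component_subset: "C \<in> graph_components m J \<Longrightarrow> C \<subseteq> J"
proof
  fix t assume C: "C \<in> graph_components m J" and t: "t \<in> C"
  then obtain s0 where s0: "s0 \<in> J" "(s0, t) \<in> (coxeter_edges m J)\<^sup>*"
    by (auto simp: graph_components_def quotient_def)
  from s0(2) show "t \<in> J"
    by (induction rule: rtrancl_induct) (use s0 in \<open>auto simp: coxeter_edges_def\<close>)
qed

lemma graph_component_separated:
  assumes "C \<in> graph_components m J" "x \<in> C" "y \<in> J - C"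
  shows "\<not> m x y \<ge> 3"
proof
  assume "m x y \<ge> 3"
  moreover have "x \<in> J" using graph_component_subset assms by blast
  ultimately have "(x, y) \<in> coxeter_edges m J" using assms by (auto simp: coxeter_edges_def)
  then show False using assms by (auto simp: graph_components_def quotient_def intro: rtrancl_into_rtrancl)
qed

lemma graph_component_of:
  assumes "s \<in> J" obtains C where "C \<in> graph_components m J" "s \<in> C"
  using assms that[of "(coxeter_edges m J)\<^sup>* `` {s}"]
  by (auto simp: graph_components_def quotient_def)

sublocale coxeter_system \<subseteq> coxeter_data S m
  using finite_rank matrix by unfold_locales

context coxeter_system
begin

section \<open>Words and group elements\<close>

lemma word_value_Cons: "word_value W (s # u) = s \<otimes> word_value W u"
  by (simp add: word_value_def)

lemma word_value_closed: "u \<in> lists S \<Longrightarrow> word_value W u \<in> carrier W"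
proof (induction u rule: list.induct)
  case (Cons s u)
  then show ?case using generators_closed by (auto simp: word_value_Cons)
qed (simp add: word_value_def)

lemma word_value_append:
  "u \<in> lists S \<Longrightarrow> v \<in> lists S \<Longrightarrow> word_value W (u @ v) = word_value W u \<otimes> word_value W v"
proof (induction u rule: list.induct)
  case Nil
  then show ?case using word_value_closed[of v] by (simp add: word_value_def[of W "[]"])
next
  case (Cons s u)
  then have "s \<in> carrier W" "u \<in> lists S" using generators_closed by auto
  then show ?case using Cons word_value_closed[of u] word_value_closed[of v]
    by (simp add: word_value_Cons m_assoc)
qed

lemma word_value_wpow: "u \<in> lists S \<Longrightarrow> word_value W (wpow k u) = word_value W u [^] k"
proof (induction k)
  case 0
  then show ?case by (simp add: wpow_def word_value_def)
next
  case (Suc k)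
  then show ?case using word_value_append[of "wpow k u" u] wpow_lists[of u k] wpow_add[of k 1 u]
    by (simp add: wpow_def)
qed

lemma presentation_map:
  obtains \<phi> where "\<phi> \<in> iso (coxeter_group S m) W"
    "\<And>u. u \<in> lists S \<Longrightarrow> \<phi> (coxeter_cong S m `` {u}) = word_value W u"
proof -
  obtain \<phi> where \<phi>: "\<phi> \<in> iso (coxeter_group S m) W" "\<forall>s\<in>S. \<phi> (coxeter_cong S m `` {[s]}) = s"
    using presentation by blast
  interpret G: group "coxeter_group S m" by (rule group_coxeter_group[OF matrix])
  interpret h: group_hom "coxeter_group S m" W \<phi>
    by unfold_locales (use \<phi> in \<open>auto simp: iso_def\<close>)
  have cl: "coxeter_cong S m `` {u} \<in> carrier (coxeter_group S m)" if "u \<in> lists S" for u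
    using that by (simp add: coxeter_group_def quotientI)
  have "\<phi> (coxeter_cong S m `` {u}) = word_value W u" if "u \<in> lists S" for u
    using that
  proof (induction u rule: list.induct)
    case Nil
    have "coxeter_cong S m `` {[]} = \<one>\<^bsub>coxeter_group S m\<^esub>" by (simp add: coxeter_group_def)
    then show ?case using h.hom_one by (simp add: word_value_def)
  next
    case (Cons s u)
    then have "coxeter_cong S m `` {s # u} =
        (coxeter_cong S m `` {[s]}) \<otimes>\<^bsub>coxeter_group S m\<^esub> (coxeter_cong S m `` {u})"
      using coxeter_group_mult_class[of "[s]" S u m] by simp
    then show ?case using Cons h.hom_mult[OF cl[of "[s]"] cl[of u]] \<phi>(2) by (simp add: word_value_Cons)
  qed
  then show ?thesis using that \<phi>(1) by blast
qed

lemma word_value_eq_iff: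
  assumes "u \<in> lists S" "v \<in> lists S"
  shows "word_value W u = word_value W v \<longleftrightarrow> eqv u v"
proof -
  obtain \<phi> where \<phi>: "\<phi> \<in> iso (coxeter_group S m) W"
    "\<And>u. u \<in> lists S \<Longrightarrow> \<phi> (coxeter_cong S m `` {u}) = word_value W u"
    using presentation_map by blast
  have inj: "inj_on \<phi> (lists S // coxeter_cong S m)"
    using \<phi>(1) by (auto simp: iso_def bij_betw_def coxeter_group_def)
  have "word_value W u = word_value W v \<longleftrightarrow> \<phi> (coxeter_cong S m `` {u}) = \<phi> (coxeter_cong S m `` {v})"
    using \<phi>(2) assms by simp
  also have "\<dots> \<longleftrightarrow> coxeter_cong S m `` {u} = coxeter_cong S m `` {v}"
    using inj_on_eq_iff[OF inj] assms by (simp add: quotientI)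
  also have "\<dots> \<longleftrightarrow> eqv u v"
    using eq_equiv_class_iff[OF equiv_coxeter_cong assms] .
  finally show ?thesis .
qed

lemma word_value_eqv: "eqv u v \<Longrightarrow> word_value W v = word_value W u"
  using word_value_eq_iff[of u v] eqv_lists[of u v] by simp

lemma word_value_surj:
  assumes "w \<in> carrier W"
  obtains u where "u \<in> lists S" "word_value W u = w"
proof -
  obtain \<phi> where \<phi>: "\<phi> \<in> iso (coxeter_group S m) W"
    "\<And>u. u \<in> lists S \<Longrightarrow> \<phi> (coxeter_cong S m `` {u}) = word_value W u"
    using presentation_map by blast
  have "w \<in> \<phi> ` (lists S // coxeter_cong S m)"
    using \<phi>(1) assms by (auto simp: iso_def bij_betw_def coxeter_group_def)
  then obtain u where u: "u \<in> lists S" "w = \<phi> (coxeter_cong S m `` {u})"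
    by (auto simp: quotient_def)
  then show ?thesis using that[OF u(1)] \<phi>(2)[OF u(1)] by simp
qed

lemma len_word_value:
  assumes "red u"
  shows "len W S (word_value W u) = length u"
  unfolding len_def
proof (rule Least_equality)
  show "\<exists>v\<in>expressions W S (word_value W u). length v = length u"
    using red_lists[OF assms] by (auto simp: expressions_def)
  fix n assume "\<exists>v\<in>expressions W S (word_value W u). length v = n"
  then obtain v where v: "v \<in> lists S" "word_value W v = word_value W u" "length v = n"
    by (auto simp: expressions_def)
  then have "eqv u v" using word_value_eq_iff[OF red_lists[OF assms] v(1)] by simp
  then show "length u \<le> n" using assms v(3) by (auto simp: red_def)
qed

lemma reduced_expressions_iff: "u \<in> reduced_expressions W S w \<longleftrightarrow> red u \<and> word_value W u = w"
proof
  assume u: "u \<in> reduced_expressions W S w"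
  then have uS: "u \<in> lists S" "word_value W u = w" "length u = len W S w"
    by (auto simp: reduced_expressions_def expressions_def)
  have "length u \<le> length v" if "eqv u v" for v
  proof -
    have "v \<in> expressions W S w"
      using uS eqv_lists[OF that] word_value_eqv[OF that] by (auto simp: expressions_def)
    then show ?thesis unfolding uS(3) len_def by (intro Least_le) blast
  qed
  then show "red u \<and> word_value W u = w" using uS by (simp add: red_def)
next
  assume "red u \<and> word_value W u = w"
  then show "u \<in> reduced_expressions W S w"
    using len_word_value[of u] by (auto simp: reduced_expressions_def expressions_def red_def)
qed

lemma len_le:
  assumes "u \<in> lists S" shows "len W S (word_value W u) \<le> length u"
  unfolding len_def by (rule Least_le) (use assms in \<open>auto simp: expressions_def\<close>)

lemma reduced_expression_exists:
  assumes "w \<in> carrier W"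
  obtains u where "u \<in> reduced_expressions W S w"
proof -
  obtain v where v: "v \<in> lists S" "word_value W v = w" using word_value_surj[OF assms] .
  obtain u where u: "eqv v u" "red u" using reduced_representative[OF v(1)] .
  then have "word_value W u = w" using word_value_eqv[OF u(1)] v by simp
  then show ?thesis using that u reduced_expressions_iff by blast
qed

lemma torsion_free_if_logarithmic:
  assumes log: "logarithmic W S w"
  shows "torsion_free W S m w"
  unfolding torsion_free_def
proof
  fix C assume C: "C \<in> graph_components m (supp W S w)"
  show "infinite (carrier (coxeter_group C m))"
  proof
    assume fin: "finite (carrier (coxeter_group C m))"
    have supp_S: "supp W S w \<subseteq> S"
      using reduced_expressions_iff red_lists by (auto simp: supp_def in_lists_conv_set)
    have CS: "C \<subseteq> S" using graph_component_subset[OF C] supp_S by blast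
    obtain s0 where "s0 \<in> C" "s0 \<in> supp W S w"
      using C by (auto simp: graph_components_def quotient_def)
    then obtain u where u: "u \<in> reduced_expressions W S w" "s0 \<in> set u" by (auto simp: supp_def)
    have r: "red u" and w: "word_value W u = w" using u reduced_expressions_iff by auto
    have uS: "u \<in> lists S" using red_lists[OF r] .
    have set_u: "set u \<subseteq> supp W S w" using u by (auto simp: supp_def)
    let ?v = "filter (\<lambda>x. x \<in> C) u" and ?v' = "filter (\<lambda>x. x \<notin> C) u"
    have "?v \<in> lists C" by auto
    then obtain k where k: "k \<ge> 1" "eqv (wpow k ?v) []" using finite_order[OF CS fin] by blast
    have set_pow: "set (wpow k u) \<subseteq> set u" by (auto simp: wpow_def)
    \<comment> \<open>The letters of \<open>C\<close> commute with the rest of the support, so the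
      power splits. Its part in \<open>C\<close> is trivial by the choice of \<open>k\<close>, and
      the other part has fewer than \<open>k * length u\<close> letters.\<close>
    have "eqv (wpow k u) (filter (\<lambda>x. x \<in> C) (wpow k u) @ filter (\<lambda>x. x \<notin> C) (wpow k u))"
    proof (rule eqv_filter_split[OF wpow_lists[OF uS]])
      fix x y assume xy: "x \<in> set (wpow k u)" "y \<in> set (wpow k u)" "x \<in> C" "y \<notin> C"
      then have "\<not> m x y \<ge> 3" using graph_component_separated[OF C] set_pow set_u by blast
      then show "m x y = 2"
        using m_not_adj[of x y] xy set_pow set_u supp_S by (auto simp: adj_def)
    qed
    then have e: "eqv (wpow k u) (wpow k ?v @ wpow k ?v')" by (simp add: filter_wpow)
    have "wpow k ?v' \<in> lists S" using uS by (intro wpow_lists) (auto simp: in_lists_conv_set)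
    then have "eqv (wpow k ?v @ wpow k ?v') ([] @ wpow k ?v')"
      using k(2) by (intro eqv_append coxeter_cong.refl)
    with e have e: "eqv (wpow k u) (wpow k ?v')" by (auto intro: coxeter_cong.trans)
    have "k * length u = k * len W S w" using len_word_value[OF r] w by simp
    also have "\<dots> = len W S (w [^] k)" using log k(1) by (simp add: logarithmic_def)
    also have "\<dots> = len W S (word_value W (wpow k ?v'))"
      using word_value_eq_iff[OF wpow_lists[OF uS]] e eqv_lists[OF e] word_value_wpow[OF uS] w by metis
    also have "\<dots> \<le> k * length ?v'" using len_le[of "wpow k ?v'"] eqv_lists[OF e] length_wpow by metis
    also have "\<dots> < k * length u"
    proof -
      have "length ?v' < length u"
        using u(2) \<open>s0 \<in> C\<close> by (intro length_filter_less[of s0]) auto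
      then show ?thesis using k(1) by simp
    qed
    finally show False by simp
  qed
qed

lemma supp_FC:
  assumes "w \<in> FC W S m" "u \<in> reduced_expressions W S w"
  shows "supp W S w = set u"
proof -
  have "set v = set u" if "v \<in> reduced_expressions W S w" for v
    using assms that comm_eqv[of u v] reduced_expressions_iff red_lists by (auto simp: FC_def)
  then show ?thesis using assms(2) unfolding supp_def by blast
qed

text \<open>A braid move keeps the word reduced but interchanges the roles of \<open>s\<close> and
  \<open>t\<close>, which commutations cannot do unless the label is 2.\<close>

lemma FC_no_braid:
  assumes x: "x \<in> FC W S m" and z: "z \<in> reduced_expressions W S x"
    and c: "comm z (P @ alt s t r @ Q)" and st: "s \<in> S" "t \<in> S" "s \<noteq> t" "m s t = enat r" "r \<noteq> 2"
    and PQ: "P \<in> lists S" "Q \<in> lists S"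
  shows False
proof -
  let ?u = "P @ alt s t r @ Q" and ?v = "P @ alt t s r @ Q"
  have zr: "red z" "word_value W z = x" using z reduced_expressions_iff by auto
  have zu: "eqv z ?u" "length ?u = length z" using comm_eqv[OF c] red_lists[OF zr(1)] by auto
  have uv: "eqv ?u ?v" using PQ st by (intro eqv_append coxeter_cong.refl eqv_braid)
  then have zv: "eqv z ?v" using zu by (auto intro: coxeter_cong.trans)
  have "?u \<in> reduced_expressions W S x" "?v \<in> reduced_expressions W S x"
    using red_eqv[OF zr(1) zu(1)] red_eqv[OF zr(1) zv] zu(2) zr zu(1) zv
      word_value_eqv[OF zu(1)] word_value_eqv[OF zv] reduced_expressions_iff by auto
  then have uv_comm: "comm ?u ?v" using x by (auto simp: FC_def)
  have "m s t \<noteq> 2" using st by (auto simp: numeral_eq_enat)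
  then have "filter (\<lambda>x. x \<in> {s, t}) ?u = filter (\<lambda>x. x \<in> {s, t}) ?v"
    using comm_filter[OF uv_comm] st by blast
  then have "filter (\<lambda>x. x \<in> {s, t}) (alt s t r) = filter (\<lambda>x. x \<in> {s, t}) (alt t s r)" by simp
  moreover have "filter (\<lambda>x. x \<in> {s, t}) (alt s t r) = alt s t r"
    "filter (\<lambda>x. x \<in> {s, t}) (alt t s r) = alt t s r"
    using set_alt[of s t r] set_alt[of t s r] by (auto simp: filter_id_conv)
  ultimately have "alt s t r = alt t s r" by simp
  moreover have "r \<noteq> 0" using m_ge_2[OF st(1-3)] st(4) by (auto simp: numeral_eq_enat)
  ultimately show False using st(3) by (cases r) auto
qed

lemma logarithmic_if_torsion_free:
  assumes w: "w \<in> CFC W S m" and tf: "torsion_free W S m w"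
  shows "logarithmic W S w"
proof -
  have wW: "w \<in> carrier W" using w by (simp add: CFC_def)
  obtain u where u: "u \<in> reduced_expressions W S w" using reduced_expression_exists[OF wW] .
  have ur: "red u" and uw: "word_value W u = w" using u reduced_expressions_iff by auto
  have uS: "u \<in> lists S" using red_lists[OF ur] .
  have powers: "logarithmic W S w" if "\<And>k. red (wpow k u)"
    unfolding logarithmic_def
    using len_word_value[OF that] len_word_value[OF ur] word_value_wpow[OF uS] uw length_wpow by metis
  show ?thesis
  proof (cases "u = []")
    case True
    have "wpow k [] = []" for k by (induction k) (auto simp: wpow_def)
    then show ?thesis using powers True ur by simp
  next
    case False
    define n where "n = length u"
    have n: "n > 0" using False by (simp add: n_def)
    define f where "f k = u ! (k mod n)" for k
    interpret periodic_sequence S m f n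
      by unfold_locales (use uS n in \<open>auto simp: f_def n_def in_lists_conv_set\<close>)
    have range: "range f = set u"
    proof
      show "range f \<subseteq> set u" using n by (auto simp: f_def n_def)
      show "set u \<subseteq> range f"
      proof
        fix x assume "x \<in> set u"
        then obtain k where "k < n" "u ! k = x" by (auto simp: in_set_conv_nth n_def)
        then show "x \<in> range f" by (auto simp: f_def intro!: image_eqI[of _ _ k])
      qed
    qed
    have window: "map f [i..<i + n] = rotate i u" for i
      by (rule nth_equalityI) (auto simp: f_def n_def nth_rotate add.commute)
    have windowFC: "\<exists>x\<in>FC W S m. map f [i..<i + n] \<in> reduced_expressions W S x" for i
      using w u window by (auto simp: CFC_def)
    then have window_red: "red (map f [i..<i + n])" for i using reduced_expressions_iff by blast
    have supp: "supp W S w = set u"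
    proof -
      obtain x where x: "x \<in> FC W S m" "rotate 0 u \<in> reduced_expressions W S x"
        using w u unfolding CFC_def by blast
      then have "x = w" using uw reduced_expressions_iff by simp
      then show ?thesis using supp_FC x u by blast
    qed
    have ne: "no_empty_gap (range f)"
      unfolding no_empty_gap_def
    proof (intro allI impI notI)
      fix i1 i assume i: "consec i1 i" "i < i1 + n" "gap (range f) i1 i = {}"
      have lt: "i1 < i" "f i1 = f i" using i(1) by (auto simp: consec_def)
      let ?A = "map f [Suc i1..<i]" and ?B = "map f [Suc i..<i1 + n]"
      have "[i1..<i1 + n] = i1 # [Suc i1..<i] @ i # [Suc i..<i1 + n]"
        using lt i(2) upt_add_eq_append[of "Suc i1" i "i1 + n - i"]
        by (simp add: upt_conv_Cons)
      then have w1: "map f [i1..<i1 + n] = f i # ?A @ f i # ?B" using lt by simp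
      have AS: "?A \<in> lists S" "?B \<in> lists S" using f_in by (auto simp: in_lists_conv_set)
      have "m (f i) x = 2" if "x \<in> set ?A" for x
      proof -
        obtain k where k: "x = f k" "i1 < k" "k < i" using \<open>x \<in> set ?A\<close> by auto
        have "f k \<noteq> f i" using i(1) k by (auto simp: consec_def)
        moreover have "\<not> adj (f k) (f i)" using i(3) k by (auto simp: gap_def)
        ultimately show ?thesis using m_not_adj[of "f i" "f k"] adj_sym[OF f_in f_in, of i k] f_in k by auto
      qed
      then have "comm (?A @ [f i]) (f i # ?A)" by (intro comm_letter_word f_in AS)
      then have "comm ([f i] @ (?A @ [f i]) @ ?B) ([f i] @ (f i # ?A) @ ?B)"
        using AS f_in by (intro comm_append) auto
      then have "eqv (map f [i1..<i1 + n]) ([] @ [f i, f i] @ ?A @ ?B)"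
        "length ([] @ [f i, f i] @ ?A @ ?B) = length (map f [i1..<i1 + n])"
        using comm_eqv red_lists[OF window_red[of i1]] unfolding w1 by fastforce+
      then have "red ([] @ [f i, f i] @ ?A @ ?B)" using red_eqv[OF window_red] by simp
      then show False using not_red_square by blast
    qed
    have nb: "no_short_braid (range f)"
      unfolding no_short_braid_def
    proof (intro allI impI)
      fix c r assume c: "cchain (range f) c r" and r: "enat r = m (f (c 0)) (f (c 1))"
      show "c 0 + n \<le> c (r - 1)"
      proof (rule ccontr)
        assume short: "\<not> c 0 + n \<le> c (r - 1)"
        have "adj (f (c 0)) (f (c 1))" using c by (simp add: cchain_def linked_def)
        then have r3: "r \<ge> 3" using r[symmetric] by (simp add: adj_def numeral_eq_enat)
        obtain P Q where PQ: "P \<in> lists S" "Q \<in> lists S"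
          "comm (map f [c 0..<c (r - 1) + 1]) (P @ alt (f (c 0)) (f (c 1)) r @ Q)"
        proof (rule chain_window_comm[of r c "f (c 0)" "f (c 1)"])
          show "linked (c j) (c (j + 1))" if "j + 1 < r" for j using cchain_linked[OF c that] .
          show "consec (c j) (c (j + 2)) \<and> gap (range f) (c j) (c (j + 2)) = {c (j + 1)}" if "j + 2 < r" for j
            using cchain_consec[OF c that] cchain_gap[OF c that] by blast
          show "f (c j) = (if even j then f (c 0) else f (c 1))" if "j < r" for j
            using cchain_letter[OF c that] .
        qed (use r3 in auto)
        let ?Y = "map f [c (r - 1) + 1..<c 0 + n]"
        have le: "c 0 \<le> c (r - 1) + 1" using cchain_less[OF c, of 0 "r - 1"] r3 by simp
        have "[c 0..<c 0 + n] = [c 0..<c (r - 1) + 1] @ [c (r - 1) + 1..<c 0 + n]"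
        proof -
          have "c (r - 1) + 1 \<le> c 0 + n" using short by simp
          from upt_add_eq_append[OF le, of "c 0 + n - (c (r - 1) + 1)", unfolded le_add_diff_inverse[OF this]]
          show ?thesis .
        qed
        then have w1: "map f [c 0..<c 0 + n] = [] @ map f [c 0..<c (r - 1) + 1] @ ?Y" by simp
        have YS: "?Y \<in> lists S" using f_in by (auto simp: in_lists_conv_set)
        have "comm ([] @ map f [c 0..<c (r - 1) + 1] @ ?Y) ([] @ (P @ alt (f (c 0)) (f (c 1)) r @ Q) @ ?Y)"
          by (rule comm_append[OF PQ(3)]) (use YS in auto)
        then have cm: "comm (map f [c 0..<c 0 + n]) (P @ alt (f (c 0)) (f (c 1)) r @ (Q @ ?Y))"
          unfolding w1 by simp
        obtain x where x: "x \<in> FC W S m" "map f [c 0..<c 0 + n] \<in> reduced_expressions W S x"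
          using windowFC by blast
        show False
          by (rule FC_no_braid[OF x cm f_in f_in cchain_letters_neq[OF c] r[symmetric]])
            (use r3 PQ YS in auto)
      qed
    qed
    have straight_component: "straight_on C" if C: "C \<in> graph_components m (range f)" for C
    proof -
      have CR: "C \<subseteq> range f" using graph_component_subset[OF C] .
      have CS: "C \<subseteq> S" using CR f_in by auto
      have fin: "finite C" using CS finite_S finite_subset by blast
      \<comment> \<open>No edge leaves a component, so the attachment condition of
        \<open>removal\<close> holds vacuously.\<close>
      have att: "single y" if "x \<in> range f - C" "y \<in> C" "adj x y" for x y
      proof -
        have "adj y x" using that adj_sym[of x y] CR f_in by auto
        then show ?thesis using graph_component_separated[OF C that(2,1)] by (simp add: adj_def)
      qed
      have rem: "no_empty_gap C" "no_short_braid C" using removal(1,2)[OF ne nb CR] att by blast+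
      have conn: "connected C"
        unfolding connected_def adj_def
        using graph_component_connected[OF C] m_sym f_in by (metis rangeE)
      interpret Cox: coxeter_data C m
      proof
        show "finite C" by (rule fin)
        show "coxeter_matrix C m" using cmatrix CS by (auto simp: coxeter_matrix_def)
      qed
      have inf: "infinite (carrier (coxeter_group C m))"
        using tf C supp range by (simp add: torsion_free_def)
      obtain y where y: "\<And>s. s \<in> C \<Longrightarrow> y s \<ge> 0" "\<exists>s\<in>C. y s > 0"
        "\<And>s. s \<in> C \<Longrightarrow> (\<Sum>t\<in>C. a s t * y t) \<ge> 0"
        using Cox.subsolution_if_infinite[OF inf] unfolding Cox.a_def a_def by metis
      \<comment> \<open>The inequalities for \<open>y\<close> at \<open>s\<close> and
        \<open>t\<close> add up to \<open>2 * (y s + y t) \<le> a s t * (y s + y t)\<close>,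
        impossible for a finite label, where \<open>a s t < 2\<close>.\<close>
      have nfd: "not_finite_dihedral C"
        unfolding not_finite_dihedral_def
      proof (intro allI impI)
        fix s t assume st: "C = {s, t}" "s \<noteq> t"
        show "m s t = \<infinity>"
        proof (rule ccontr)
          assume "m s t \<noteq> \<infinity>"
          then obtain k where k: "m s t = enat k" by auto
          have S: "s \<in> S" "t \<in> S" using st CS by auto
          have "k \<ge> 2" using m_ge_2[OF S st(2)] k by (simp add: numeral_eq_enat)
          then have A: "a s t < 2" "a s t \<ge> 0" "a t s = a s t" "a s s = -2" "a t t = -2"
            using angle_coeff_lt_2 k a_nonneg[OF S st(2)] a_sym S a_self by (auto simp: a_def[of s t])
          have 1: "2 * y s \<le> a s t * y t" and 2: "2 * y t \<le> a s t * y s"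
            using y(3)[of s] y(3)[of t] st A by auto
          have nn: "y s \<ge> 0" "y t \<ge> 0" using y(1) st by auto
          have "y s + y t > 0" using y(2) nn st by auto
          then have "a s t * (y s + y t) < 2 * (y s + y t)" by (rule mult_strict_right_mono[OF A(1)])
          then show False using 1 2 by (simp add: algebra_simps)
        qed
      qed
      show ?thesis
      proof (cases "\<exists>z\<in>C. \<not> single z \<and> \<not> in_large_band C z")
        case True
        then show ?thesis
          using straight_on_if_repeated_letter[OF fin CR rem conn nfd] by blast
      next
        case False
        then show ?thesis
          using straight_on_if_single_or_large_band[OF fin CR conn nfd _ y] by blast
      qed
    qed
    have "straight_on (range f)"
    proof (rule straight_onI)
      fix i
      obtain C where C: "C \<in> graph_components m (range f)" "f i \<in> C"
        using graph_component_of[of "f i" "range f" m] by blast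
      have "fired (range f) i = fired C i"
      proof (rule fired_component[OF graph_component_subset[OF C(1)] _ _ C(2)])
        show "\<not> adj y x" if "x \<in> range f - C" "y \<in> C" for x y
          using graph_component_separated[OF C(1) that(2,1)] by (simp add: adj_def)
      qed (use f_in in auto)
      then show "fired (range f) i > 0" using straight_on_fired_pos[OF straight_component[OF C(1)] C(2)] by simp
    qed
    moreover have "prefix_on (range f) (k * n) = wpow k u" for k
    proof (induction k)
      case 0
      then show ?case by (simp add: prefix_on_def wpow_def)
    next
      case (Suc k)
      have "map f [k * n..<k * n + n] = u"
        by (rule nth_equalityI) (auto simp: f_def n_def)
      moreover have "[0..<Suc k * n] = [0..<k * n] @ [k * n..<k * n + n]"
        using upt_add_eq_append[of 0 "k * n" n] by (simp add: add.commute)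
      ultimately have "prefix_on (range f) (Suc k * n) = prefix_on (range f) (k * n) @ u"
        using range by (simp add: prefix_on_def)
      then show ?case using Suc wpow_add[of k 1 u] by (simp add: wpow_def)
    qed
    ultimately show ?thesis using powers by (metis straight_on_def)
  qed
qed

end

theorem corollary7p2:
  fixes W :: "('a, 'b) monoid_scheme" and S :: "'a set" and m :: "'a \<Rightarrow> 'a \<Rightarrow> enat" and w :: 'a
  assumes "coxeter_system W S m"
    and "\<not> (\<exists>s\<in>S. large_odd_endpoint S m s)"
    and "w \<in> CFC W S m"
  shows "logarithmic W S w \<longleftrightarrow> torsion_free W S m w"
proof -
  interpret coxeter_system W S m by (rule assms(1))
  show ?thesis using torsion_free_if_logarithmic logarithmic_if_torsion_free[OF assms(3)] by blast
qed

end
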